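(* Let $T$ be an aperiodic countable-to-one measure-preserving Borel transformation on a standard probability space $(X,\mu)$. Let $E_T$ denote the induced orbit equivalence relation and let $(x,y)\mapsto\rho_x(y):E_T\to\mathbb{R}^+$ be the Radon--Nikodym cocycle of $E_T$ with respect to $\mu$. For any $1\le p<\infty$ and $f\in L^p(X,\mu)$, \[ \lim_{n\to\infty}\frac{1}{n+1}\sum_{i=0}^n\ \sum_{y\in T^{-i}(x)}f(y)\rho_x(y)=\overline{f}(x)\quad\text{a.e. and in }L^p, \] where $\overline{f}$ is the conditional expectation of $f$ with respect to the $\sigma$-algebra of $T$-invariant Borel sets.
   Context: $\mathbb{N}$ includes $0$. $T$ is aperiodic if $T^n(x)\ne x$ for all $x\in X$ and $n\ge1$; countable-to-one if all $T^{-1}(x)$ are countable. $x\,E_T\,y$ iff $T^n(x)=T^m(y)$ for some $n,m\in\mathbb{N}$. A countable Borel equivalence relation $E$ on $(X,\mu)$ is null-preserving if for every partial Borel injection $\gamma$ on $X$ with graph contained in $E$, $\mathrm{dom}(\gamma)$ is null iff $\mathrm{im}(\gamma)$ is null. Standing assumption (which can be arranged by discarding a null set): $T$ is surjective and $E_T$ is null-preserving. The Radon--Nikodym cocycle of $E$ with respect to $\mu$ is the a.e. unique Borel function $\rho:E\to\mathbb{R}^+$, $(x,y)\mapsto\rho_x(y)$, with $\rho_x(y)\rho_y(z)=\rho_x(z)$ and $\int_{\mathrm{im}(\gamma)}h\,d\mu=\int_{\mathrm{dom}(\gamma)}h(\gamma(x))\rho_x(\gamma(x))\,d\mu(x)$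 for all $h\in L^1(X,\mu)$ and all partial Borel injections $\gamma$ with graph contained in $E$. *)

theory Defs
  imports "HOL-Probability.Probability"
begin

text \<open>A standard Borel space: the \<open>\<sigma>\<close>-algebra is the Borel \<open>\<sigma>\<close>-algebra of some Polish topology
  on the underlying set.\<close>

definition standard_borel :: "'a measure \<Rightarrow> bool" where
  "standard_borel M \<longleftrightarrow>
     (\<exists>\<tau>. topspace \<tau> = space M \<and> completely_metrizable_space \<tau> \<and> second_countable \<tau> \<and>
          sets M = sigma_sets (space M) {U. openin \<tau> U})"

definition standard_prob_space :: "'a measure \<Rightarrow> bool" where
  "standard_prob_space M \<longleftrightarrow> prob_space M \<and> standard_borel M"

definition measure_preserving_map :: "'a measure \<Rightarrow> ('a \<Rightarrow> 'a) \<Rightarrow> bool" where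
  "measure_preserving_map M T \<longleftrightarrow>
     T \<in> measurable M M \<and> (\<forall>A\<in>sets M. emeasure M (T -` A \<inter> space M) = emeasure M A)"

definition fibre :: "'a measure \<Rightarrow> ('a \<Rightarrow> 'a) \<Rightarrow> nat \<Rightarrow> 'a \<Rightarrow> 'a set" where
  "fibre M T i x = {y \<in> space M. (T ^^ i) y = x}"

definition aperiodic :: "'a measure \<Rightarrow> ('a \<Rightarrow> 'a) \<Rightarrow> bool" where
  "aperiodic M T \<longleftrightarrow> (\<forall>x\<in>space M. \<forall>n\<ge>1. (T ^^ n) x \<noteq> x)"

definition countable_to_one :: "'a measure \<Rightarrow> ('a \<Rightarrow> 'a) \<Rightarrow> bool" where
  "countable_to_one M T \<longleftrightarrow> (\<forall>x\<in>space M. countable (fibre M T 1 x))"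

definition orbit_rel :: "'a measure \<Rightarrow> ('a \<Rightarrow> 'a) \<Rightarrow> ('a \<times> 'a) set" where
  "orbit_rel M T = {(x, y). x \<in> space M \<and> y \<in> space M \<and> (\<exists>n m. (T ^^ n) x = (T ^^ m) y)}"

text \<open>Partial Borel injections with domain \<open>A\<close> and graph contained in \<open>E\<close>. On a standard Borel
  space the image \<open>\<gamma> ` A\<close> is then automatically Borel (Lusin--Souslin).\<close>

definition partial_borel_injection ::
  "'a measure \<Rightarrow> ('a \<times> 'a) set \<Rightarrow> 'a set \<Rightarrow> ('a \<Rightarrow> 'a) \<Rightarrow> bool" where
  "partial_borel_injection M E A \<gamma> \<longleftrightarrow>
     A \<in> sets M \<and> \<gamma> \<in> measurable (restrict_space M A) M \<and> inj_on \<gamma> A \<and> (\<forall>x\<in>A. (x, \<gamma> x) \<in> E)"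

definition null_preserving :: "'a measure \<Rightarrow> ('a \<times> 'a) set \<Rightarrow> bool" where
  "null_preserving M E \<longleftrightarrow>
     (\<forall>A \<gamma>. partial_borel_injection M E A \<gamma> \<longrightarrow> (A \<in> null_sets M \<longleftrightarrow> \<gamma> ` A \<in> null_sets M))"

text \<open>\<open>\<rho> x y\<close> stands for \<open>\<rho>\<^sub>x(y)\<close>; only its values on \<open>E\<close> matter. As Bochner integrals
  of non-integrable functions are \<open>0\<close> in HOL, integrability of the right-hand side is stated
  separately.\<close>

definition radon_nikodym_cocycle ::
  "'a measure \<Rightarrow> ('a \<times> 'a) set \<Rightarrow> ('a \<Rightarrow> 'a \<Rightarrow> real) \<Rightarrow> bool" where
  "radon_nikodym_cocycle M E \<rho> \<longleftrightarrow>
     (\<lambda>(x, y). \<rho> x y) \<in> borel_measurable (restrict_space (M \<Otimes>\<^sub>M M) E) \<and>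
     (\<forall>(x, y)\<in>E. \<rho> x y > 0) \<and>
     (\<forall>x y z. (x, y) \<in> E \<and> (y, z) \<in> E \<longrightarrow> \<rho> x y * \<rho> y z = \<rho> x z) \<and>
     (\<forall>h A \<gamma>. integrable M (h :: 'a \<Rightarrow> real) \<and> partial_borel_injection M E A \<gamma> \<longrightarrow>
        set_integrable M A (\<lambda>x. h (\<gamma> x) * \<rho> x (\<gamma> x)) \<and>
        (LINT y:\<gamma> ` A|M. h y) = (LINT x:A|M. h (\<gamma> x) * \<rho> x (\<gamma> x)))"

definition in_Lp :: "'a measure \<Rightarrow> real \<Rightarrow> ('a \<Rightarrow> real) \<Rightarrow> bool" where
  "in_Lp M p f \<longleftrightarrow> f \<in> borel_measurable M \<and> integrable M (\<lambda>x. \<bar>f x\<bar> powr p)"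

text \<open>Elements of \<open>L\<^sup>p\<close> are classes of a.e. equal functions, so each \<open>F n\<close> (possibly defined
  only a.e.) is replaced by a Borel representative \<open>G n\<close>.\<close>

definition tendsto_Lp ::
  "'a measure \<Rightarrow> real \<Rightarrow> (nat \<Rightarrow> 'a \<Rightarrow> real) \<Rightarrow> ('a \<Rightarrow> real) \<Rightarrow> bool" where
  "tendsto_Lp M p F g \<longleftrightarrow> in_Lp M p g \<and>
     (\<exists>G. (\<forall>n. in_Lp M p (G n) \<and> (AE x in M. F n x = G n x)) \<and>
          (\<lambda>n. (LINT x|M. \<bar>G n x - g x\<bar> powr p) powr (1 / p)) \<longlonglongrightarrow> 0)"

definition invariant_algebra :: "'a measure \<Rightarrow> ('a \<Rightarrow> 'a) \<Rightarrow> 'a measure" where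
  "invariant_algebra M T = sigma (space M) {A \<in> sets M. T -` A \<inter> space M = A}"

text \<open>The sums over \<open>T\<^sup>-\<^sup>i(x)\<close> are countable and unordered, taken with \<open>infsum\<close>,
  which returns \<open>0\<close> for a divergent sum.\<close>

definition backward_average ::
  "'a measure \<Rightarrow> ('a \<Rightarrow> 'a) \<Rightarrow> ('a \<Rightarrow> 'a \<Rightarrow> real) \<Rightarrow> ('a \<Rightarrow> real) \<Rightarrow> nat \<Rightarrow> 'a \<Rightarrow> real" where
  "backward_average M T \<rho> f n x =
     1 / real (n + 1) * (\<Sum>i=0..n. \<Sum>\<^sub>\<infinity>y\<in>fibre M T i x. f y * \<rho> x y)"

end

theory Submission
  imports Defs
begin

text \<open>Let \<open>P\<close> be the transfer operator of \<open>T\<close>: the operator on integrable functions that is adjoint to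
composition with \<open>T\<close>, so that \<open>P f\<close> has over a measurable set \<open>A\<close> the integral that \<open>f\<close> has over the
preimage of \<open>A\<close>. It is positive, it preserves integrals, and it fixes the constants because \<open>T\<close>
preserves \<open>M\<close>. The theorem follows from an identity, \<open>(P ^^ i) f x = (\<Sum>\<^sub>\<infinity>y\<in>fibre M T i x. f y * \<rho> x y)\<close>
for almost every \<open>x\<close>, and from an ergodic theorem for the averages of the iterates \<open>(P ^^ i) f\<close>.

The identity (\<open>fibre_sum\<close>). Let \<open>S = T ^^ i\<close>. Cut the space into countably many Borel pieces on which
\<open>S\<close> is injective, up to a rest whose image under \<open>S\<close> is null. On a piece \<open>A\<close>, the inverse of \<open>S\<close> is a
partial Borel injection inside the orbit relation, and the change of variables formula for the
cocycle turns the integral of \<open>f\<close> over \<open>A\<close> into an integral over \<open>S ` A\<close> against \<open>\<rho>\<close>. The sum over the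
pieces has the defining property of \<open>(P ^^ i) f\<close>. The pieces are found by exhausting the measure
(\<open>ex_injective_pieces\<close>). If the rest \<open>R\<close> had a nonnull image, then \<open>S\<close> would have a Borel section
\<open>s : B \<rightarrow> R\<close> over a nonnull Borel set \<open>B\<close>, and \<open>s ` B\<close> would be one more piece, nonnull because the
relation is null-preserving. That images of pieces are Borel follows from the cocycle identity
for the constant function \<open>1\<close>: an image outside the \<open>\<sigma>\<close>-algebra would make one side zero and the
other positive, unless the piece is null (\<open>image_in_sets\<close>).

The section (\<open>ex_measurable_section\<close>) is the almost everywhere form of the selection theorem of
Jankov and von Neumann. A Borel set is a continuous image of a closed subset of Baire space, and
the cover can be chosen so that \<open>S\<close> becomes continuous on it. Bounding the coordinates one after the
other leaves a compact set whose image still has positive measure, and there the lexicographically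
least preimage depends measurably on the point.

The ergodic theorem (\<open>avg_tendsto\<close>, \<open>avg_tendsto_Lp\<close>). Garsia's argument gives Hopf's maximal lemma
for \<open>P\<close>, and with it a weak-type inequality for the averages. Let \<open>0 \<le> f \<le> C\<close> and let \<open>F\<close> be the upper
limit of the averages of \<open>f\<close>. Then \<open>F \<le> P F\<close>, so \<open>\<integral> F\<^sup>2 \<le> \<integral> F \<cdot> (F \<circ> T)\<close>, which forces
\<open>\<integral> (F \<circ> T - F)\<^sup>2 \<le> 0\<close>; hence \<open>F\<close> is invariant. The set where \<open>F\<close> exceeds the conditional expectation by
\<open>\<epsilon>\<close> is therefore invariant, restriction to it commutes with \<open>P\<close>, and the maximal lemma shows that it
is null. The same bound for \<open>C - f\<close> gives convergence for bounded functions. Truncation passes to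
the general case: almost everywhere through the weak-type inequality, and in the mean of order \<open>p\<close>
because \<open>P f \<circ> T\<close> is a conditional expectation of \<open>f\<close>, so that \<open>P\<close> is a contraction by Jensen's
inequality.\<close>

section \<open>Covering Polish spaces by closed subsets of Baire space\<close>

text \<open>Continuity and closedness in Baire space are checked below on finite initial segments.\<close>

lemma open_baire_iff:
  "open (A :: (nat \<Rightarrow> nat) set) \<longleftrightarrow> (\<forall>z\<in>A. \<exists>n. \<forall>w. (\<forall>i<n. w i = z i) \<longrightarrow> w \<in> A)"
proof
  assume "open A"
  show "\<forall>z\<in>A. \<exists>n. \<forall>w. (\<forall>i<n. w i = z i) \<longrightarrow> w \<in> A"
  proof
    fix z assume "z \<in> A"
    have "openin (product_topology (\<lambda>i::nat. euclidean :: nat topology) UNIV) A"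
      using \<open>open A\<close> by (simp add: euclidean_product_topology)
    from product_topology_open_contains_basis[OF this \<open>z \<in> A\<close>] obtain X where
      X: "z \<in> (\<Pi>\<^sub>E i\<in>UNIV. X i)" "finite {i. X i \<noteq> UNIV}" "(\<Pi>\<^sub>E i\<in>UNIV. X i) \<subseteq> A"
      by auto
    obtain n where n: "\<And>i. X i \<noteq> UNIV \<Longrightarrow> i < n"
      using X(2) by (metis (mono_tags, lifting) finite_nat_set_iff_bounded mem_Collect_eq)
    have "w \<in> A" if "\<forall>i<n. w i = z i" for w
    proof -
      have "w i \<in> X i" for i
        using n[of i] that X(1) by (cases "i < n") (auto simp: PiE_def Pi_def)
      then show ?thesis using X(3) by (auto simp: PiE_def Pi_def)
    qed
    then show "\<exists>n. \<forall>w. (\<forall>i<n. w i = z i) \<longrightarrow> w \<in> A" by blast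
  qed
next
  assume *: "\<forall>z\<in>A. \<exists>n. \<forall>w. (\<forall>i<n. w i = z i) \<longrightarrow> w \<in> A"
  have op: "open {w :: nat \<Rightarrow> nat. \<forall>i<n. w i = z i}" for n and z :: "nat \<Rightarrow> nat"
  proof -
    have "open ((\<lambda>w :: nat \<Rightarrow> nat. w i) -` {z i})" for i
      by (rule open_vimage[OF Topological_Spaces.open_discrete continuous_on_product_coordinates])
    then have "open (\<Inter>i\<in>{..<n}. (\<lambda>w :: nat \<Rightarrow> nat. w i) -` {z i})"
      by (intro open_INT) auto
    also have "(\<Inter>i\<in>{..<n}. (\<lambda>w. w i) -` {z i}) = {w. \<forall>i<n. w i = z i}" by auto
    finally show ?thesis .
  qed
  show "open A"
  proof (subst open_subopen, intro ballI)
    fix z assume "z \<in> A"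
    with * obtain n where "\<forall>w. (\<forall>i<n. w i = z i) \<longrightarrow> w \<in> A" by blast
    then show "\<exists>T. open T \<and> z \<in> T \<and> T \<subseteq> A"
      by (intro exI[of _ "{w. \<forall>i<n. w i = z i}"]) (auto simp: op)
  qed
qed

text \<open>A point may have several names in a cover; refinements with overlapping pieces produce them.\<close>

definition baire_cover :: "'a topology \<Rightarrow> (nat \<Rightarrow> nat) set \<Rightarrow> ((nat \<Rightarrow> nat) \<Rightarrow> 'a) \<Rightarrow> bool" where
  "baire_cover \<tau> Z \<psi> \<longleftrightarrow> closed Z \<and> continuous_map (top_of_set Z) \<tau> \<psi> \<and> \<psi> ` Z = topspace \<tau>"

text \<open>A point is named by a sequence of indices into a dense sequence such that consecutive members have
summably small distance. Each such condition involves two coordinates, so the names form a closed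
set, and the first \<open>n\<close> coordinates determine the limit up to a multiple of \<open>(1/2)^n\<close>.\<close>

lemma ex_baire_cover:
  assumes "completely_metrizable_space \<tau>" "second_countable \<tau>"
  shows "\<exists>Z \<psi>. baire_cover \<tau> Z \<psi>"
proof (cases "topspace \<tau> = {}")
  case True
  then show ?thesis
    by (intro exI[of _ "{}"] exI) (auto simp: baire_cover_def continuous_map_on_empty)
next
  case False
  obtain X d where Xd: "Metric_space X d" "Metric_space.mcomplete X d"
    and \<tau>: "\<tau> = Metric_space.mtopology X d"
    using assms(1) by (auto simp: completely_metrizable_space_def)
  interpret Metric_space X d by fact
  have top: "topspace \<tau> = X" by (simp add: \<tau>)
  obtain D where D: "countable D" "D \<subseteq> X" "\<tau> closure_of D = X"
    using second_countable_imp_separable_space[OF assms(2)]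
    unfolding separable_space_def top by blast
  have "D \<noteq> {}" using D(3) False top by auto
  define q where "q = from_nat_into D"
  have rq: "range q = D" unfolding q_def by (rule range_from_nat_into) (use \<open>D \<noteq> {}\<close> D in auto)
  have qX: "q n \<in> X" for n using rq D(2) by auto
  have dense: "\<exists>n. d x (q n) < r" if "x \<in> X" "r > 0" for x r
    using D(3) that rq unfolding \<tau> metric_closure_of by force
  define Z where "Z = {z. \<forall>n. d (q (z n)) (q (z (Suc n))) \<le> (1/2)^n}"
  have "closed Z"
    unfolding closed_def open_baire_iff Z_def
  proof (intro ballI)
    fix z assume "z \<in> - {z. \<forall>n. d (q (z n)) (q (z (Suc n))) \<le> (1/2)^n}"
    then obtain n where n: "\<not> d (q (z n)) (q (z (Suc n))) \<le> (1/2)^n" by auto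
    show "\<exists>n. \<forall>w. (\<forall>i<n. w i = z i) \<longrightarrow> w \<in> - {z. \<forall>n. d (q (z n)) (q (z (Suc n))) \<le> (1/2)^n}"
    proof (intro exI[of _ "Suc (Suc n)"] allI impI)
      fix w assume "\<forall>i<Suc (Suc n). w i = z i"
      then have "\<not> d (q (w n)) (q (w (Suc n))) \<le> (1/2)^n" using n by simp
      then show "w \<in> - {z. \<forall>n. d (q (z n)) (q (z (Suc n))) \<le> (1/2)^n}" by blast
    qed
  qed
  have tele: "d (q (z n)) (q (z (n + k))) \<le> 2 * (1/2)^n - 2 * (1/2)^(n + k)" if "z \<in> Z" for z n k
  proof (induction k)
    case 0
    then show ?case using qX by simp
  next
    case (Suc k)
    have "d (q (z n)) (q (z (n + Suc k))) \<le> d (q (z n)) (q (z (n + k))) + d (q (z (n+k))) (q (z (Suc (n + k))))"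
      using qX triangle by simp
    also have "\<dots> \<le> 2 * (1/2)^n - 2 * (1/2)^(n + k) + (1/2)^(n+k)"
      using Suc that by (intro add_mono) (auto simp: Z_def)
    finally show ?case by simp
  qed
  have tele2: "d (q (z n)) (q (z m)) \<le> 2 * (1/2)^n" if "z \<in> Z" "n \<le> m" for z n m
  proof -
    have "(0::real) \<le> (1/2)^m" by simp
    moreover have "d (q (z n)) (q (z m)) \<le> 2 * (1/2)^n - 2 * (1/2)^m"
      using tele[OF that(1), of n "m - n"] that(2) by simp
    ultimately show ?thesis by linarith
  qed
  have small: "\<exists>n. 4 * (1/2)^n < e" if "e > 0" for e :: real
  proof -
    have "\<exists>n. (1/2 :: real)^n < e / 4" using that by (intro real_arch_pow_inv) auto
    then show ?thesis by (auto simp: field_simps)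
  qed
  have "\<exists>x. limitin \<tau> (\<lambda>n. q (z n)) x sequentially" if "z \<in> Z" for z
  proof -
    have "MCauchy (\<lambda>n. q (z n))"
      unfolding MCauchy_def
    proof (intro conjI allI impI)
      fix e :: real assume "e > 0"
      then obtain N where N: "4 * (1/2)^N < e" using small by blast
      have "d (q (z n)) (q (z n')) < e" if "N \<le> n" "N \<le> n'" for n n'
      proof -
        have "d (q (z n)) (q (z n')) \<le> d (q (z N)) (q (z n)) + d (q (z N)) (q (z n'))"
          using qX triangle by (metis commute)
        also have "\<dots> \<le> 4 * (1/2)^N"
          using tele2[OF \<open>z \<in> Z\<close>] that by (smt (verit))
        finally show ?thesis using N by simp
      qed
      then show "\<exists>N. \<forall>n n'. N \<le> n \<longrightarrow> N \<le> n' \<longrightarrow> d (q (z n)) (q (z n')) < e" by blast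
    qed (use qX in auto)
    then show ?thesis using Xd(2) unfolding mcomplete_def \<tau> by blast
  qed
  then obtain \<psi> where \<psi>: "\<And>z. z \<in> Z \<Longrightarrow> limitin \<tau> (\<lambda>n. q (z n)) (\<psi> z) sequentially" by metis
  have \<psi>X: "\<psi> z \<in> X" if "z \<in> Z" for z
    using \<psi>[OF that] unfolding \<tau> limitin_metric by simp
  have close: "d (q (z n)) (\<psi> z) \<le> 2 * (1/2)^n" if zZ: "z \<in> Z" for z n
  proof (rule field_le_epsilon)
    fix e :: real assume "e > 0"
    then obtain N where N: "\<And>m. m \<ge> N \<Longrightarrow> d (q (z m)) (\<psi> z) < e"
      using \<psi>[OF zZ] unfolding \<tau> limitin_metric eventually_sequentially by blast
    have "d (q (z n)) (\<psi> z) \<le> d (q (z n)) (q (z (max n N))) + d (q (z (max n N))) (\<psi> z)"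
      using qX \<psi>X[OF that] triangle by simp
    also have "\<dots> \<le> 2 * (1/2)^n + e"
      using tele2[OF zZ, of n "max n N"] N[of "max n N"] by simp
    finally show "d (q (z n)) (\<psi> z) \<le> 2 * (1/2)^n + e" .
  qed
  have cont: "continuous_map (top_of_set Z) \<tau> \<psi>"
    unfolding \<tau> continuous_map_to_metric
  proof (intro ballI allI impI)
    fix z and e :: real assume z: "z \<in> topspace (top_of_set Z)" and "e > 0"
    then obtain N where N: "4 * (1/2)^N < e" using small by blast
    let ?U = "Z \<inter> {w. \<forall>i<Suc N. w i = z i}"
    have "open {w. \<forall>i<Suc N. w i = z i}" unfolding open_baire_iff by (intro ballI exI[of _ "Suc N"]) auto
    then have "openin (top_of_set Z) ?U" by (rule openin_open_Int)
    moreover have "\<psi> w \<in> mball (\<psi> z) e" if "w \<in> ?U" for w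
    proof -
      have "w N = z N" "w \<in> Z" "z \<in> Z" using that z by auto
      then have "d (\<psi> z) (\<psi> w) \<le> d (q (z N)) (\<psi> z) + d (q (w N)) (\<psi> w)"
        using \<psi>X qX triangle by (metis commute)
      also have "\<dots> \<le> 2 * (1/2)^N + 2 * (1/2)^N"
        using close \<open>w \<in> Z\<close> \<open>z \<in> Z\<close> by (intro add_mono) auto
      finally show ?thesis using N \<psi>X \<open>w \<in> Z\<close> \<open>z \<in> Z\<close> by simp
    qed
    ultimately show "\<exists>U. openin (top_of_set Z) U \<and> z \<in> U \<and> (\<forall>y\<in>U. \<psi> y \<in> mball (\<psi> z) e)"
      using z by (intro exI[of _ ?U]) auto
  qed
  have onto: "x \<in> \<psi> ` Z" if "x \<in> X" for x
  proof -
    have "\<exists>k. d x (q k) < (1/2)^n / 4" for n using dense[OF that, of "(1/2)^n / 4"] by simp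
    then obtain z where z: "\<And>n. d x (q (z n)) < (1/2)^n / 4" by metis
    have "z \<in> Z"
      unfolding Z_def
    proof (intro CollectI allI)
      fix n
      have "d (q (z n)) (q (z (Suc n))) \<le> d x (q (z n)) + d x (q (z (Suc n)))"
        using qX that triangle by (metis commute)
      also have "\<dots> \<le> (1/2)^n / 4 + (1/2)^(Suc n) / 4"
        using z[of n] z[of "Suc n"] by linarith
      also have "\<dots> \<le> (1/2)^n" by (simp add: field_simps)
      finally show "d (q (z n)) (q (z (Suc n))) \<le> (1/2)^n" .
    qed
    have "d x (\<psi> z) \<le> 0"
    proof (rule field_le_epsilon)
      fix e :: real assume "e > 0"
      then obtain N where N: "4 * (1/2)^N < e" using small by blast
      have "d x (\<psi> z) \<le> d x (q (z N)) + d (q (z N)) (\<psi> z)"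
        using qX that triangle \<psi>X[OF \<open>z \<in> Z\<close>] by simp
      also have "\<dots> \<le> (1/2)^N / 4 + 2 * (1/2)^N"
        using z[of N] close[OF \<open>z \<in> Z\<close>, of N] by linarith
      also have "\<dots> \<le> 4 * (1/2)^N" by simp
      finally show "d x (\<psi> z) \<le> 0 + e" using N by linarith
    qed
    then have "x = \<psi> z" using that \<psi>X[OF \<open>z \<in> Z\<close>] nonneg zero by (metis antisym)
    then show ?thesis using \<open>z \<in> Z\<close> by blast
  qed
  show ?thesis
    using \<open>closed Z\<close> cont onto \<psi>X unfolding baire_cover_def top by blast
qed

text \<open>The fibre product of countably many covers: a name is an interleaving of names of one point in all
the covers, and agreement of the named points is a closed condition in a Hausdorff space.\<close>

lemma baire_cover_join:
  assumes cov: "\<And>n :: nat. baire_cover \<tau> (Z n) (\<psi> n)" and "Hausdorff_space \<tau>"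
  shows "\<exists>W \<phi> \<pi>. baire_cover \<tau> W \<phi> \<and>
    (\<forall>n. continuous_map (top_of_set W) (top_of_set (Z n)) (\<pi> n)) \<and> (\<forall>n. \<forall>w\<in>W. \<phi> w = \<psi> n (\<pi> n w))"
proof -
  define \<pi> where "\<pi> n w = (\<lambda>k. w (prod_encode (n, k)))" for n :: nat and w :: "nat \<Rightarrow> nat"
  have \<pi>c: "continuous_on S (\<pi> n)" for n S
    unfolding \<pi>_def
    by (intro continuous_on_coordinatewise_then_product continuous_on_subset[OF continuous_on_product_coordinates]) auto
  define V where "V = (\<Inter>n. \<pi> n -` Z n)"
  have Zc: "closed (Z n)" for n using cov[of n] by (simp add: baire_cover_def)
  have "closed V"
    unfolding V_def using Zc \<pi>c by (intro closed_INT ballI closed_vimage) auto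
  have \<pi>m: "continuous_map (top_of_set V) (top_of_set (Z n)) (\<pi> n)" for n
    using \<pi>c by (auto simp: V_def)
  have c: "continuous_map (top_of_set V) \<tau> (\<lambda>w. \<psi> n (\<pi> n w))" for n
    using continuous_map_compose[OF \<pi>m[of n], of \<tau> "\<psi> n"] cov[of n] by (simp add: baire_cover_def o_def)
  define W where "W = (\<Inter>n. {w\<in>V. \<psi> n (\<pi> n w) = \<psi> 0 (\<pi> 0 w)})"
  have "closedin (top_of_set V) {w\<in>topspace (top_of_set V). \<psi> n (\<pi> n w) = \<psi> 0 (\<pi> 0 w)}" for n
    by (intro closedin_continuous_maps_eq[OF assms(2)] c)
  then have "closed {w\<in>V. \<psi> n (\<pi> n w) = \<psi> 0 (\<pi> 0 w)}" for n
    using \<open>closed V\<close> closedin_closed_trans by fastforce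
  then have "closed W" unfolding W_def by (intro closed_INT) auto
  have WV: "W \<subseteq> V" by (auto simp: W_def)
  let ?\<phi> = "\<lambda>w. \<psi> 0 (\<pi> 0 w)"
  have "continuous_map (top_of_set W) \<tau> ?\<phi>"
    using c[of 0] WV by (rule continuous_map_from_subtopology_mono)
  moreover have "?\<phi> ` W = topspace \<tau>"
  proof (intro equalityI subsetI)
    fix x assume "x \<in> ?\<phi> ` W"
    then show "x \<in> topspace \<tau>" using WV cov[of 0] by (auto simp: baire_cover_def V_def)
  next
    fix x assume "x \<in> topspace \<tau>"
    then have "\<exists>z. z \<in> Z n \<and> \<psi> n z = x" for n
      using cov[of n] unfolding baire_cover_def by (metis imageE)
    then obtain z where z: "\<And>n. z n \<in> Z n" "\<And>n. \<psi> n (z n) = x" by metis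
    define w where "w j = (case prod_decode j of (n, k) \<Rightarrow> z n k)" for j
    have "\<pi> n w = z n" for n by (simp add: \<pi>_def w_def)
    then have "w \<in> W" "?\<phi> w = x" using z by (auto simp: W_def V_def)
    then show "x \<in> ?\<phi> ` W" by force
  qed
  ultimately have "baire_cover \<tau> W ?\<phi>" using \<open>closed W\<close> by (simp add: baire_cover_def)
  moreover have "continuous_map (top_of_set W) (top_of_set (Z n)) (\<pi> n)" for n
    using \<pi>m WV by (rule continuous_map_from_subtopology_mono)
  moreover have "?\<phi> w = \<psi> n (\<pi> n w)" if "w \<in> W" for n w
  proof -
    have "w \<in> {w\<in>V. \<psi> n (\<pi> n w) = \<psi> 0 (\<pi> 0 w)}" using that unfolding W_def by blast
    then show ?thesis by simp
  qed
  ultimately show ?thesis by blast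
qed

definition clopen_pullback :: "(nat \<Rightarrow> nat) set \<Rightarrow> ((nat \<Rightarrow> nat) \<Rightarrow> 'a) \<Rightarrow> 'a set \<Rightarrow> bool" where
  "clopen_pullback Z \<psi> B \<longleftrightarrow>
     openin (top_of_set Z) {z\<in>Z. \<psi> z \<in> B} \<and> openin (top_of_set Z) {z\<in>Z. \<psi> z \<notin> B}"

lemma clopen_pullback_compose:
  assumes "clopen_pullback Z \<psi> B" "continuous_map (top_of_set W) (top_of_set Z) \<pi>"
    "\<And>w. w \<in> W \<Longrightarrow> \<phi> w = \<psi> (\<pi> w)"
  shows "clopen_pullback W \<phi> B"
proof -
  have W: "\<pi> w \<in> Z" if "w \<in> W" for w using assms(2) that by auto
  have eq: "{w\<in>W. \<phi> w \<in> B} = {w\<in>topspace (top_of_set W). \<pi> w \<in> {z\<in>Z. \<psi> z \<in> B}}"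
    "{w\<in>W. \<phi> w \<notin> B} = {w\<in>topspace (top_of_set W). \<pi> w \<in> {z\<in>Z. \<psi> z \<notin> B}}"
    using assms(3) W by auto
  show ?thesis
    using assms(1) unfolding clopen_pullback_def eq
    by (intro conjI openin_continuous_map_preimage[OF assms(2)]) simp_all
qed

text \<open>An open subset of Baire space is a countable union of clopen sets, of those points whose first \<open>k\<close>
coordinates already force membership. One more coordinate says which of them contains the name,
with \<open>0\<close> for the complement of the open set. Whether this coordinate vanishes is a clopen condition.\<close>

lemma baire_cover_refine:
  assumes cov: "baire_cover \<tau> Z \<psi>" and O: "openin (top_of_set Z) {z\<in>Z. \<psi> z \<in> B}"
  shows "\<exists>W \<phi>. baire_cover \<tau> W \<phi> \<and> clopen_pullback W \<phi> B"
proof -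
  obtain V where V: "open V" "{z\<in>Z. \<psi> z \<in> B} = Z \<inter> V" using O by (auto simp: openin_open)
  define C where "C k = {z. \<forall>w. (\<forall>i<k. w i = z i) \<longrightarrow> w \<in> V}" for k :: nat
  have "(\<Union>k. C k) = V"
    using V(1) unfolding open_baire_iff C_def by auto
  moreover have "closed (C k)" for k
    unfolding closed_def open_baire_iff
  proof (intro ballI exI allI impI)
    fix z w assume "z \<in> - C k" "\<forall>i<k. w i = z i"
    then show "w \<in> - C k" by (auto simp: C_def)
  qed
  ultimately have C: "\<And>n. closed (C n)" "(\<Union>n. C n) = V" by auto
  define D where "D j = (case j of 0 \<Rightarrow> - V | Suc k \<Rightarrow> C k)" for j
  have Dc: "closed (D j)" for j using C V by (auto simp: D_def split: nat.split)
  define \<pi> where "\<pi> w = (\<lambda>k. w (Suc k))" for w :: "nat \<Rightarrow> nat"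
  have \<pi>c: "continuous_on S \<pi>" for S
    unfolding \<pi>_def
    by (intro continuous_on_coordinatewise_then_product continuous_on_subset[OF continuous_on_product_coordinates]) auto
  define W where "W = {w. \<pi> w \<in> Z \<inter> D (w 0)}"
  have sec: "open ((\<lambda>w :: nat \<Rightarrow> nat. w 0) -` A)" for A
    by (rule open_vimage[OF Topological_Spaces.open_discrete continuous_on_product_coordinates])
  have cZ: "closed Z" using cov by (simp add: baire_cover_def)
  have "- W = (\<Union>j. ((\<lambda>w. w 0) -` {j}) \<inter> - (\<pi> -` (Z \<inter> D j)))" by (auto simp: W_def)
  moreover have "open \<dots>"
    using cZ Dc \<pi>c by (intro open_UN ballI open_Int sec open_Compl closed_vimage closed_Int) auto
  ultimately have "closed W" by (simp add: closed_def)
  have \<pi>m: "continuous_map (top_of_set W) (top_of_set Z) \<pi>" using \<pi>c by (auto simp: W_def)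
  let ?\<phi> = "\<lambda>w. \<psi> (\<pi> w)"
  have "continuous_map (top_of_set W) \<tau> ?\<phi>"
    using continuous_map_compose[OF \<pi>m, of \<tau> \<psi>] cov by (simp add: baire_cover_def o_def)
  moreover have "?\<phi> ` W = topspace \<tau>"
  proof (intro equalityI subsetI)
    fix x assume "x \<in> ?\<phi> ` W"
    then show "x \<in> topspace \<tau>" using cov by (auto simp: baire_cover_def W_def)
  next
    fix x assume "x \<in> topspace \<tau>"
    then obtain z where z: "z \<in> Z" "\<psi> z = x" using cov by (force simp: baire_cover_def)
    have "z \<in> (\<Union>j. D j)"
    proof (cases "z \<in> V")
      case True
      then obtain k where "z \<in> C k" using C by auto
      then have "z \<in> D (Suc k)" by (simp add: D_def)
      then show ?thesis by blast
    next
      case False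
      then have "z \<in> D 0" by (simp add: D_def)
      then show ?thesis by blast
    qed
    then obtain j where j: "z \<in> D j" by blast
    define w where "w k = (case k of 0 \<Rightarrow> j | Suc k \<Rightarrow> z k)" for k
    have "\<pi> w = z" "w 0 = j" by (simp_all add: \<pi>_def w_def)
    then have "w \<in> W" "?\<phi> w = x" using z j by (auto simp: W_def)
    then show "x \<in> ?\<phi> ` W" by force
  qed
  ultimately have "baire_cover \<tau> W ?\<phi>" using \<open>closed W\<close> by (simp add: baire_cover_def)
  moreover have "clopen_pullback W ?\<phi> B"
  proof -
    have *: "\<psi> (\<pi> w) \<in> B \<longleftrightarrow> w 0 \<noteq> 0" if "w \<in> W" for w
    proof -
      have "\<pi> w \<in> Z" "\<pi> w \<in> D (w 0)" using that by (auto simp: W_def)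
      moreover have "z \<in> V \<longleftrightarrow> j \<noteq> 0" if "z \<in> D j" for z j
        using that C(2) by (auto simp: D_def split: nat.splits)
      ultimately show ?thesis using V(2) by blast
    qed
    have "{w\<in>W. \<psi> (\<pi> w) \<in> B} = W \<inter> ((\<lambda>w. w 0) -` {0<..})"
      "{w\<in>W. \<psi> (\<pi> w) \<notin> B} = W \<inter> ((\<lambda>w. w 0) -` {0})" using * by auto
    then show ?thesis unfolding clopen_pullback_def by (auto intro!: openin_open_Int sec)
  qed
  ultimately show ?thesis by blast
qed

text \<open>The sets that become clopen in a suitable cover form a \<open>\<sigma>\<close>-algebra: countable unions are first made
open by joining the covers and then clopen by a refinement.\<close>

lemma borel_clopen_baire_cover:
  assumes "completely_metrizable_space \<tau>" "second_countable \<tau>"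
    and "B \<in> sigma_sets (topspace \<tau>) {U. openin \<tau> U}"
  shows "\<exists>W \<phi>. baire_cover \<tau> W \<phi> \<and> clopen_pullback W \<phi> B"
  using assms(3)
proof induction
  case (Basic U)
  then have U: "openin \<tau> U" by simp
  obtain Z \<psi> where c: "baire_cover \<tau> Z \<psi>" using ex_baire_cover[OF assms(1,2)] by blast
  have "openin (top_of_set Z) {z \<in> topspace (top_of_set Z). \<psi> z \<in> U}"
    using c U by (intro openin_continuous_map_preimage) (auto simp: baire_cover_def)
  then show ?case using baire_cover_refine[OF c] by simp
next
  case Empty
  obtain Z \<psi> where c: "baire_cover \<tau> Z \<psi>" using ex_baire_cover[OF assms(1,2)] by blast
  then show ?case by (intro exI[of _ Z] exI[of _ \<psi>]) (simp add: clopen_pullback_def)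
next
  case (Compl B)
  then obtain Z \<psi> where c: "baire_cover \<tau> Z \<psi>" "clopen_pullback Z \<psi> B" by blast
  have "{z\<in>Z. \<psi> z \<in> topspace \<tau> - B} = {z\<in>Z. \<psi> z \<notin> B}" "{z\<in>Z. \<psi> z \<notin> topspace \<tau> - B} = {z\<in>Z. \<psi> z \<in> B}"
    using c(1) by (auto simp: baire_cover_def)
  then have "clopen_pullback Z \<psi> (topspace \<tau> - B)" using c(2) unfolding clopen_pullback_def by simp
  then show ?case using c(1) by blast
next
  case (Union B)
  then have "\<forall>n. \<exists>W \<phi>. baire_cover \<tau> W \<phi> \<and> clopen_pullback W \<phi> (B n)" by blast
  then obtain Z \<psi> where c: "\<And>n. baire_cover \<tau> (Z n) (\<psi> n)" "\<And>n. clopen_pullback (Z n) (\<psi> n) (B n)"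
    by metis
  have "Hausdorff_space \<tau>"
    using assms(1) completely_metrizable_imp_metrizable_space metrizable_imp_Hausdorff_space by blast
  from baire_cover_join[of \<tau> Z \<psi>, OF c(1) this] obtain W \<phi> \<pi> where W: "baire_cover \<tau> W \<phi>"
    "\<And>n. continuous_map (top_of_set W) (top_of_set (Z n)) (\<pi> n)" "\<And>n w. w \<in> W \<Longrightarrow> \<phi> w = \<psi> n (\<pi> n w)"
    by blast
  have "clopen_pullback W \<phi> (B n)" for n
    by (rule clopen_pullback_compose[OF c(2) W(2,3)])
  then have "openin (top_of_set W) (\<Union>n. {z\<in>W. \<phi> z \<in> B n})"
    unfolding clopen_pullback_def by (intro openin_clauses) auto
  also have "(\<Union>n. {z\<in>W. \<phi> z \<in> B n}) = {z\<in>W. \<phi> z \<in> (\<Union>n. B n)}" by auto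
  finally show ?case by (rule baire_cover_refine[OF W(1)])
qed

section \<open>Measurable sections over sets of positive measure\<close>

text \<open>The section picks the lexicographically least name. The next coordinate after a prefix \<open>\<sigma>\<close> is the
least \<open>j\<close> such that the point lies in the image of the names starting with \<open>\<sigma> @ [j]\<close>; these images are
compact, so each finite prefix of the least name is a measurable function of the point.\<close>

lemma lexicographic_section:
  fixes K :: "(nat \<Rightarrow> nat) set"
  assumes "compact K" "closed K" and g: "continuous_map (top_of_set K) \<tau> g" and haus: "Hausdorff_space \<tau>"
    and closed_sets: "\<And>C. closedin \<tau> C \<Longrightarrow> C \<in> sets M"
  shows "\<exists>l. (\<forall>x\<in>g ` K. l x \<in> K \<and> g (l x) = x) \<and> (\<forall>Q. open Q \<longrightarrow> {x\<in>g ` K. l x \<in> Q} \<in> sets M)"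
proof -
  define C where "C \<sigma> = {z\<in>K. \<forall>i<length \<sigma>. z i = \<sigma> ! i}" for \<sigma>
  have "closed {z. \<forall>i<length \<sigma>. z i = \<sigma> ! i}" for \<sigma> :: "nat list"
    unfolding closed_def open_baire_iff by (intro ballI exI[of _ "length \<sigma>"]) auto
  then have "compact (C \<sigma>)" for \<sigma>
    using compact_Int_closed[OF \<open>compact K\<close>] unfolding C_def by (simp add: Collect_conj_eq)
  then have "compactin \<tau> (g ` C \<sigma>)" for \<sigma>
    by (intro image_compactin[OF _ g]) (auto simp: compactin_subtopology C_def)
  then have gC: "g ` C \<sigma> \<in> sets M" for \<sigma>
    by (intro closed_sets compactin_imp_closedin[OF haus])
  have gK: "g ` K = g ` C []" by (simp add: C_def)
  define p where "p = rec_nat (\<lambda>x. []) (\<lambda>n r x. r x @ [LEAST j. x \<in> g ` C (r x @ [j])])"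
  have p0: "p 0 x = []" and pS: "p (Suc n) x = p n x @ [LEAST j. x \<in> g ` C (p n x @ [j])]" for n x
    by (simp_all add: p_def)
  have len: "length (p n x) = n" for n x by (induction n) (auto simp: p0 pS)
  have step: "\<exists>j. x \<in> g ` C (\<sigma> @ [j])" if x: "x \<in> g ` C \<sigma>" for x \<sigma>
  proof -
    obtain z where z: "z \<in> C \<sigma>" "x = g z" using x by blast
    then have "z \<in> C (\<sigma> @ [z (length \<sigma>)])" by (auto simp: C_def nth_append less_Suc_eq)
    then show ?thesis using z by blast
  qed
  have inC: "x \<in> g ` C (p n x)" if "x \<in> g ` K" for n x
  proof (induction n)
    case 0 then show ?case using that gK p0 by simp
  next
    case (Suc n)
    show ?case unfolding pS using LeastI_ex[OF step[OF Suc]] by simp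
  qed
  have meas: "{x \<in> g ` K. p n x = \<sigma>} \<in> sets M" for n \<sigma>
  proof (induction n arbitrary: \<sigma>)
    case 0
    show ?case using gC[of "[]"] gK by (cases "\<sigma> = []") (auto simp: p0)
  next
    case (Suc n)
    show ?case
    proof (cases \<sigma> rule: rev_exhaust)
      case Nil then show ?thesis by (simp add: pS)
    next
      case (snoc \<sigma>' j)
      have "{x \<in> g ` K. p (Suc n) x = \<sigma>} =
          {x \<in> g ` K. p n x = \<sigma>'} \<inter> g ` C (\<sigma>' @ [j]) - (\<Union>i\<in>{..<j}. g ` C (\<sigma>' @ [i]))"
      proof -
        have "(LEAST j. x \<in> g ` C (\<sigma>' @ [j])) = j \<longleftrightarrow>
            x \<in> g ` C (\<sigma>' @ [j]) \<and> (\<forall>i<j. x \<notin> g ` C (\<sigma>' @ [i]))"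
          if "x \<in> g ` K" "p n x = \<sigma>'" for x
        proof -
          have ex: "\<exists>j. x \<in> g ` C (\<sigma>' @ [j])" using step[OF inC[OF that(1), of n]] that(2) by simp
          show ?thesis
            using LeastI_ex[OF ex] not_less_Least[of _ "\<lambda>j. x \<in> g ` C (\<sigma>' @ [j])"]
            by (metis Least_equality linorder_not_le)
        qed
        then show ?thesis unfolding snoc pS by auto
      qed
      also have "\<dots> \<in> sets M" using Suc gC by (intro sets.Diff sets.Int sets.finite_UN) auto
      finally show ?thesis .
    qed
  qed
  define l where "l x i = p (Suc i) x ! i" for x i
  have pre: "l x i = p n x ! i" if "i < n" for x i n
    using that
  proof (induction n)
    case (Suc n)
    show ?case
    proof (cases "i = n")
      case False
      then have "p (Suc n) x ! i = p n x ! i" using Suc.prems by (simp add: pS nth_append len)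
      then show ?thesis using Suc False by simp
    qed (simp add: l_def)
  qed simp
  \<comment> \<open>for every \<open>n\<close> a name of \<open>x\<close> agrees with \<open>l x\<close> below \<open>n\<close>, and the names of \<open>x\<close> in \<open>K\<close> form a closed set\<close>
  have sect: "l x \<in> K \<and> g (l x) = x" if xK: "x \<in> g ` K" for x
  proof -
    have xt: "x \<in> topspace \<tau>" using that g by (auto simp: continuous_map_def)
    have "closedin (top_of_set K) {z \<in> topspace (top_of_set K). g z \<in> {x}}"
      using xt by (intro closedin_continuous_map_preimage[OF g])
        (simp add: closedin_Hausdorff_sing_eq[OF haus])
    then have cl: "closed {z\<in>K. g z = x}" using closedin_closed_trans \<open>closed K\<close> by fastforce
    have "l x \<in> {z\<in>K. g z = x}"
    proof (rule ccontr)
      assume "l x \<notin> {z\<in>K. g z = x}"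
      then have "\<exists>n. \<forall>w. (\<forall>i<n. w i = l x i) \<longrightarrow> w \<in> - {z\<in>K. g z = x}"
        using cl unfolding closed_def open_baire_iff by (elim ballE) auto
      then obtain n where n: "\<And>w. (\<forall>i<n. w i = l x i) \<Longrightarrow> w \<notin> {z\<in>K. g z = x}" by blast
      obtain w where "w \<in> C (p n x)" "x = g w" using inC[OF xK, of n] by blast
      then have "\<forall>i<n. w i = l x i" "w \<in> {z\<in>K. g z = x}" using pre by (auto simp: C_def len)
      then show False using n by blast
    qed
    then show ?thesis by simp
  qed
  have "{x\<in>g ` K. l x \<in> Q} \<in> sets M" if Qop: "open Q" for Q
  proof -
    let ?P = "\<lambda>\<sigma>. \<forall>w. (\<forall>i<length \<sigma>. w i = \<sigma> ! i) \<longrightarrow> w \<in> Q"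
    have "{x\<in>g ` K. l x \<in> Q} = (\<Union>\<sigma>\<in>{\<sigma>. ?P \<sigma>}. {x\<in>g ` K. p (length \<sigma>) x = \<sigma>})"
    proof (intro equalityI subsetI)
      fix x assume x: "x \<in> {x\<in>g ` K. l x \<in> Q}"
      then obtain n where n: "\<And>w. (\<forall>i<n. w i = l x i) \<Longrightarrow> w \<in> Q"
        using Qop x unfolding open_baire_iff by blast
      have "?P (p n x)" using n pre by (simp add: len)
      then show "x \<in> (\<Union>\<sigma>\<in>{\<sigma>. ?P \<sigma>}. {x\<in>g ` K. p (length \<sigma>) x = \<sigma>})"
        using x by (intro UN_I[of "p n x"]) (auto simp: len)
    next
      fix x assume "x \<in> (\<Union>\<sigma>\<in>{\<sigma>. ?P \<sigma>}. {x\<in>g ` K. p (length \<sigma>) x = \<sigma>})"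
      then obtain \<sigma> where s: "?P \<sigma>" "x \<in> g ` K" "p (length \<sigma>) x = \<sigma>" by blast
      then have "l x \<in> Q" using pre[of _ "length \<sigma>" x] by simp
      then show "x \<in> {x\<in>g ` K. l x \<in> Q}" using s by simp
    qed
    also have "\<dots> \<in> sets M" using meas by (intro sets.countable_UN'') auto
    finally show ?thesis .
  qed
  then show ?thesis using sect by (intro exI[of _ l]) simp
qed

lemma compact_box: "compact {z :: nat \<Rightarrow> nat. \<forall>i. z i \<le> c i}"
proof -
  have "compactin (product_topology (\<lambda>i::nat. euclidean :: nat topology) UNIV) (PiE UNIV (\<lambda>i. {..c i}))"
    unfolding compactin_PiE by (auto intro: finite_imp_compact)
  moreover have "PiE UNIV (\<lambda>i. {..c i}) = {z :: nat \<Rightarrow> nat. \<forall>i. z i \<le> c i}" by (auto simp: PiE_def Pi_def)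
  ultimately show ?thesis by (simp add: euclidean_product_topology)
qed

text \<open>A capacity argument. Outer measure is continuous along increasing unions, so the coordinates can be
bounded successively by \<open>m 0, m 1, ...\<close> while the outer measure of the image stays above a fixed
\<open>a > 0\<close>. All these bounds together define a compact set, and by sequential compactness its image
contains the intersection of the closures of the images obtained on the way.\<close>

lemma ex_compact_positive_image:
  fixes Z :: "(nat \<Rightarrow> nat) set"
  assumes "finite_measure M" "metrizable_space \<tau>" "topspace \<tau> = space M"
    and closed_sets: "\<And>C. closedin \<tau> C \<Longrightarrow> C \<in> sets M"
    and "closed Z" and g: "continuous_map (top_of_set Z) \<tau> g"
    and pos: "outer_measure_of M (g ` Z) > 0"
  shows "\<exists>K\<subseteq>Z. compact K \<and> closed K \<and> emeasure M (g ` K) > 0"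
proof -
  interpret finite_measure M by fact
  obtain X d where Xd: "Metric_space X d" and \<tau>: "\<tau> = Metric_space.mtopology X d"
    using assms(2) by (auto simp: metrizable_space_def)
  interpret X: Metric_space X d by fact
  have X: "X = space M" using assms(3) \<tau> by simp
  have gX: "g z \<in> X" if "z \<in> Z" for z
    using g that by (auto simp: continuous_map_def \<tau>)
  obtain a where a: "0 < a" "a < outer_measure_of M (g ` Z)" using dense[OF pos] by blast
  \<comment> \<open>\<open>S n\<close> is the set of names whose coordinates below \<open>n\<close> obey the bounds chosen so far\<close>
  have "\<exists>S. \<forall>n. (a < outer_measure_of M (g ` S n) \<and> S n \<subseteq> Z \<and> (n = 0 \<longrightarrow> S n = Z)) \<and>
    (\<exists>m. S (Suc n) = S n \<inter> {z. z n \<le> m})"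
  proof (rule dependent_nat_choice)
    fix S :: "(nat \<Rightarrow> nat) set" and n :: nat assume S: "a < outer_measure_of M (g ` S) \<and> S \<subseteq> Z \<and> (n = 0 \<longrightarrow> S = Z)"
    have "(SUP m. outer_measure_of M (g ` (S \<inter> {z. z n \<le> m}))) =
        outer_measure_of M (\<Union>m. g ` (S \<inter> {z. z n \<le> m}))"
      using S gX X by (intro SUP_outer_measure_of_incseq) (auto simp: incseq_def)
    also have "(\<Union>m. g ` (S \<inter> {z. z n \<le> m})) = g ` S" by auto
    finally have "a < (SUP m. outer_measure_of M (g ` (S \<inter> {z. z n \<le> m})))" using S by simp
    then obtain m where "a < outer_measure_of M (g ` (S \<inter> {z. z n \<le> m}))"
      unfolding less_SUP_iff by blast
    then show "\<exists>S'. (a < outer_measure_of M (g ` S') \<and> S' \<subseteq> Z \<and> (Suc n = 0 \<longrightarrow> S' = Z)) \<and>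
        (\<exists>m. S' = S \<inter> {z. z n \<le> m})"
      using S by (intro exI[of _ "S \<inter> {z. z n \<le> m}"]) auto
  qed (use a in auto)
  then obtain S m where S: "\<And>n. a < outer_measure_of M (g ` S n)" "S 0 = Z"
    and SS: "\<And>n. S (Suc n) = S n \<inter> {z. z n \<le> m n}" by metis
  have Seq: "S n = {z\<in>Z. \<forall>i<n. z i \<le> m i}" for n
    by (induction n) (auto simp: S SS less_Suc_eq)
  define K where "K = Z \<inter> {z. \<forall>i. z i \<le> m i}"
  have "compact K" unfolding K_def using \<open>closed Z\<close> compact_box by (rule closed_Int_compact)
  have "closed {z :: nat \<Rightarrow> nat. \<forall>i. z i \<le> m i}"
    unfolding closed_def open_baire_iff
  proof (intro ballI)
    fix z :: "nat \<Rightarrow> nat" assume "z \<in> - {z. \<forall>i. z i \<le> m i}"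
    then obtain i where "\<not> z i \<le> m i" by blast
    then have "\<forall>w. (\<forall>j<Suc i. w j = z j) \<longrightarrow> w \<in> - {z. \<forall>i. z i \<le> m i}"
      by (metis (mono_tags, lifting) ComplI lessI mem_Collect_eq)
    then show "\<exists>n. \<forall>w. (\<forall>j<n. w j = z j) \<longrightarrow> w \<in> - {z. \<forall>i. z i \<le> m i}" by blast
  qed
  then have "closed K" unfolding K_def using \<open>closed Z\<close> by blast
  have "compactin \<tau> (g ` K)"
    using \<open>compact K\<close> by (intro image_compactin[OF _ g]) (auto simp: compactin_subtopology K_def)
  have Haus: "Hausdorff_space \<tau>" using assms(2) metrizable_imp_Hausdorff_space by blast
  have gKM: "g ` K \<in> sets M"
    using closed_sets compactin_imp_closedin[OF Haus \<open>compactin \<tau> (g ` K)\<close>] by blast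
  define F where "F n = \<tau> closure_of (g ` S n)" for n
  have FM: "F n \<in> sets M" for n unfolding F_def by (intro closed_sets) simp
  have sub: "(\<Inter>n. F n) \<subseteq> g ` K"
  proof
    fix x assume x: "x \<in> (\<Inter>n. F n)"
    have "\<exists>z. z \<in> S n \<and> d x (g z) < inverse (real (Suc n))" for n
    proof -
      have "x \<in> \<tau> closure_of (g ` S n)" using x by (auto simp: F_def)
      then have "\<exists>y\<in>g ` S n. y \<in> X.mball x (inverse (real (Suc n)))"
        unfolding \<tau> X.metric_closure_of by (simp del: of_nat_Suc)
      then show ?thesis by (auto simp del: of_nat_Suc)
    qed
    then obtain z where z: "\<And>n. z n \<in> S n" "\<And>n. d x (g (z n)) < inverse (real (Suc n))" by metis
    have xX: "x \<in> X" using x unfolding F_def \<tau> X.metric_closure_of by auto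
    have zZ: "z n \<in> Z" for n using z(1)[of n] by (simp add: Seq)
    \<comment> \<open>the bound \<open>m i\<close> holds for \<open>z k i\<close> only if \<open>k > i\<close>; the sum covers the finitely many exceptions\<close>
    define c where "c i = m i + (\<Sum>k\<le>i. z k i)" for i
    have zc: "z k i \<le> c i" for k i
    proof (cases "i < k")
      case True
      then show ?thesis using z(1)[of k] by (auto simp: Seq c_def intro: trans_le_add1)
    next
      case False
      then have "z k i \<le> (\<Sum>k\<le>i. z k i)" by (intro member_le_sum) auto
      then show ?thesis by (simp add: c_def)
    qed
    have "seq_compact {z :: nat \<Rightarrow> nat. \<forall>i. z i \<le> c i}"
      by (rule compact_imp_seq_compact[OF compact_box])
    moreover have "\<forall>k. z k \<in> {z. \<forall>i. z i \<le> c i}" using zc by simp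
    ultimately obtain l r where r: "strict_mono r" "(z \<circ> r) \<longlonglongrightarrow> l" by (rule seq_compactE)
    have lZ: "l \<in> Z"
      by (rule Lim_in_closed_set[OF \<open>closed Z\<close> _ _ r(2)]) (auto simp: zZ)
    have "l i \<le> m i" for i
    proof -
      have "open {w :: nat \<Rightarrow> nat. w i = l i}"
        unfolding open_baire_iff by (intro ballI exI[of _ "Suc i"]) auto
      then have "\<forall>\<^sub>F k in sequentially. (z \<circ> r) k i = l i"
        using r(2) unfolding tendsto_def by fastforce
      with eventually_gt_at_top[of i] have "\<forall>\<^sub>F k in sequentially. i < k \<and> z (r k) i = l i"
        by eventually_elim simp
      then obtain k where k: "k > i" "z (r k) i = l i"
        using eventually_happens'[OF sequentially_bot] by blast
      have "i < r k" using k(1) seq_suble[OF r(1), of k] by simp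
      then show ?thesis using z(1)[of "r k"] k(2) by (auto simp: Seq)
    qed
    then have "l \<in> K" using lZ by (simp add: K_def)
    have "limitin (top_of_set Z) (z \<circ> r) l sequentially"
      using r(2) lZ zZ by (simp add: limitin_subtopology)
    then have l1: "limitin \<tau> (g \<circ> (z \<circ> r)) (g l) sequentially"
      by (rule continuous_map_limit[OF g])
    have "(\<lambda>n. d x (g (z n))) \<longlonglongrightarrow> 0"
    proof (rule tendsto_sandwich[OF _ _ tendsto_const LIMSEQ_inverse_real_of_nat])
      show "\<forall>\<^sub>F n in sequentially. d x (g (z n)) \<le> inverse (real (Suc n))"
        using less_imp_le[OF z(2)] by (intro always_eventually allI)
    qed simp
    then have "(\<lambda>k. d x (g (z (r k)))) \<longlonglongrightarrow> 0"
      using LIMSEQ_subseq_LIMSEQ[OF _ r(1), of "\<lambda>n. d x (g (z n))"] by (simp add: o_def)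
    then have "limitin \<tau> (g \<circ> (z \<circ> r)) x sequentially"
      unfolding \<tau> X.limitin_metric_dist_null using xX gX[OF zZ]
      by (simp add: X.commute[of _ x])
    with l1 have "x = g l"
      by (intro limitin_Hausdorff_unique[OF _ _ _ Haus]) auto
    then show "x \<in> g ` K" using \<open>l \<in> K\<close> by blast
  qed
  have "decseq F"
    unfolding F_def
  proof (intro decseq_SucI closure_of_mono image_mono)
    show "S (Suc n) \<subseteq> S n" for n using SS by blast
  qed
  have "a \<le> emeasure M (F n)" for n
  proof -
    have "S n \<subseteq> Z" by (auto simp: Seq)
    then have "g ` S n \<subseteq> F n"
      unfolding F_def by (intro closure_of_subset) (use gX assms(3) X in auto)
    then have "outer_measure_of M (g ` S n) \<le> emeasure M (F n)"
      using outer_measure_of_mono FM outer_measure_of_eq by metis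
    then show ?thesis using S(1)[of n] by simp
  qed
  then have "a \<le> (INF n. emeasure M (F n))" by (intro INF_greatest)
  also have "\<dots> = emeasure M (\<Inter>n. F n)"
    using FM \<open>decseq F\<close> by (intro INF_emeasure_decseq) auto
  also have "\<dots> \<le> emeasure M (g ` K)" using sub gKM by (rule emeasure_mono)
  finally show ?thesis using a(1) \<open>compact K\<close> \<open>closed K\<close> by (intro exI[of _ K]) (auto simp: K_def)
qed

text \<open>A measurable uniformization up to null sets. In the cover, the preimages of \<open>N\<close> and of the
\<open>S\<close>-preimages of a countable base are clopen, so \<open>S\<close> becomes a continuous map \<open>g\<close> on the closed set \<open>Y\<close>
of names of points of \<open>N\<close>.\<close>

theorem ex_measurable_section:
  assumes "standard_borel M" "finite_measure M" and S: "S \<in> measurable M M" and N: "N \<in> sets M"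
    and pos: "\<And>C. C \<in> null_sets M \<Longrightarrow> \<not> S ` N \<subseteq> C"
  shows "\<exists>B s. B \<in> sets M \<and> B \<notin> null_sets M \<and> s \<in> measurable (restrict_space M B) M \<and>
    (\<forall>x\<in>B. s x \<in> N \<and> S (s x) = x)"
proof -
  obtain \<tau> where \<tau>: "topspace \<tau> = space M" "completely_metrizable_space \<tau>" "second_countable \<tau>"
    and setsM: "sets M = sigma_sets (topspace \<tau>) {U. openin \<tau> U}"
    using assms(1) unfolding standard_borel_def by metis
  have metr: "metrizable_space \<tau>" using \<tau>(2) completely_metrizable_imp_metrizable_space by blast
  have Haus: "Hausdorff_space \<tau>" using metr metrizable_imp_Hausdorff_space by blast
  have open_sets: "U \<in> sets M" if "openin \<tau> U" for U unfolding setsM using that by blast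
  have closed_sets: "C \<in> sets M" if "closedin \<tau> C" for C
  proof -
    have "space M - (topspace \<tau> - C) \<in> sets M" using that by (intro sets.compl_sets open_sets) auto
    moreover have "space M - (topspace \<tau> - C) = C" using closedin_subset[OF that] \<tau>(1) by auto
    ultimately show ?thesis by simp
  qed
  obtain \<B> where \<B>: "countable \<B>" "\<And>V. V \<in> \<B> \<Longrightarrow> openin \<tau> V"
    "\<And>U x. openin \<tau> U \<Longrightarrow> x \<in> U \<Longrightarrow> \<exists>V\<in>\<B>. x \<in> V \<and> V \<subseteq> U"
    using \<tau>(3) unfolding second_countable_def by metis
  define U where "U = from_nat_into (insert {} \<B>)"
  have rU: "range U = insert {} \<B>" unfolding U_def using \<B>(1) by (intro range_from_nat_into) auto
  have Uop: "openin \<tau> (U k)" for k using rU \<B>(2) by (metis insertE openin_empty rangeI)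
  \<comment> \<open>the countably many Borel sets that are to become clopen\<close>
  define A where "A j = (case j of 0 \<Rightarrow> N | Suc k \<Rightarrow> S -` U k \<inter> space M)" for j
  have "A j \<in> sigma_sets (topspace \<tau>) {U. openin \<tau> U}" for j
    unfolding setsM[symmetric] A_def using N Uop open_sets measurable_sets[OF S] by (auto split: nat.split)
  then have "\<forall>j. \<exists>W \<phi>. baire_cover \<tau> W \<phi> \<and> clopen_pullback W \<phi> (A j)"
    using borel_clopen_baire_cover[OF \<tau>(2,3)] by blast
  then obtain Z \<psi> where c: "\<And>n. baire_cover \<tau> (Z n) (\<psi> n)" "\<And>n. clopen_pullback (Z n) (\<psi> n) (A n)"
    by metis
  from baire_cover_join[of \<tau> Z \<psi>, OF c(1) Haus] obtain W \<phi> \<pi> where W: "baire_cover \<tau> W \<phi>"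
    "\<And>n. continuous_map (top_of_set W) (top_of_set (Z n)) (\<pi> n)" "\<And>n w. w \<in> W \<Longrightarrow> \<phi> w = \<psi> n (\<pi> n w)"
    by blast
  have clop: "clopen_pullback W \<phi> (A n)" for n
    by (rule clopen_pullback_compose[OF c(2) W(2,3)])
  have \<phi>M: "\<phi> w \<in> space M" if "w \<in> W" for w using W(1) that \<tau>(1) by (auto simp: baire_cover_def)
  have cW: "closed W" using W(1) by (simp add: baire_cover_def)
  define Y where "Y = {w\<in>W. \<phi> w \<in> N}"
  have "closedin (top_of_set W) Y"
  proof -
    have "W - Y = {w\<in>W. \<phi> w \<notin> A 0}" by (auto simp: Y_def A_def)
    then show ?thesis using clop[of 0] unfolding clopen_pullback_def closedin_def by (auto simp: Y_def)
  qed
  then have "closed Y" using cW closedin_closed_trans by blast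
  define g where "g w = S (\<phi> w)" for w
  have g: "continuous_map (top_of_set Y) \<tau> g"
    unfolding continuous_map_def topspace_euclidean_subtopology
  proof (intro conjI allI impI)
    show "g \<in> Y \<rightarrow> topspace \<tau>"
      using \<phi>M measurable_space[OF S] \<tau>(1) by (auto simp: Y_def g_def)
    fix V assume V: "openin \<tau> V"
    have "{w\<in>Y. g w \<in> V} = (\<Union>k\<in>{k. U k \<subseteq> V}. Y \<inter> {w\<in>W. \<phi> w \<in> A (Suc k)})"
    proof (intro equalityI subsetI)
      fix w assume w: "w \<in> {w\<in>Y. g w \<in> V}"
      then obtain G where "G \<in> \<B>" "g w \<in> G" "G \<subseteq> V" using \<B>(3)[OF V] by blast
      moreover then obtain k where "G = U k" using rU by (metis insertCI rangeE)
      ultimately show "w \<in> (\<Union>k\<in>{k. U k \<subseteq> V}. Y \<inter> {w\<in>W. \<phi> w \<in> A (Suc k)})"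
        using w \<phi>M by (auto simp: A_def g_def Y_def)
    qed (auto simp: A_def g_def)
    moreover have "openin (top_of_set Y) (Y \<inter> {w\<in>W. \<phi> w \<in> A (Suc k)})" for k
    proof -
      obtain Q where "open Q" "{w\<in>W. \<phi> w \<in> A (Suc k)} = W \<inter> Q"
        using clop[of "Suc k"] unfolding clopen_pullback_def openin_open by blast
      moreover have "Y \<subseteq> W" by (auto simp: Y_def)
      ultimately show ?thesis unfolding openin_open by (intro exI[of _ Q]) auto
    qed
    then have "openin (top_of_set Y) (\<Union>k\<in>{k. U k \<subseteq> V}. Y \<inter> {w\<in>W. \<phi> w \<in> A (Suc k)})"
      by (intro openin_Union) blast
    ultimately show "openin (top_of_set Y) {w\<in>Y. g w \<in> V}" by simp
  qed
  have gY: "g ` Y = S ` N"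
  proof -
    have "\<phi> ` Y = N"
      using W(1) sets.sets_into_space[OF N] \<tau>(1) unfolding baire_cover_def Y_def by force
    then show ?thesis unfolding g_def by (metis image_image)
  qed
  have "outer_measure_of M (g ` Y) > 0"
  proof -
    have "S ` N \<subseteq> space M" using measurable_space[OF S] sets.sets_into_space[OF N] by auto
    from outer_measure_of_attain[OF this] obtain E where
      E: "E \<in> sets M" "S ` N \<subseteq> E" "outer_measure_of M (S ` N) = emeasure M E" by blast
    then have "E \<notin> null_sets M" using pos by blast
    then show ?thesis using E gY by (auto simp: null_sets_def zero_less_iff_neq_zero)
  qed
  from ex_compact_positive_image[OF assms(2) metr \<tau>(1) closed_sets \<open>closed Y\<close> g this]
  obtain K where K: "K \<subseteq> Y" "compact K" "emeasure M (g ` K) > 0" "closed K" by blast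
  have gK: "continuous_map (top_of_set K) \<tau> g" by (rule continuous_map_from_subtopology_mono[OF g K(1)])
  from lexicographic_section[OF K(2,4) gK Haus closed_sets] obtain l where
    l: "\<And>x. x \<in> g ` K \<Longrightarrow> l x \<in> K" "\<And>x. x \<in> g ` K \<Longrightarrow> g (l x) = x"
    "\<And>Q. open Q \<Longrightarrow> {x\<in>g ` K. l x \<in> Q} \<in> sets M" by metis
  let ?B = "g ` K"
  have BM: "?B \<in> sets M" using l(3)[of UNIV] by simp
  let ?s = "\<lambda>x. \<phi> (l x)"
  have sp: "space (restrict_space M ?B) = ?B"
    using sets.sets_into_space[OF BM] by (simp add: space_restrict_space Int_absorb2)
  have "?s \<in> measurable (restrict_space M ?B) M"
  proof (rule measurable_sigma_sets[OF setsM])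
    show "{U. openin \<tau> U} \<subseteq> Pow (topspace \<tau>)" using openin_subset by blast
    show "?s \<in> space (restrict_space M ?B) \<rightarrow> topspace \<tau>"
      unfolding sp using l(1) K(1) \<phi>M \<tau>(1) by (auto simp: Y_def)
    fix V assume "V \<in> {U. openin \<tau> U}"
    then have "openin (top_of_set W) {w\<in>topspace (top_of_set W). \<phi> w \<in> V}"
      using W(1) by (intro openin_continuous_map_preimage) (auto simp: baire_cover_def)
    then obtain Q where Q: "open Q" "{w\<in>W. \<phi> w \<in> V} = W \<inter> Q" by (auto simp: openin_open)
    have "?s -` V \<inter> space (restrict_space M ?B) = {x\<in>?B. l x \<in> Q}"
      unfolding sp using l(1) K(1) Q(2) by (auto simp: Y_def)
    then show "?s -` V \<inter> space (restrict_space M ?B) \<in> sets (restrict_space M ?B)"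
      using l(3)[OF Q(1)] BM by (auto simp: sets_restrict_space_iff)
  qed
  moreover have "\<phi> (l x) \<in> N \<and> S (\<phi> (l x)) = x" if "x \<in> ?B" for x
    using l(1,2)[OF that] K(1) by (auto simp: Y_def g_def)
  moreover have "?B \<notin> null_sets M" using K(3) by auto
  ultimately show ?thesis using BM by blast
qed

section \<open>The transfer operator of a measure-preserving map\<close>

text \<open>The density of the image under \<open>T\<close> of the signed measure with density \<open>f\<close>. Positive and negative part
are treated separately; \<open>ennreal\<close> sends negative numbers to \<open>0\<close>.\<close>

definition transfer :: "'a measure \<Rightarrow> ('a \<Rightarrow> 'a) \<Rightarrow> ('a \<Rightarrow> real) \<Rightarrow> 'a \<Rightarrow> real" where
  "transfer M T f x =
     enn2real (RN_deriv M (distr (density M (\<lambda>x. ennreal (f x))) M T) x) -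
     enn2real (RN_deriv M (distr (density M (\<lambda>x. ennreal (- f x))) M T) x)"

locale measure_preserving = prob_space M for M :: "'a measure" +
  fixes T :: "'a \<Rightarrow> 'a"
  assumes T_measurable [measurable]: "T \<in> measurable M M"
    and T_preserves: "\<And>A. A \<in> sets M \<Longrightarrow> emeasure M (T -` A \<inter> space M) = emeasure M A"
begin

abbreviation P :: "('a \<Rightarrow> real) \<Rightarrow> 'a \<Rightarrow> real" where "P \<equiv> transfer M T"

lemma distr_T: "distr M M T = M"
  by (rule measure_eqI) (auto simp: emeasure_distr T_preserves)

lemma integral_T: "f \<in> borel_measurable M \<Longrightarrow> (\<integral>x. f (T x) \<partial>M) = (\<integral>x. f x \<partial>M)"
  for f :: "'a \<Rightarrow> real"
  using integral_distr[OF T_measurable, of f] by (simp add: distr_T)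

lemma integrable_T: "integrable M f \<Longrightarrow> integrable M (\<lambda>x. f (T x))" for f :: "'a \<Rightarrow> real"
  using integrable_distr[OF T_measurable, of f] by (simp add: distr_T)

lemma AE_T: "(AE x in M. Q x) \<Longrightarrow> (AE x in M. Q (T x))"
proof -
  assume "AE x in M. Q x"
  then obtain N where N: "N \<in> null_sets M" "{x\<in>space M. \<not> Q x} \<subseteq> N" by (auto elim!: AE_E)
  then have "T -` N \<inter> space M \<in> null_sets M"
    using T_preserves[of N] by (auto simp: null_sets_def)
  then show ?thesis
    by (rule AE_I') (use N(2) measurable_space[OF T_measurable] in auto)
qed

lemma borel_measurable_transfer [measurable]: "P f \<in> borel_measurable M"
  unfolding transfer_def by measurable

lemma integrable_mult_bounded:
  fixes f g :: "'a \<Rightarrow> real"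
  assumes "integrable M f" "g \<in> borel_measurable M" "\<And>x. \<bar>g x\<bar> \<le> C"
  shows "integrable M (\<lambda>x. f x * g x)"
proof (rule Bochner_Integration.integrable_bound)
  show "integrable M (\<lambda>x. C * f x)" using assms(1) by simp
  have "0 \<le> C" using assms(3)[of undefined] by simp
  then show "AE x in M. norm (f x * g x) \<le> norm (C * f x)"
    using mult_right_mono[OF assms(3) abs_ge_zero] by (intro AE_I2) (simp add: abs_mult mult.commute)
qed (use assms in auto)

text \<open>The image of the measure with density \<open>f\<close> is absolutely continuous because preimages of null sets
under \<open>T\<close> are null, and it is finite, so that its Radon--Nikodym derivative is finite almost everywhere.\<close>

lemma nn_integral_RN_deriv_transfer:
  assumes f: "integrable M f" and [measurable]: "g \<in> borel_measurable M"
  defines "u \<equiv> \<lambda>x. enn2real (RN_deriv M (distr (density M (\<lambda>x. ennreal (f x))) M T) x)"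
  shows "(\<integral>\<^sup>+x. ennreal (u x) * g x \<partial>M) = (\<integral>\<^sup>+x. ennreal (f x) * g (T x) \<partial>M)"
proof -
  have [measurable]: "f \<in> borel_measurable M" using f by simp
  define \<nu> where "\<nu> = distr (density M (\<lambda>x. ennreal (f x))) M T"
  have sets: "sets \<nu> = sets M" by (simp add: \<nu>_def)
  have nu: "(\<integral>\<^sup>+x. h x \<partial>\<nu>) = (\<integral>\<^sup>+x. ennreal (f x) * h (T x) \<partial>M)"
    if [measurable]: "h \<in> borel_measurable M" for h
    unfolding \<nu>_def by (subst nn_integral_distr) (auto simp: nn_integral_density)
  have emu: "emeasure \<nu> A = (\<integral>\<^sup>+x. ennreal (f x) * indicator A (T x) \<partial>M)" if "A \<in> sets M" for A
    using nu[of "indicator A"] that sets by simp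
  have ac: "absolutely_continuous M \<nu>"
    unfolding absolutely_continuous_def
  proof
    fix A assume A: "A \<in> null_sets M"
    then have "AE x in M. T x \<notin> A" by (intro AE_T AE_not_in)
    then have "(\<integral>\<^sup>+x. ennreal (f x) * indicator A (T x) \<partial>M) = (\<integral>\<^sup>+x. 0 \<partial>M)"
      by (intro nn_integral_cong_AE) auto
    then show "A \<in> null_sets \<nu>" using A emu[of A] by (auto simp: null_sets_def sets)
  qed
  have "emeasure \<nu> (space \<nu>) < \<infinity>"
  proof -
    have "emeasure \<nu> (space M) = (\<integral>\<^sup>+x. ennreal (f x) \<partial>M)"
      using measurable_space[OF T_measurable] by (subst emu) (auto intro!: nn_integral_cong)
    also have "\<dots> \<le> (\<integral>\<^sup>+x. ennreal (norm (f x)) \<partial>M)" by (intro nn_integral_mono ennreal_leI) simp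
    also have "\<dots> < \<infinity>" using f by (simp add: integrable_iff_bounded)
    finally show ?thesis by (simp add: \<nu>_def)
  qed
  then have "finite_measure \<nu>" by (intro finite_measureI) simp
  then have "sigma_finite_measure \<nu>" by (simp add: finite_measure_def)
  then have "AE x in M. RN_deriv M \<nu> x \<noteq> \<infinity>" using ac sets by (rule RN_deriv_finite)
  then have "AE x in M. ennreal (u x) = RN_deriv M \<nu> x"
    by eventually_elim (simp add: u_def \<nu>_def less_top)
  then have "(\<integral>\<^sup>+x. ennreal (u x) * g x \<partial>M) = (\<integral>\<^sup>+x. RN_deriv M \<nu> x * g x \<partial>M)"
    by (intro nn_integral_cong_AE) auto
  also have "\<dots> = (\<integral>\<^sup>+x. g x \<partial>\<nu>)" by (rule RN_deriv_nn_integral[symmetric]) (auto simp: ac sets)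
  finally show ?thesis by (simp add: nu)
qed

lemma integral_RN_deriv_transfer:
  assumes f: "integrable M f" and [measurable]: "g \<in> borel_measurable M"
    and g: "\<And>x. 0 \<le> g x" "\<And>x. g x \<le> C"
  defines "u \<equiv> \<lambda>x. enn2real (RN_deriv M (distr (density M (\<lambda>x. ennreal (f x))) M T) x)"
  shows "integrable M (\<lambda>x. u x * g x)" "(\<integral>x. u x * g x \<partial>M) = (\<integral>x. max 0 (f x) * g (T x) \<partial>M)"
proof -
  have [measurable]: "f \<in> borel_measurable M" using f by simp
  have [measurable]: "u \<in> borel_measurable M" unfolding u_def by measurable
  have u: "0 \<le> u x" for x by (simp add: u_def)
  have int: "integrable M (\<lambda>x. max 0 (f x) * g (T x))"
    by (rule integrable_mult_bounded[where C = C])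
      (use f g order_trans[OF g] in \<open>auto intro!: integrable_max simp: abs_of_nonneg\<close>)
  have "(\<integral>\<^sup>+x. ennreal (u x * g x) \<partial>M) = (\<integral>\<^sup>+x. ennreal (u x) * ennreal (g x) \<partial>M)"
    using u g by (simp add: ennreal_mult)
  also have "\<dots> = (\<integral>\<^sup>+x. ennreal (f x) * ennreal (g (T x)) \<partial>M)"
    unfolding u_def by (rule nn_integral_RN_deriv_transfer[OF f]) measurable
  also have "\<dots> = (\<integral>\<^sup>+x. ennreal (max 0 (f x) * g (T x)) \<partial>M)"
    using g by (intro nn_integral_cong) (auto simp: ennreal_mult max_def ennreal_neg)
  also have "\<dots> = ennreal (\<integral>x. max 0 (f x) * g (T x) \<partial>M)"
    using g by (intro nn_integral_eq_integral[OF int]) auto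
  finally have *: "(\<integral>\<^sup>+x. ennreal (u x * g x) \<partial>M) = ennreal (\<integral>x. max 0 (f x) * g (T x) \<partial>M)" .
  show "integrable M (\<lambda>x. u x * g x)"
    using * u g by (intro integrableI_nonneg) auto
  show "(\<integral>x. u x * g x \<partial>M) = (\<integral>x. max 0 (f x) * g (T x) \<partial>M)"
    using * u g by (intro integral_eq_nn_integral[THEN trans]) (auto intro!: integral_nonneg_AE)
qed

lemma transfer_dual:
  assumes f: "integrable M f" and g [measurable]: "g \<in> borel_measurable M"
    and gC: "\<And>x. \<bar>g x\<bar> \<le> C"
  shows "integrable M (\<lambda>x. P f x * g x)" "(\<integral>x. P f x * g x \<partial>M) = (\<integral>x. f x * g (T x) \<partial>M)"
proof -
  have [measurable]: "f \<in> borel_measurable M" using f by simp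
  have f': "integrable M (\<lambda>x. - f x)" using f by simp
  let ?u = "\<lambda>f x. enn2real (RN_deriv M (distr (density M (\<lambda>x. ennreal (f x))) M T) x)"
  have nonneg: "integrable M (\<lambda>x. P f x * h x) \<and> (\<integral>x. P f x * h x \<partial>M) = (\<integral>x. f x * h (T x) \<partial>M)"
    if [measurable]: "h \<in> borel_measurable M" and h: "\<And>x. 0 \<le> h x" "\<And>x. h x \<le> D" for h D
  proof -
    note 1 = integral_RN_deriv_transfer[OF f _ h] integral_RN_deriv_transfer[OF f' _ h]
    have int: "integrable M (\<lambda>x. k x * h (T x))" if k: "integrable M k" for k
      by (rule integrable_mult_bounded[OF k]) (use h in \<open>auto simp: abs_of_nonneg\<close>)
    have eq: "P f x * h x = ?u f x * h x - ?u (\<lambda>x. - f x) x * h x" for x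
      by (simp add: transfer_def left_diff_distrib)
    have "integrable M (\<lambda>x. P f x * h x)" unfolding eq using 1 by (intro Bochner_Integration.integrable_diff) auto
    moreover have "(\<integral>x. P f x * h x \<partial>M) = (\<integral>x. max 0 (f x) * h (T x) \<partial>M) - (\<integral>x. max 0 (- f x) * h (T x) \<partial>M)"
      unfolding eq using 1 by (subst Bochner_Integration.integral_diff) auto
    moreover have "\<dots> = (\<integral>x. max 0 (f x) * h (T x) - max 0 (- f x) * h (T x) \<partial>M)"
      using f f' by (intro Bochner_Integration.integral_diff[symmetric] int integrable_max) auto
    moreover have "\<dots> = (\<integral>x. f x * h (T x) \<partial>M)"
      by (intro Bochner_Integration.integral_cong) (auto simp: max_def)
    ultimately show ?thesis by simp
  qed
  \<comment> \<open>a signed bounded function is the difference of the nonnegative functions \<open>g + C\<close> and \<open>C\<close>\<close>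
  have C: "- C \<le> g x" "g x \<le> C" for x using gC[of x] by auto
  have 0: "0 \<le> C" using gC[of undefined] by simp
  have 1: "integrable M (\<lambda>x. P f x * (g x + C)) \<and> (\<integral>x. P f x * (g x + C) \<partial>M) = (\<integral>x. f x * (g (T x) + C) \<partial>M)"
  proof (rule nonneg)
    show "0 \<le> g x + C" "g x + C \<le> 2 * C" for x using C[of x] by linarith+
  qed measurable
  have 2: "integrable M (\<lambda>x. P f x * C) \<and> (\<integral>x. P f x * C \<partial>M) = (\<integral>x. f x * C \<partial>M)"
    by (rule nonneg) (use 0 in auto)
  have i: "integrable M (\<lambda>x. f x * (g (T x) + C))"
  proof (rule integrable_mult_bounded[where C = "2 * C", OF f])
    show "\<bar>g (T x) + C\<bar> \<le> 2 * C" for x using C[of "T x"] by (simp add: abs_le_iff)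
  qed measurable
  have eq: "P f x * g x = P f x * (g x + C) - P f x * C" "f x * g (T x) = f x * (g (T x) + C) - f x * C" for x
    by (auto simp: algebra_simps)
  show "integrable M (\<lambda>x. P f x * g x)"
    unfolding eq(1) using 1 2 by (intro Bochner_Integration.integrable_diff) auto
  show "(\<integral>x. P f x * g x \<partial>M) = (\<integral>x. f x * g (T x) \<partial>M)"
    unfolding eq using 1 2 i f by (simp add: Bochner_Integration.integral_diff)
qed

lemma integrable_transfer: "integrable M f \<Longrightarrow> integrable M (P f)"
  using transfer_dual(1)[of f "\<lambda>_. 1" 1] by simp

lemma integral_transfer: "integrable M f \<Longrightarrow> (\<integral>x. P f x \<partial>M) = (\<integral>x. f x \<partial>M)"
  using transfer_dual(2)[of f "\<lambda>_. 1" 1] by simp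

lemma transfer_set:
  assumes "integrable M f" "A \<in> sets M"
  shows "(\<integral>x. P f x * indicator A x \<partial>M) = (\<integral>x. f x * indicator A (T x) \<partial>M)"
  using assms by (intro transfer_dual[where C = 1]) (auto simp: indicator_def)

lemma AE_eqI_integral:
  fixes u v :: "'a \<Rightarrow> real"
  assumes "integrable M u" "integrable M v"
    and "\<And>A. A \<in> sets M \<Longrightarrow> (\<integral>x. u x * indicator A x \<partial>M) = (\<integral>x. v x * indicator A x \<partial>M)"
  shows "AE x in M. u x = v x"
  using assms by (intro density_unique_real) (auto simp: set_lebesgue_integral_def mult.commute)

text \<open>All identities for \<open>P\<close> are proved by comparing integrals over measurable sets.\<close>

lemma transfer_unique:
  assumes "integrable M f" "integrable M u"
    and "\<And>A. A \<in> sets M \<Longrightarrow> (\<integral>x. u x * indicator A x \<partial>M) = (\<integral>x. f x * indicator A (T x) \<partial>M)"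
  shows "AE x in M. P f x = u x"
  using assms integrable_transfer by (intro AE_eqI_integral) (auto simp: transfer_set)

lemma integrable_mult_indicator_T:
  assumes "integrable M f" "A \<in> sets M"
  shows "integrable M (\<lambda>x. f x * indicator A (T x) :: real)" "integrable M (\<lambda>x. f x * indicator A x :: real)"
  using assms by (auto intro!: integrable_mult_bounded[where C = 1] simp: indicator_def)

lemma transfer_cong:
  assumes f: "integrable M f" and [measurable]: "g \<in> borel_measurable M" and eq: "AE x in M. f x = g x"
  shows "AE x in M. P f x = P g x"
proof -
  have g: "integrable M g" using f eq by (subst integrable_cong_AE[symmetric]) auto
  have [measurable]: "f \<in> borel_measurable M" using f by simp
  show ?thesis
  proof (rule transfer_unique[OF f integrable_transfer[OF g]])
    fix A assume [measurable]: "A \<in> sets M"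
    show "(\<integral>x. P g x * indicator A x \<partial>M) = (\<integral>x. f x * indicator A (T x) \<partial>M)"
      unfolding transfer_set[OF g \<open>A \<in> sets M\<close>] using eq by (intro integral_cong_AE) auto
  qed
qed

lemma transfer_add:
  assumes f: "integrable M f" and g: "integrable M g"
  shows "AE x in M. P (\<lambda>x. f x + g x) x = P f x + P g x"
proof (rule transfer_unique)
  fix A assume A: "A \<in> sets M"
  show "(\<integral>x. (P f x + P g x) * indicator A x \<partial>M) = (\<integral>x. (f x + g x) * indicator A (T x) \<partial>M)"
    using A f g integrable_transfer
    by (simp add: distrib_right integrable_mult_indicator_T transfer_set Bochner_Integration.integral_add)
qed (use f g integrable_transfer in auto)

lemma transfer_cmult:
  assumes f: "integrable M f"
  shows "AE x in M. P (\<lambda>x. c * f x) x = c * P f x"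
proof (rule transfer_unique)
  fix A assume A: "A \<in> sets M"
  show "(\<integral>x. c * P f x * indicator A x \<partial>M) = (\<integral>x. c * f x * indicator A (T x) \<partial>M)"
    using transfer_set[OF f A] by (simp add: mult.assoc)
qed (use f integrable_transfer in auto)

lemma transfer_const: "AE x in M. P (\<lambda>_. c) x = c"
proof (rule transfer_unique)
  fix A assume [measurable]: "A \<in> sets M"
  show "(\<integral>x. c * indicator A x \<partial>M) = (\<integral>x. c * indicator A (T x) \<partial>M)"
    by (rule integral_T[of "\<lambda>x. c * indicator A x", symmetric]) simp
qed auto

lemma transfer_nonneg:
  assumes f: "integrable M f" and nonneg: "AE x in M. 0 \<le> f x"
  shows "AE x in M. 0 \<le> P f x"
proof -
  have [measurable]: "f \<in> borel_measurable M" using f by simp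
  define A where "A = {x\<in>space M. P f x < 0}"
  have A: "A \<in> sets M" unfolding A_def by measurable
  have "0 \<le> (\<integral>x. f x * indicator A (T x) \<partial>M)" using nonneg by (intro integral_nonneg_AE) auto
  also have "\<dots> = (\<integral>x. P f x * indicator A x \<partial>M)" using transfer_set[OF f A] by simp
  finally have "(\<integral>x. - (P f x * indicator A x) \<partial>M) \<le> 0" by simp
  moreover have nn: "AE x in M. 0 \<le> - (P f x * indicator A x)" by (auto simp: A_def indicator_def)
  ultimately have "(\<integral>x. - (P f x * indicator A x) \<partial>M) = 0" using integral_nonneg_AE[OF nn] by linarith
  then have "AE x in M. - (P f x * indicator A x) = 0"
    using integral_nonneg_eq_0_iff_AE[OF _ nn] integrable_mult_indicator_T(2)[OF integrable_transfer[OF f] A] by simp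
  then show ?thesis using AE_space by eventually_elim (auto simp: A_def indicator_def split: if_splits)
qed

lemma transfer_mono:
  assumes f: "integrable M f" and g: "integrable M g" and le: "AE x in M. f x \<le> g x"
  shows "AE x in M. P f x \<le> P g x"
proof -
  have d: "integrable M (\<lambda>x. g x - f x)" using f g by simp
  have "AE x in M. P (\<lambda>x. f x + (g x - f x)) x = P f x + P (\<lambda>x. g x - f x) x" by (rule transfer_add[OF f d])
  moreover have "AE x in M. 0 \<le> P (\<lambda>x. g x - f x) x" using le by (intro transfer_nonneg[OF d]) auto
  ultimately show ?thesis by eventually_elim simp
qed

text \<open>Composition with \<open>T\<close> makes functions of \<open>T x\<close> act as scalars: \<open>P\<close> is linear over them.\<close>

lemma transfer_mult_T:
  assumes f: "integrable M f" and [measurable]: "g \<in> borel_measurable M" and g: "\<And>x. \<bar>g x\<bar> \<le> C"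
  shows "AE x in M. P (\<lambda>x. f x * g (T x)) x = P f x * g x"
proof (rule transfer_unique)
  have [measurable]: "f \<in> borel_measurable M" using f by simp
  show "integrable M (\<lambda>x. f x * g (T x))"
    by (rule integrable_mult_bounded[OF f _ g]) measurable
  show "integrable M (\<lambda>x. P f x * g x)" using transfer_dual(1)[OF f _ g] by simp
  fix A assume [measurable]: "A \<in> sets M"
  have "(\<integral>x. P f x * (g x * indicator A x) \<partial>M) = (\<integral>x. f x * (g (T x) * indicator A (T x)) \<partial>M)"
    by (rule transfer_dual(2)[OF f, where C = "C"]) (use g order_trans[OF abs_ge_zero g] in \<open>auto simp: indicator_def\<close>)
  then show "(\<integral>x. P f x * g x * indicator A x \<partial>M) = (\<integral>x. f x * g (T x) * indicator A (T x) \<partial>M)"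
    by (simp add: mult.assoc)
qed

lemma integrable_iterate: "integrable M f \<Longrightarrow> integrable M ((P ^^ i) f)"
  by (induction i) (auto intro: integrable_transfer)

lemma borel_measurable_iterate [measurable]: "f \<in> borel_measurable M \<Longrightarrow> (P ^^ i) f \<in> borel_measurable M"
  by (cases i) auto

lemma iterate_add:
  assumes f: "integrable M f" and g: "integrable M g"
  shows "AE x in M. (P ^^ i) (\<lambda>x. f x + g x) x = (P ^^ i) f x + (P ^^ i) g x"
proof (induction i)
  case (Suc i)
  have "AE x in M. P ((P ^^ i) (\<lambda>x. f x + g x)) x = P (\<lambda>x. (P ^^ i) f x + (P ^^ i) g x) x"
    using f g Suc by (intro transfer_cong integrable_iterate) auto
  moreover have "AE x in M. P (\<lambda>x. (P ^^ i) f x + (P ^^ i) g x) x = P ((P ^^ i) f) x + P ((P ^^ i) g) x"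
    using f g by (intro transfer_add integrable_iterate)
  ultimately show ?case by eventually_elim simp
qed simp

lemma iterate_cmult:
  assumes f: "integrable M f"
  shows "AE x in M. (P ^^ i) (\<lambda>x. c * f x) x = c * (P ^^ i) f x"
proof (induction i)
  case (Suc i)
  have "AE x in M. P ((P ^^ i) (\<lambda>x. c * f x)) x = P (\<lambda>x. c * (P ^^ i) f x) x"
    using f Suc by (intro transfer_cong integrable_iterate) auto
  moreover have "AE x in M. P (\<lambda>x. c * (P ^^ i) f x) x = c * P ((P ^^ i) f) x"
    using f by (intro transfer_cmult integrable_iterate)
  ultimately show ?case by eventually_elim simp
qed simp

lemma iterate_const: "AE x in M. (P ^^ i) (\<lambda>_. c) x = c"
proof (induction i)
  case (Suc i)
  have "AE x in M. P ((P ^^ i) (\<lambda>_. c)) x = P (\<lambda>_. c) x"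
    using Suc by (intro transfer_cong integrable_iterate) auto
  then show ?case using transfer_const[of c] by eventually_elim simp
qed simp

lemma iterate_mono:
  assumes f: "integrable M f" and g: "integrable M g" and le: "AE x in M. f x \<le> g x"
  shows "AE x in M. (P ^^ i) f x \<le> (P ^^ i) g x"
proof (induction i)
  case (Suc i)
  then show ?case using transfer_mono[OF integrable_iterate[OF f] integrable_iterate[OF g] Suc] by simp
qed (use le in simp)

text \<open>In particular \<open>P\<close> commutes with restriction to an invariant set.\<close>

lemma iterate_mult_invariant:
  assumes f: "integrable M f" and [measurable]: "g \<in> borel_measurable M" and g: "\<And>x. \<bar>g x\<bar> \<le> C"
    and inv: "\<And>x. x \<in> space M \<Longrightarrow> g (T x) = g x"
  shows "AE x in M. (P ^^ i) (\<lambda>x. f x * g x) x = (P ^^ i) f x * g x"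
proof (induction i)
  case (Suc i)
  have int: "integrable M (\<lambda>x. h x * g x)" if "integrable M h" for h
    using that by (rule integrable_mult_bounded[OF _ _ g]) measurable
  have "AE x in M. P ((P ^^ i) (\<lambda>x. f x * g x)) x = P (\<lambda>x. (P ^^ i) f x * g (T x)) x"
    using f Suc inv by (intro transfer_cong integrable_iterate int) auto
  moreover have "AE x in M. P (\<lambda>x. (P ^^ i) f x * g (T x)) x = P ((P ^^ i) f) x * g x"
    using f g by (intro transfer_mult_T integrable_iterate) auto
  ultimately show ?case by eventually_elim simp
qed simp

end

section \<open>The maximal ergodic lemma\<close>

context measure_preserving
begin

definition psum :: "('a \<Rightarrow> real) \<Rightarrow> nat \<Rightarrow> 'a \<Rightarrow> real" where
  "psum f n x = (\<Sum>i<n. (P ^^ i) f x)"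

lemma integrable_psum: "integrable M f \<Longrightarrow> integrable M (psum f n)"
  unfolding psum_def by (intro Bochner_Integration.integrable_sum integrable_iterate)

lemma borel_measurable_psum [measurable]: "f \<in> borel_measurable M \<Longrightarrow> psum f n \<in> borel_measurable M"
  unfolding psum_def by measurable

lemma psum_0 [simp]: "psum f 0 x = 0" and psum_Suc: "psum f (Suc n) x = psum f n x + (P ^^ n) f x"
  by (simp_all add: psum_def)

text \<open>The recursion that drives Garsia's argument.\<close>

lemma psum_Suc_transfer:
  assumes f: "integrable M f"
  shows "AE x in M. psum f (Suc n) x = f x + P (psum f n) x"
proof (induction n)
  case 0
  have "psum f 0 = (\<lambda>_. 0)" by (simp add: fun_eq_iff)
  then show ?case using transfer_const[of 0] by (simp add: psum_Suc)
next
  case (Suc n)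
  have "psum f (Suc n) = (\<lambda>x. psum f n x + (P ^^ n) f x)" by (simp add: fun_eq_iff psum_Suc)
  moreover have "AE x in M. P (\<lambda>x. psum f n x + (P ^^ n) f x) x = P (psum f n) x + P ((P ^^ n) f) x"
    by (intro transfer_add integrable_psum integrable_iterate f)
  ultimately have "AE x in M. P (psum f (Suc n)) x = P (psum f n) x + (P ^^ Suc n) f x" by simp
  with Suc show ?case by eventually_elim (simp add: psum_Suc[of f "Suc n"])
qed

lemma psum_add:
  assumes "integrable M f" "integrable M g"
  shows "AE x in M. \<forall>n. psum (\<lambda>x. f x + g x) n x = psum f n x + psum g n x"
proof -
  have "AE x in M. \<forall>i. (P ^^ i) (\<lambda>x. f x + g x) x = (P ^^ i) f x + (P ^^ i) g x"
    unfolding AE_all_countable using assms by (intro allI iterate_add)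
  then show ?thesis by eventually_elim (simp add: psum_def sum.distrib)
qed

lemma psum_cmult:
  assumes "integrable M f"
  shows "AE x in M. \<forall>n. psum (\<lambda>x. c * f x) n x = c * psum f n x"
proof -
  have "AE x in M. \<forall>i. (P ^^ i) (\<lambda>x. c * f x) x = c * (P ^^ i) f x"
    unfolding AE_all_countable using assms by (intro allI iterate_cmult)
  then show ?thesis by eventually_elim (simp add: psum_def sum_distrib_left)
qed

lemma psum_const: "AE x in M. \<forall>n. psum (\<lambda>_. c) n x = real n * c"
proof -
  have "AE x in M. \<forall>i. (P ^^ i) (\<lambda>_. c) x = c"
    unfolding AE_all_countable by (intro allI iterate_const)
  then show ?thesis by eventually_elim (simp add: psum_def)
qed

lemma psum_mono:
  assumes "integrable M f" "integrable M g" "AE x in M. f x \<le> g x"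
  shows "AE x in M. \<forall>n. psum f n x \<le> psum g n x"
proof -
  have "AE x in M. \<forall>i. (P ^^ i) f x \<le> (P ^^ i) g x"
    unfolding AE_all_countable using assms by (intro allI iterate_mono)
  then show ?thesis by eventually_elim (auto simp: psum_def intro: sum_mono)
qed

lemma psum_abs_le:
  assumes "integrable M f"
  shows "AE x in M. \<forall>n. \<bar>psum f n x\<bar> \<le> psum (\<lambda>x. \<bar>f x\<bar>) n x"
proof -
  have "AE x in M. \<forall>n. psum f n x \<le> psum (\<lambda>x. \<bar>f x\<bar>) n x"
    using assms by (intro psum_mono) auto
  moreover have "AE x in M. \<forall>n. psum (\<lambda>x. - 1 * f x) n x \<le> psum (\<lambda>x. \<bar>f x\<bar>) n x"
    using assms by (intro psum_mono) auto
  ultimately show ?thesis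
    using psum_cmult[OF assms, of "- 1"] by eventually_elim (auto simp: abs_le_iff)
qed

text \<open>Starting from the empty sum \<open>0\<close> keeps the running maximum nonnegative.\<close>

primrec smax :: "('a \<Rightarrow> real) \<Rightarrow> nat \<Rightarrow> 'a \<Rightarrow> real" where
  "smax f 0 = (\<lambda>x. 0)"
| "smax f (Suc n) = (\<lambda>x. max (smax f n x) (psum f (Suc n) x))"

lemma integrable_smax: "integrable M f \<Longrightarrow> integrable M (smax f n)"
  by (induction n) (auto intro!: integrable_max integrable_psum)

lemma smax_nonneg: "0 \<le> smax f n x"
  by (induction n) (auto simp: le_max_iff_disj)

lemma psum_le_smax: "k \<le> n \<Longrightarrow> psum f k x \<le> smax f n x"
  by (induction n) (auto simp: le_Suc_eq le_max_iff_disj)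

lemma smax_pos: "0 < smax f n x \<Longrightarrow> \<exists>k<n. smax f n x = psum f (Suc k) x"
proof (induction n)
  case (Suc n)
  then show ?case by (cases "smax f n x \<le> psum f (Suc n) x") (auto simp: max_def intro: less_SucI)
qed simp

text \<open>Garsia's argument. Where the running maximum \<open>smax f n\<close> is positive, it equals
  \<open>psum f (Suc k) = f + P (psum f k)\<close> for some \<open>k < n\<close>, which is at most \<open>f + P (smax f n)\<close>; where it is \<open>0\<close>, it
  is at most \<open>P (smax f n)\<close>. Integrating the two bounds, the integrals of \<open>smax f n\<close> and of \<open>P (smax f n)\<close> cancel.\<close>

lemma maximal_lemma_finite:
  assumes f: "integrable M f"
  shows "0 \<le> (\<integral>x. f x * indicator {x\<in>space M. 0 < smax f n x} x \<partial>M)"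
proof -
  let ?E = "{x\<in>space M. 0 < smax f n x}"
  have [measurable]: "f \<in> borel_measurable M" "smax f n \<in> borel_measurable M"
    using f integrable_smax[OF f] by auto
  have E: "?E \<in> sets M" by measurable
  have "AE x in M. \<forall>k. psum f (Suc k) x = f x + P (psum f k) x"
    unfolding AE_all_countable using f by (intro allI psum_Suc_transfer)
  moreover have "AE x in M. \<forall>k. k \<le> n \<longrightarrow> P (psum f k) x \<le> P (smax f n) x"
    unfolding AE_all_countable
  proof
    fix k
    show "AE x in M. k \<le> n \<longrightarrow> P (psum f k) x \<le> P (smax f n) x"
    proof (cases "k \<le> n")
      case True
      have "AE x in M. P (psum f k) x \<le> P (smax f n) x"
        using psum_le_smax[OF True] by (intro transfer_mono integrable_psum integrable_smax f AE_I2)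
      then show ?thesis by eventually_elim simp
    qed simp
  qed
  moreover have "AE x in M. 0 \<le> P (smax f n) x"
    using f by (intro transfer_nonneg integrable_smax AE_I2 smax_nonneg)
  ultimately have "AE x in M. smax f n x \<le> f x * indicator ?E x + P (smax f n) x"
    using AE_space
  proof eventually_elim
    case (elim x)
    show ?case
    proof (cases "0 < smax f n x")
      case True
      then obtain k where k: "k < n" "smax f n x = psum f (Suc k) x" using smax_pos by blast
      then have "smax f n x = f x + P (psum f k) x" "P (psum f k) x \<le> P (smax f n) x" using elim by auto
      then show ?thesis using True elim by simp
    next
      case False
      then show ?thesis using elim smax_nonneg[of f n x] by simp
    qed
  qed
  then have "(\<integral>x. smax f n x \<partial>M) \<le> (\<integral>x. f x * indicator ?E x + P (smax f n) x \<partial>M)"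
    using f E by (intro integral_mono_AE Bochner_Integration.integrable_add integrable_mult_indicator_T
        integrable_transfer integrable_smax)
  also have "\<dots> = (\<integral>x. f x * indicator ?E x \<partial>M) + (\<integral>x. smax f n x \<partial>M)"
    using f E by (simp add: Bochner_Integration.integral_add integrable_mult_indicator_T
        integrable_transfer integrable_smax integral_transfer)
  finally show ?thesis by simp
qed

text \<open>Hopf's maximal lemma, as the limit of its finite form along the increasing maxima.\<close>

theorem maximal_lemma:
  assumes f: "integrable M f"
  shows "0 \<le> (\<integral>x. f x * indicator {x\<in>space M. \<exists>n. 0 < psum f n x} x \<partial>M)"
proof (rule LIMSEQ_le_const)
  let ?E = "{x\<in>space M. \<exists>n. 0 < psum f n x}"
  have [measurable]: "f \<in> borel_measurable M" "smax f n \<in> borel_measurable M" for n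
    using f integrable_smax[OF f] by auto
  show "(\<lambda>n. \<integral>x. f x * indicator {x\<in>space M. 0 < smax f n x} x \<partial>M) \<longlonglongrightarrow> (\<integral>x. f x * indicator ?E x \<partial>M)"
  proof (rule integral_dominated_convergence[where w = "\<lambda>x. \<bar>f x\<bar>"])
    show "AE x in M. (\<lambda>n. f x * indicator {x\<in>space M. 0 < smax f n x} x) \<longlonglongrightarrow> f x * indicator ?E x"
    proof (intro AE_I2)
      fix x assume x: "x \<in> space M"
      have "\<forall>\<^sub>F n in sequentially. (0 < smax f n x) = (\<exists>n. 0 < psum f n x)"
      proof (cases "\<exists>n. 0 < psum f n x")
        case True
        then obtain k where k: "0 < psum f k x" by blast
        have "0 < smax f n x" if "n \<ge> k" for n using psum_le_smax[OF that] k by (rule less_le_trans[rotated])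
        then show ?thesis using k unfolding eventually_sequentially by (intro exI[of _ k]) blast
      next
        case False
        then show ?thesis using smax_pos by (intro always_eventually) metis
      qed
      then show "(\<lambda>n. f x * indicator {x\<in>space M. 0 < smax f n x} x) \<longlonglongrightarrow> f x * indicator ?E x"
        by (intro tendsto_eventually, elim eventually_mono) (simp add: indicator_def)
    qed
  qed (use f in \<open>auto simp: indicator_def\<close>)
  show "\<exists>N. \<forall>n\<ge>N. 0 \<le> (\<integral>x. f x * indicator {x\<in>space M. 0 < smax f n x} x \<partial>M)"
    using maximal_lemma_finite[OF f] by blast
qed

text \<open>The weak-type bound is the maximal lemma for \<open>r - c\<close>, whose partial sums are those of \<open>r\<close> minus \<open>n * c\<close>
since \<open>P\<close> fixes constants.\<close>

theorem maximal_inequality: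
  assumes r: "integrable M r" and nonneg: "AE x in M. 0 \<le> r x" and "0 < c"
  shows "c * measure M {x\<in>space M. \<exists>n. real (Suc n) * c < psum r (Suc n) x} \<le> (\<integral>x. r x \<partial>M)"
proof -
  have [measurable]: "r \<in> borel_measurable M" using r by simp
  let ?A = "{x\<in>space M. \<exists>n. real (Suc n) * c < psum r (Suc n) x}"
  let ?h = "\<lambda>x. r x + - c"
  let ?E = "{x\<in>space M. \<exists>n. 0 < psum ?h n x}"
  have h: "integrable M ?h" using r by simp
  have [measurable]: "?E \<in> sets M" "?A \<in> sets M" by measurable
  have "AE x in M. \<forall>n. psum ?h n x = psum r n x + psum (\<lambda>_. - c) n x" by (rule psum_add) (use r in auto)
  then have "AE x in M. x \<in> ?E \<longleftrightarrow> x \<in> ?A"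
    using psum_const[of "- c"]
  proof eventually_elim
    case (elim x)
    have "(\<exists>n. 0 < psum ?h n x) \<longleftrightarrow> (\<exists>n. 0 < psum ?h (Suc n) x)"
      by (metis gr0_conv_Suc less_irrefl neq0_conv psum_0)
    then show ?case using elim by simp
  qed
  then have "(\<integral>x. ?h x * indicator ?E x \<partial>M) = (\<integral>x. ?h x * indicator ?A x \<partial>M)"
    by (intro integral_cong_AE) (auto simp: indicator_def)
  then have "0 \<le> (\<integral>x. ?h x * indicator ?A x \<partial>M)" using maximal_lemma[OF h] by simp
  also have "\<dots> = (\<integral>x. r x * indicator ?A x - c * indicator ?A x \<partial>M)"
    by (simp add: algebra_simps)
  also have "\<dots> = (\<integral>x. r x * indicator ?A x \<partial>M) - c * measure M ?A"
    using r integrable_mult_indicator_T(2)[of "\<lambda>_. c" ?A]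
    by (subst Bochner_Integration.integral_diff) (simp_all add: integrable_mult_indicator_T)
  also have "(\<integral>x. r x * indicator ?A x \<partial>M) \<le> (\<integral>x. r x \<partial>M)"
    using r nonneg by (intro integral_mono_AE integrable_mult_indicator_T) (auto simp: indicator_def)
  finally show ?thesis by simp
qed

section \<open>Invariant functions\<close>

lemma sets_invariant_algebra:
  "sets (invariant_algebra M T) = {A \<in> sets M. T -` A \<inter> space M = A}"
proof -
  have "sigma_algebra (space M) {A \<in> sets M. T -` A \<inter> space M = A}"
    unfolding sigma_algebra_iff2
  proof (intro conjI ballI allI impI)
    fix A assume A: "A \<in> {A \<in> sets M. T -` A \<inter> space M = A}"
    then have "T -` (space M - A) \<inter> space M = space M - A"
      using measurable_space[OF T_measurable] by auto
    then show "space M - A \<in> {A \<in> sets M. T -` A \<inter> space M = A}" using A by auto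
  next
    fix A :: "nat \<Rightarrow> 'a set" assume A: "range A \<subseteq> {A \<in> sets M. T -` A \<inter> space M = A}"
    then have "T -` (\<Union>i. A i) \<inter> space M = (\<Union>i. A i)" by blast
    moreover have "(\<Union>i. A i) \<in> sets M" using A by (intro sets.countable_nat_UN) auto
    ultimately show "(\<Union>i. A i) \<in> {A \<in> sets M. T -` A \<inter> space M = A}" by simp
  qed (auto dest: sets.sets_into_space)
  then show ?thesis unfolding invariant_algebra_def by (rule sigma_algebra.sets_measure_of_eq)
qed

lemma space_invariant_algebra [simp]: "space (invariant_algebra M T) = space M"
  by (simp add: invariant_algebra_def space_measure_of_conv)

lemma subalgebra_invariant: "subalgebra M (invariant_algebra M T)"
  unfolding subalgebra_def by (auto simp: sets_invariant_algebra)

sublocale inv: finite_measure_subalgebra M "invariant_algebra M T"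
  by standard (rule subalgebra_invariant)

text \<open>The level set of \<open>h\<close> through \<open>x\<close> is invariant.\<close>

lemma invariant_algebra_fun:
  assumes h: "h \<in> borel_measurable (invariant_algebra M T)" and x: "x \<in> space M"
  shows "h (T x) = (h x :: real)"
proof -
  have "h -` {h x} \<inter> space (invariant_algebra M T) \<in> sets (invariant_algebra M T)"
    using h by (rule measurable_sets) simp
  then have "T -` (h -` {h x} \<inter> space M) \<inter> space M = h -` {h x} \<inter> space M"
    by (simp add: sets_invariant_algebra)
  then show ?thesis using x by blast
qed

lemma AE_T_funpow: "(AE x in M. Q x) \<Longrightarrow> (AE x in M. Q ((T ^^ n) x))"
proof (induction n)
  case (Suc n)
  then show ?case using AE_T[of "\<lambda>x. Q ((T ^^ n) x)"] by (simp add: funpow_swap1)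
qed simp

text \<open>The upper limit along the forward orbit is invariant at every point, and almost every forward orbit
sees only the value \<open>F x\<close>.\<close>

lemma ex_invariant_version:
  fixes F :: "'a \<Rightarrow> real"
  assumes F [measurable]: "F \<in> borel_measurable M" and inv: "AE x in M. F (T x) = F x"
  shows "\<exists>F' \<in> borel_measurable M. (AE x in M. F' x = F x) \<and> (\<forall>x\<in>space M. F' (T x) = F' x)"
proof -
  define F' where "F' x = real_of_ereal (limsup (\<lambda>n. ereal (F ((T ^^ n) x))))" for x
  have [measurable]: "(T ^^ n) \<in> measurable M M" for n by (induction n) (auto simp: id_def)
  have "F' \<in> borel_measurable M" unfolding F'_def by measurable
  moreover have "F' (T x) = F' x" for x
    unfolding F'_def using limsup_shift[of "\<lambda>n. ereal (F ((T ^^ n) x))"] by (simp add: funpow_swap1)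
  moreover have "AE x in M. F' x = F x"
  proof -
    have "AE x in M. \<forall>n. F (T ((T ^^ n) x)) = F ((T ^^ n) x)"
      unfolding AE_all_countable using AE_T_funpow[OF inv] by blast
    then show ?thesis
    proof eventually_elim
      case (elim x)
      have "F ((T ^^ n) x) = F x" for n by (induction n) (use elim in auto)
      then show ?case by (simp add: F'_def Limsup_const)
    qed
  qed
  ultimately show ?thesis by blast
qed

end

section \<open>Almost everywhere convergence of the averages\<close>

lemma (in sigma_finite_subalgebra) abs_real_cond_exp_le:
  assumes f: "integrable M f"
  shows "AE x in M. \<bar>real_cond_exp M F f x\<bar> \<le> real_cond_exp M F (\<lambda>x. \<bar>f x\<bar>) x"
proof -
  have m: "integrable M (\<lambda>x. - 1 * f x)" and a: "integrable M (\<lambda>x. \<bar>f x\<bar>)" using f by auto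
  have "AE x in M. real_cond_exp M F f x \<le> real_cond_exp M F (\<lambda>x. \<bar>f x\<bar>) x"
    by (rule real_cond_exp_mono[OF _ f a]) simp
  moreover have "AE x in M. real_cond_exp M F (\<lambda>x. - 1 * f x) x \<le> real_cond_exp M F (\<lambda>x. \<bar>f x\<bar>) x"
    by (rule real_cond_exp_mono[OF _ m a]) (intro AE_I2, simp)
  moreover have "AE x in M. real_cond_exp M F (\<lambda>x. - 1 * f x) x = - 1 * real_cond_exp M F f x"
    by (rule real_cond_exp_cmult[OF f])
  ultimately show ?thesis by eventually_elim (simp add: abs_le_iff)
qed

context measure_preserving
begin

definition avg :: "('a \<Rightarrow> real) \<Rightarrow> nat \<Rightarrow> 'a \<Rightarrow> real" where
  "avg f n x = psum f (Suc n) x / real (Suc n)"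

lemma borel_measurable_avg [measurable]: "f \<in> borel_measurable M \<Longrightarrow> avg f n \<in> borel_measurable M"
  unfolding avg_def by (intro borel_measurable_divide borel_measurable_psum borel_measurable_const)

lemma transfer_invariant:
  assumes u: "integrable M u" and inv: "\<And>x. x \<in> space M \<Longrightarrow> u (T x) = u x"
  shows "AE x in M. P u x = u x"
proof (rule transfer_unique[OF u u])
  fix A assume [measurable]: "A \<in> sets M"
  have [measurable]: "u \<in> borel_measurable M" using u by simp
  have "(\<integral>x. u x * indicator A x \<partial>M) = (\<integral>x. u (T x) * indicator A (T x) \<partial>M)"
    by (rule integral_T[symmetric]) measurable
  also have "\<dots> = (\<integral>x. u x * indicator A (T x) \<partial>M)"
    using inv by (intro Bochner_Integration.integral_cong) auto
  finally show "(\<integral>x. u x * indicator A x \<partial>M) = (\<integral>x. u x * indicator A (T x) \<partial>M)" .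
qed

lemma psum_invariant:
  assumes u: "integrable M u" and inv: "\<And>x. x \<in> space M \<Longrightarrow> u (T x) = u x"
  shows "AE x in M. \<forall>n. psum u n x = real n * u x"
proof -
  have [measurable]: "u \<in> borel_measurable M" using u by simp
  have "AE x in M. (P ^^ i) u x = u x" for i
  proof (induction i)
    case (Suc i)
    have "AE x in M. P ((P ^^ i) u) x = P u x" using u Suc by (intro transfer_cong integrable_iterate) auto
    moreover have "AE x in M. P u x = u x" by (rule transfer_invariant[OF u]) (rule inv)
    ultimately show ?case by eventually_elim simp
  qed simp
  then have "AE x in M. \<forall>i. (P ^^ i) u x = u x" by (simp add: AE_all_countable)
  then show ?thesis by eventually_elim (simp add: psum_def)
qed

lemma psum_mult_invariant:
  assumes "integrable M f" "g \<in> borel_measurable M" "\<And>x. \<bar>g x\<bar> \<le> C"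
    and "\<And>x. x \<in> space M \<Longrightarrow> g (T x) = g x"
  shows "AE x in M. \<forall>n. psum (\<lambda>x. f x * g x) n x = psum f n x * g x"
proof -
  have "AE x in M. \<forall>i. (P ^^ i) (\<lambda>x. f x * g x) x = (P ^^ i) f x * g x"
    unfolding AE_all_countable using assms by (intro allI iterate_mult_invariant)
  then show ?thesis by eventually_elim (simp add: psum_def sum_distrib_right)
qed

text \<open>\<open>F\<close> is the upper limit of the averages. The conclusion states the two halves of its definition
that are used later, the second one only as an upper bound by the supremum of all averages.

The tail suprema \<open>g k\<close> decrease to \<open>F\<close>. Since \<open>P\<close> is positive and moves the \<open>n\<close>-th average to the
next one up to \<open>O(1/n)\<close>, \<open>P (g k) \<ge> F\<close>. Integrating against \<open>F\<close> and letting \<open>k\<close> tend to infinity gives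
\<open>\<integral> F\<^sup>2 \<le> \<integral> F \<cdot> (F \<circ> T)\<close>; as \<open>F\<close> and \<open>F \<circ> T\<close> have the same second moment, \<open>F \<circ> T - F\<close> vanishes in
the mean square.\<close>

lemma ex_invariant_limsup:
  assumes f [measurable]: "f \<in> borel_measurable M" and fC: "\<And>x. 0 \<le> f x" "\<And>x. f x \<le> C"
  shows "\<exists>F \<in> borel_measurable M. (AE x in M. F (T x) = F x) \<and>
    (AE x in M. (\<forall>c>F x. \<forall>\<^sub>F n in sequentially. avg f n x < c) \<and> (\<forall>c<F x. \<exists>n. c < avg f n x))"
proof -
  have C: "0 \<le> C" using fC[of undefined] by simp
  have fi: "integrable M f" using fC by (intro integrable_const_bound[where B = C] AE_I2) auto
  \<comment> \<open>the averages lie between \<open>0\<close> and \<open>C\<close> only almost everywhere; clamping them keeps all suprema finite\<close>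
  define b where "b n x = max 0 (min C (avg f n x))" for n x
  have [measurable]: "b n \<in> borel_measurable M" for n unfolding b_def by measurable
  have b: "0 \<le> b n x" "b n x \<le> C" for n x using C by (auto simp: b_def)
  have bint: "integrable M (b n)" for n
    using b by (intro integrable_const_bound[where B = C] AE_I2) auto
  have bavg: "AE x in M. \<forall>n. b n x = avg f n x"
  proof -
    have "AE x in M. \<forall>n. psum (\<lambda>_. 0) n x \<le> psum f n x" using fC fi by (intro psum_mono) auto
    moreover have "AE x in M. \<forall>n. psum f n x \<le> psum (\<lambda>_. C) n x" using fC fi by (intro psum_mono) auto
    ultimately show ?thesis using psum_const[of 0] psum_const[of C]
    proof eventually_elim
      case (elim x)
      have "0 \<le> avg f n x" "avg f n x \<le> C" for n
        using elim(1,2)[rule_format, of "Suc n"] elim(3,4)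
        by (simp_all add: avg_def divide_le_eq mult.commute del: of_nat_Suc)
      then show ?case by (simp add: b_def)
    qed
  qed
  define g where "g k x = (SUP n. b (n + k) x)" for k x
  have bdd: "bdd_above (range (\<lambda>n. b (n + k) x))" for k x using b(2) by (intro bdd_aboveI) auto
  have [measurable]: "g k \<in> borel_measurable M" for k
    unfolding g_def using bdd by measurable
  have bg: "b n x \<le> g k x" if "k \<le> n" for n k x
    unfolding g_def using cSUP_upper[OF _ bdd, of "n - k" k x] that by simp
  have g: "0 \<le> g k x" "g k x \<le> C" for k x
    using b(1)[of k x] bg[of k k x] cSUP_least[of UNIV "\<lambda>n. b (n + k) x" C] b(2) by (auto simp: g_def)
  have gint: "integrable M (g k)" for k
    using g by (intro integrable_const_bound[where B = C] AE_I2) auto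
  define F where "F x = (INF k. g k x)" for x
  have bdg: "bdd_below (range (\<lambda>k. g k x))" for x using g(1) by (intro bdd_belowI) auto
  have Fm [measurable]: "F \<in> borel_measurable M" unfolding F_def using bdg by measurable
  have Fg: "F x \<le> g k x" for k x unfolding F_def by (rule cINF_lower[OF bdg]) simp
  have F: "0 \<le> F x" "F x \<le> C" for x
    using Fg[of x 0] g(2)[of 0 x] cINF_greatest[of UNIV 0 "\<lambda>k. g k x"] g(1) by (auto simp: F_def)
  have "decseq (\<lambda>k. g k x)" for x
  proof (rule decseq_SucI)
    show "g (Suc k) x \<le> g k x" for k
      unfolding g_def[of "Suc k"] using bg[of k] by (intro cSUP_least) auto
  qed
  then have lim: "(\<lambda>k. g k x) \<longlonglongrightarrow> F x" for x
    unfolding F_def using bdg by (intro LIMSEQ_decseq_INF)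
  have sub: "AE x in M. \<forall>k. F x \<le> P (g k) x"
  proof -
    have "AE x in M. \<forall>m k. P (b (m + k)) x \<le> P (g k) x"
      unfolding AE_all_countable by (intro allI transfer_mono bint gint AE_I2 bg) simp
    moreover have "AE x in M. \<forall>m. P (b m) x = P (avg f m) x"
      unfolding AE_all_countable using bavg by (intro allI transfer_cong bint) auto
    moreover have "AE x in M. \<forall>m. P (\<lambda>x. (1 / real (Suc m)) * psum f (Suc m) x) x =
        (1 / real (Suc m)) * P (psum f (Suc m)) x"
      unfolding AE_all_countable by (intro allI transfer_cmult integrable_psum fi)
    moreover have "avg f m = (\<lambda>x. (1 / real (Suc m)) * psum f (Suc m) x)" for m
      by (simp add: avg_def fun_eq_iff)
    moreover have "AE x in M. \<forall>n. psum f (Suc n) x = f x + P (psum f n) x"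
      unfolding AE_all_countable by (intro allI psum_Suc_transfer fi)
    ultimately have "AE x in M. (\<forall>m k. P (b (m + k)) x \<le> P (g k) x) \<and> (\<forall>m. P (b m) x = (1 / real (Suc m)) * P (psum f (Suc m)) x)
       \<and> (\<forall>n. psum f (Suc n) x = f x + P (psum f n) x)"
      by auto
    then show ?thesis using bavg
    proof eventually_elim
      case (elim x)
      \<comment> \<open>\<open>P\<close> applied to the \<open>m\<close>-th average is the next one, up to its first term \<open>f\<close> and the change of weight\<close>
      have step: "b (Suc m) x \<le> P (b m) x + C / real (Suc m)" for m
      proof -
        have "psum f (Suc (Suc m)) x = real (Suc (Suc m)) * b (Suc m) x"
          using elim(2) by (simp add: avg_def del: of_nat_Suc)
        then have "P (psum f (Suc m)) x = real (Suc (Suc m)) * b (Suc m) x - f x"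
          using elim(1) by (metis add_diff_cancel_left')
        then have "real (Suc m) * P (b m) x = real (Suc (Suc m)) * b (Suc m) x - f x"
          using elim(1) by (simp del: of_nat_Suc)
        also have "\<dots> \<ge> real (Suc m) * b (Suc m) x - C"
          using fC(2)[of x] b(1)[of "Suc m" x] by (simp add: algebra_simps)
        finally show ?thesis by (simp add: field_simps del: of_nat_Suc)
      qed
      show ?case
      proof
        fix k
        show "F x \<le> P (g k) x"
        proof (rule LIMSEQ_le_const)
          have "(\<lambda>K. P (g k) x + C * inverse (real (Suc K))) \<longlonglongrightarrow> P (g k) x + C * 0"
            by (intro tendsto_intros LIMSEQ_inverse_real_of_nat)
          then show "(\<lambda>K. P (g k) x + C * inverse (real (Suc K))) \<longlonglongrightarrow> P (g k) x" by simp
          have "F x \<le> P (g k) x + C * inverse (real (Suc K))" for K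
          proof -
            have "b (n + Suc (K + k)) x \<le> P (g k) x + C * inverse (real (Suc K))" for n
            proof -
              have "b (Suc (n + K + k)) x \<le> P (b (n + K + k)) x + C / real (Suc (n + K + k))" by (rule step)
              also have "\<dots> \<le> P (g k) x + C / real (Suc K)"
              proof (rule add_mono)
                show "P (b (n + K + k)) x \<le> P (g k) x" using elim(1) by blast
                show "C / real (Suc (n + K + k)) \<le> C / real (Suc K)" using C by (intro divide_left_mono) auto
              qed
              finally show ?thesis by (simp add: divide_inverse add.assoc)
            qed
            then have "g (Suc (K + k)) x \<le> P (g k) x + C * inverse (real (Suc K))"
              unfolding g_def[of "Suc (K + k)"] by (intro cSUP_least) auto
            then show ?thesis using Fg[of x "Suc (K + k)"] by simp
          qed
          then show "\<exists>N. \<forall>K\<ge>N. F x \<le> P (g k) x + C * inverse (real (Suc K))" by blast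
        qed
      qed
    qed
  qed
  have absF: "\<bar>F x\<bar> \<le> C" for x using F[of x] by simp
  have bdint: "integrable M h" if "h \<in> borel_measurable M" "\<And>x. \<bar>h x\<bar> \<le> D" for h :: "'a \<Rightarrow> real" and D
    using that by (intro integrable_const_bound[where B = D] AE_I2) auto
  have FF: "integrable M (\<lambda>x. F x * F x)" "integrable M (\<lambda>x. F x * F (T x))" "integrable M (\<lambda>x. F (T x) * F (T x))"
    using F C by (auto intro!: bdint[of _ "C * C"] simp: abs_mult abs_of_nonneg mult_mono)
  have le: "(\<integral>x. F x * F x \<partial>M) \<le> (\<integral>x. F x * F (T x) \<partial>M)"
  proof (rule LIMSEQ_le_const)
    show "(\<lambda>k. \<integral>x. g k x * F (T x) \<partial>M) \<longlonglongrightarrow> (\<integral>x. F x * F (T x) \<partial>M)"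
      using lim g F C
      by (intro integral_dominated_convergence[where w = "\<lambda>_. C * C"] AE_I2 tendsto_intros)
        (auto simp: abs_mult abs_of_nonneg mult_mono)
    have "(\<integral>x. F x * F x \<partial>M) \<le> (\<integral>x. g k x * F (T x) \<partial>M)" for k
    proof -
      have "(\<integral>x. F x * F x \<partial>M) \<le> (\<integral>x. P (g k) x * F x \<partial>M)"
        using sub F(1) transfer_dual(1)[OF gint Fm absF]
        by (intro integral_mono_AE FF) (auto elim!: eventually_mono intro!: mult_right_mono)
      then show ?thesis using transfer_dual(2)[OF gint Fm absF] by simp
    qed
    then show "\<exists>N. \<forall>k\<ge>N. (\<integral>x. F x * F x \<partial>M) \<le> (\<integral>x. g k x * F (T x) \<partial>M)" by blast
  qed
  have inv: "AE x in M. F (T x) = F x"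
  proof -
    have eq: "(F (T x) - F x)\<^sup>2 = F (T x) * F (T x) - 2 * (F x * F (T x)) + F x * F x" for x
      by (simp add: power2_eq_square algebra_simps)
    have i: "integrable M (\<lambda>x. (F (T x) - F x)\<^sup>2)"
      unfolding eq using FF by (intro Bochner_Integration.integrable_add Bochner_Integration.integrable_diff integrable_mult_right)
    have "(\<integral>x. (F (T x) - F x)\<^sup>2 \<partial>M) = (\<integral>x. F (T x) * F (T x) \<partial>M) - 2 * (\<integral>x. F x * F (T x) \<partial>M) + (\<integral>x. F x * F x \<partial>M)"
      unfolding eq using FF by simp
    also have "(\<integral>x. F (T x) * F (T x) \<partial>M) = (\<integral>x. F x * F x \<partial>M)"
      by (rule integral_T[of "\<lambda>x. F x * F x"]) measurable
    finally have "(\<integral>x. (F (T x) - F x)\<^sup>2 \<partial>M) \<le> 0" using le by simp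
    moreover have "0 \<le> (\<integral>x. (F (T x) - F x)\<^sup>2 \<partial>M)" by simp
    ultimately have "(\<integral>x. (F (T x) - F x)\<^sup>2 \<partial>M) = 0" by simp
    then have "AE x in M. (F (T x) - F x)\<^sup>2 = 0" using integral_nonneg_eq_0_iff_AE[OF i] by simp
    then show ?thesis by eventually_elim simp
  qed
  have "AE x in M. (\<forall>c>F x. \<forall>\<^sub>F n in sequentially. avg f n x < c) \<and> (\<forall>c<F x. \<exists>n. c < avg f n x)"
    using bavg
  proof eventually_elim
    case (elim x)
    show ?case
    proof (intro conjI allI impI)
      fix c assume "F x < c"
      then obtain k where "g k x < c" unfolding F_def using cINF_less_iff[OF _ bdg] by auto
      then have "avg f n x < c" if "n \<ge> k" for n using bg[OF that, of x] elim by simp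
      then show "\<forall>\<^sub>F n in sequentially. avg f n x < c" unfolding eventually_sequentially by blast
    next
      fix c assume "c < F x"
      then have "c < g 0 x" using Fg[of x 0] by simp
      then have "\<exists>n\<in>UNIV. c < b (n + 0) x" unfolding g_def by (subst (asm) less_cSUP_iff[OF _ bdd]) simp_all
      then obtain n where "c < b n x" by auto
      then show "\<exists>n. c < avg f n x" using elim by auto
    qed
  qed
  then show ?thesis using inv Fm by blast
qed

abbreviation cexp :: "('a \<Rightarrow> real) \<Rightarrow> 'a \<Rightarrow> real" where
  "cexp \<equiv> real_cond_exp M (invariant_algebra M T)"

lemma cexp_invariant: "x \<in> space M \<Longrightarrow> cexp f (T x) = cexp f x"
  by (rule invariant_algebra_fun) simp

text \<open>The maximal lemma is applied to \<open>f - cexp f - e\<close> restricted to the invariant set \<open>D\<close> where the upper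
limit exceeds \<open>cexp f + e\<close>. On \<open>D\<close> some partial sum is positive, and outside \<open>D\<close> all of them vanish, so the
integral over \<open>D\<close>, which is \<open>- e\<close> times the measure of \<open>D\<close>, is nonnegative.\<close>

lemma eventually_avg_less:
  assumes f [measurable]: "f \<in> borel_measurable M" and fC: "\<And>x. 0 \<le> f x" "\<And>x. f x \<le> C"
  shows "AE x in M. \<forall>c>cexp f x. \<forall>\<^sub>F n in sequentially. avg f n x < c"
proof -
  have fi: "integrable M f" using fC by (intro integrable_const_bound[where B = C] AE_I2) auto
  let ?g = "cexp f"
  have gi: "integrable M ?g" by (rule inv.real_cond_exp_int(1)[OF fi])
  have [measurable]: "?g \<in> borel_measurable M" by simp
  obtain F where [measurable]: "F \<in> borel_measurable M" and Finv: "AE x in M. F (T x) = F x"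
    and F: "AE x in M. (\<forall>c>F x. \<forall>\<^sub>F n in sequentially. avg f n x < c) \<and> (\<forall>c<F x. \<exists>n. c < avg f n x)"
    using ex_invariant_limsup[OF f fC] by blast
  obtain F' where [measurable]: "F' \<in> borel_measurable M" and F': "AE x in M. F' x = F x"
    and F'inv: "\<And>x. x \<in> space M \<Longrightarrow> F' (T x) = F' x"
    using ex_invariant_version[OF _ Finv] by auto
  have "AE x in M. F x \<le> ?g x + e" if e: "0 < e" for e
  proof -
    define D where "D = {x\<in>space M. ?g x + e < F' x}"
    have D [measurable]: "D \<in> sets M" unfolding D_def by measurable
    have Dinv: "T x \<in> D \<longleftrightarrow> x \<in> D" if "x \<in> space M" for x
      using that measurable_space[OF T_measurable] F'inv cexp_invariant by (simp add: D_def)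
    then have "T -` D \<inter> space M = D" using sets.sets_into_space[OF D] by auto
    then have DI: "D \<in> sets (invariant_algebra M T)" by (simp add: sets_invariant_algebra)
    let ?u = "\<lambda>x. - (?g x + e)"
    let ?k = "\<lambda>x. f x + ?u x"
    let ?h = "\<lambda>x. ?k x * indicator D x"
    have ui: "integrable M ?u" using gi by simp
    have ki: "integrable M ?k" using ui fi by simp
    have hi: "integrable M ?h" using ki D by (rule integrable_mult_indicator_T)
    let ?E = "{x\<in>space M. \<exists>n. 0 < psum ?h n x}"
    have "AE x in M. \<forall>n. psum ?h n x = psum ?k n x * indicator D x"
      by (rule psum_mult_invariant[OF ki, where C = 1]) (auto simp: indicator_def Dinv)
    moreover have "AE x in M. \<forall>n. psum ?k n x = psum f n x + psum ?u n x" by (rule psum_add[OF fi ui])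
    moreover have "AE x in M. \<forall>n. psum ?u n x = real n * ?u x"
      by (rule psum_invariant[OF ui]) (simp add: cexp_invariant)
    ultimately have "AE x in M. x \<in> ?E \<longleftrightarrow> x \<in> D"
      using F F' AE_space
    proof eventually_elim
      case (elim x)
      have eq: "psum ?h n x = (psum f n x - real n * (?g x + e)) * indicator D x" for n
        unfolding elim(1)[rule_format] elim(2)[rule_format] elim(3)[rule_format] by (simp add: algebra_simps)
      show ?case
      proof
        assume "x \<in> D"
        then have "?g x + e < F x" using elim(5) by (simp add: D_def)
        then obtain n where "?g x + e < avg f n x" using elim(4) by blast
        then have "0 < psum f (Suc n) x - real (Suc n) * (?g x + e)"
          by (simp add: avg_def field_simps del: of_nat_Suc)
        then have "0 < psum ?h (Suc n) x" unfolding eq using \<open>x \<in> D\<close> by simp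
        then show "x \<in> ?E" using elim(6) by blast
      next
        assume "x \<in> ?E"
        then obtain n where "0 < psum ?h n x" by blast
        then show "x \<in> D" unfolding eq by (cases "x \<in> D") auto
      qed
    qed
    then have "(\<integral>x. ?h x * indicator ?E x \<partial>M) = (\<integral>x. ?h x \<partial>M)"
      using hi borel_measurable_psum[of ?h] by (intro integral_cong_AE) (auto simp: indicator_def)
    then have "0 \<le> (\<integral>x. ?h x \<partial>M)" using maximal_lemma[OF hi] by simp
    also have "\<dots> = (\<integral>x. f x * indicator D x - ?g x * indicator D x - e * indicator D x \<partial>M)"
      by (simp add: algebra_simps)
    also have "\<dots> = (\<integral>x. f x * indicator D x \<partial>M) - (\<integral>x. ?g x * indicator D x \<partial>M) - e * measure M D"
      using fi gi D integrable_mult_indicator_T(2)[OF fi D] integrable_mult_indicator_T(2)[OF gi D]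
        integrable_mult_indicator_T(2)[of "\<lambda>_. e", OF _ D]
      by simp
    also have "(\<integral>x. f x * indicator D x \<partial>M) = (\<integral>x. ?g x * indicator D x \<partial>M)"
      using inv.real_cond_exp_intA[OF fi DI] by (simp add: set_lebesgue_integral_def mult.commute)
    finally have "measure M D \<le> 0" using e by (simp add: mult_le_0_iff)
    then have "D \<in> null_sets M"
      using D measure_nonneg[of M D] by (simp add: null_sets_def emeasure_eq_measure)
    then show ?thesis using F' AE_not_in[of D M] AE_space
      by (auto simp: D_def not_less elim: eventually_elim2)
  qed
  then have "AE x in M. \<forall>m. F x \<le> ?g x + inverse (real (Suc m))"
    unfolding AE_all_countable by simp
  then show ?thesis using F
  proof eventually_elim
    case (elim x)
    have "F x \<le> ?g x"
    proof (rule LIMSEQ_le_const)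
      have "(\<lambda>m. ?g x + inverse (real (Suc m))) \<longlonglongrightarrow> ?g x + 0"
        by (intro tendsto_intros LIMSEQ_inverse_real_of_nat)
      then show "(\<lambda>m. ?g x + inverse (real (Suc m))) \<longlonglongrightarrow> ?g x" by simp
    qed (use elim(1) in blast)
    then show ?case using elim(2) by auto
  qed
qed

text \<open>The one-sided bound is used for \<open>f + C\<close> and for \<open>C - f\<close>.\<close>

lemma avg_tendsto_bounded:
  assumes f [measurable]: "f \<in> borel_measurable M" and fC: "\<And>x. \<bar>f x\<bar> \<le> C"
  shows "AE x in M. (\<lambda>n. avg f n x) \<longlonglongrightarrow> cexp f x"
proof -
  have fi: "integrable M f" using fC by (intro integrable_const_bound[where B = C] AE_I2) auto
  have fC': "- C \<le> f x" "f x \<le> C" for x using fC[of x] by auto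
  have mi: "integrable M (\<lambda>x. - 1 * f x)" using fi by simp
  let ?p = "\<lambda>x. f x + C" and ?m = "\<lambda>x. - 1 * f x + C"
  have "AE x in M. \<forall>c>cexp ?p x. \<forall>\<^sub>F n in sequentially. avg ?p n x < c"
  proof (rule eventually_avg_less)
    show "0 \<le> ?p x" "?p x \<le> 2 * C" for x using fC'[of x] by linarith+
  qed measurable
  moreover have "AE x in M. \<forall>c>cexp ?m x. \<forall>\<^sub>F n in sequentially. avg ?m n x < c"
  proof (rule eventually_avg_less)
    show "0 \<le> ?m x" "?m x \<le> 2 * C" for x using fC'[of x] by linarith+
  qed measurable
  moreover have "AE x in M. cexp ?p x = cexp f x + cexp (\<lambda>_. C) x" by (rule inv.real_cond_exp_add[OF fi]) simp
  moreover have "AE x in M. cexp ?m x = cexp (\<lambda>x. - 1 * f x) x + cexp (\<lambda>_. C) x"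
    by (rule inv.real_cond_exp_add[OF mi]) simp
  moreover have "AE x in M. cexp (\<lambda>x. - 1 * f x) x = - 1 * cexp f x"
    by (rule inv.real_cond_exp_cmult[OF fi])
  moreover have "AE x in M. cexp (\<lambda>_. C) x = C" by (rule inv.real_cond_exp_F_meas) auto
  moreover have "AE x in M. \<forall>n. psum ?p n x = psum f n x + psum (\<lambda>_. C) n x" by (rule psum_add[OF fi]) simp
  moreover have "AE x in M. \<forall>n. psum ?m n x = psum (\<lambda>x. - 1 * f x) n x + psum (\<lambda>_. C) n x"
    by (rule psum_add[OF mi]) simp
  moreover have "AE x in M. \<forall>n. psum (\<lambda>x. - 1 * f x) n x = - 1 * psum f n x" by (rule psum_cmult[OF fi])
  moreover have "AE x in M. \<forall>n. psum (\<lambda>_. C) n x = real n * C" by (rule psum_const)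
  ultimately show ?thesis
  proof eventually_elim
    case (elim x)
    have p: "avg ?p n x = avg f n x + C" and m: "avg ?m n x = - avg f n x + C" for n
      using elim(7-10) by (simp_all add: avg_def field_simps del: of_nat_Suc)
    show ?case
    proof (rule order_tendstoI)
      fix a assume "a < cexp f x"
      then have "cexp ?m x < - a + C" using elim(4,5,6) by simp
      then have "\<forall>\<^sub>F n in sequentially. avg ?m n x < - a + C" using elim(2) by blast
      then show "\<forall>\<^sub>F n in sequentially. a < avg f n x" by (rule eventually_mono) (unfold m, linarith)
    next
      fix a assume "cexp f x < a"
      then have "cexp ?p x < a + C" using elim(3,6) by simp
      then have "\<forall>\<^sub>F n in sequentially. avg ?p n x < a + C" using elim(1) by blast
      then show "\<forall>\<^sub>F n in sequentially. avg f n x < a" by (rule eventually_mono) (unfold p, linarith)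
    qed
  qed
qed

definition clamp :: "nat \<Rightarrow> real \<Rightarrow> real" where "clamp k t = max (- real k) (min (real k) t)"

lemma borel_measurable_clamp [measurable]: "clamp k \<in> borel_measurable borel"
  unfolding clamp_def by measurable

lemma abs_clamp_le: "\<bar>clamp k t\<bar> \<le> real k"
  by (auto simp: clamp_def)

lemma abs_diff_clamp_le: "\<bar>t - clamp k t\<bar> \<le> \<bar>t\<bar>"
  by (auto simp: clamp_def)

lemma diff_clamp_tendsto: "(\<lambda>k. t - clamp k t) \<longlonglongrightarrow> 0"
proof -
  obtain N :: nat where "\<bar>t\<bar> \<le> real N" using real_arch_simple by blast
  then have "t - clamp k t = 0" if "k \<ge> N" for k
    using that by (auto simp: clamp_def max_def min_def abs_le_iff)
  then show ?thesis by (intro tendsto_eventually) (auto simp: eventually_sequentially)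
qed

lemma split_clamp:
  assumes f: "integrable M f"
  shows "AE x in M. (\<forall>n. avg f n x = avg (\<lambda>x. clamp k (f x)) n x + avg (\<lambda>x. f x - clamp k (f x)) n x) \<and>
    cexp f x = cexp (\<lambda>x. clamp k (f x)) x + cexp (\<lambda>x. f x - clamp k (f x)) x"
proof -
  have [measurable]: "f \<in> borel_measurable M" using f by simp
  have c: "integrable M (\<lambda>x. clamp k (f x))"
    using abs_clamp_le by (intro integrable_const_bound[where B = "real k"] AE_I2) auto
  then have r: "integrable M (\<lambda>x. f x - clamp k (f x))" using f by simp
  have "AE x in M. cexp (\<lambda>x. clamp k (f x) + (f x - clamp k (f x))) x = cexp (\<lambda>x. clamp k (f x)) x + cexp (\<lambda>x. f x - clamp k (f x)) x"
    by (rule inv.real_cond_exp_add[OF c r])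
  with psum_add[OF c r] show ?thesis
    by eventually_elim (simp add: avg_def add_divide_distrib)
qed

text \<open>With \<open>f = clamp k f + r\<close>, a deviation of \<open>3 * e\<close> that recurs for infinitely many \<open>n\<close> forces the
averages of \<open>\<bar>r\<bar>\<close> to exceed \<open>e\<close> or \<open>\<bar>cexp r\<bar>\<close> to reach \<open>e\<close>. The weak-type inequality and Markov's
inequality bound the measure of both events by the integral of \<open>\<bar>r\<bar>\<close> over \<open>e\<close>, which tends to \<open>0\<close>.\<close>

theorem avg_tendsto:
  assumes f: "integrable M f"
  shows "AE x in M. (\<lambda>n. avg f n x) \<longlonglongrightarrow> cexp f x"
proof -
  have [measurable]: "f \<in> borel_measurable M" using f by simp
  have [measurable]: "cexp h \<in> borel_measurable M" for h by simp
  have "AE x in M. \<forall>\<^sub>F n in sequentially. \<bar>avg f n x - cexp f x\<bar> < 3 * e" if e: "0 < e" for e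
  proof -
    define Bad where "Bad = {x\<in>space M. \<forall>N. \<exists>n. N \<le> n \<and> 3 * e \<le> \<bar>avg f n x - cexp f x\<bar>}"
    have [measurable]: "Bad \<in> sets M" unfolding Bad_def by measurable
    let ?r = "\<lambda>k x. f x - clamp k (f x)"
    have r: "integrable M (?r k)" for k
      using abs_clamp_le by (intro Bochner_Integration.integrable_diff f integrable_const_bound[where B = "real k"] AE_I2) auto
    have le: "measure M Bad \<le> 2 / e * (\<integral>x. \<bar>?r k x\<bar> \<partial>M)" for k
    proof -
      let ?A1 = "{x\<in>space M. \<exists>n. real (Suc n) * e < psum (\<lambda>x. \<bar>?r k x\<bar>) (Suc n) x}"
      let ?A2 = "{x\<in>space M. e \<le> \<bar>cexp (?r k) x\<bar>}"
      have A [measurable]: "?A1 \<in> sets M" "?A2 \<in> sets M" by measurable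
      have "AE x in M. (\<lambda>n. avg (\<lambda>x. clamp k (f x)) n x) \<longlonglongrightarrow> cexp (\<lambda>x. clamp k (f x)) x"
        using abs_clamp_le by (intro avg_tendsto_bounded) auto
      moreover note split_clamp[OF f, of k]
      moreover have "AE x in M. \<forall>n. \<bar>psum (?r k) n x\<bar> \<le> psum (\<lambda>x. \<bar>?r k x\<bar>) n x" by (rule psum_abs_le[OF r])
      ultimately have "AE x in M. x \<in> Bad \<longrightarrow> x \<in> ?A1 \<union> ?A2"
      proof eventually_elim
        case (elim x)
        show ?case
        proof (rule impI, rule ccontr)
          assume x: "x \<in> Bad" "x \<notin> ?A1 \<union> ?A2"
          have "\<bar>avg (?r k) n x\<bar> \<le> e" for n
          proof -
            have "\<bar>psum (?r k) (Suc n) x\<bar> \<le> real (Suc n) * e"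
              using x elim(3)[rule_format, of "Suc n"] unfolding Bad_def by (auto simp: not_less intro: order_trans)
            then show ?thesis by (simp add: avg_def abs_divide divide_le_eq mult.commute del: of_nat_Suc)
          qed
          moreover have "\<bar>cexp (?r k) x\<bar> < e" using x by (auto simp: Bad_def)
          moreover obtain N where N: "\<And>n. n \<ge> N \<Longrightarrow> \<bar>avg (\<lambda>x. clamp k (f x)) n x - cexp (\<lambda>x. clamp k (f x)) x\<bar> < e"
            using elim(1) e unfolding LIMSEQ_iff by auto
          moreover obtain n where n: "N \<le> n" "3 * e \<le> \<bar>avg f n x - cexp f x\<bar>" using x(1) by (auto simp: Bad_def)
          ultimately show False using elim(2) by (smt (verit))
        qed
      qed
      then have "measure M Bad \<le> measure M (?A1 \<union> ?A2)" by (intro finite_measure_mono_AE) auto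
      also have "\<dots> \<le> measure M ?A1 + measure M ?A2" by (intro measure_Un_le) auto
      also have "measure M ?A1 \<le> (\<integral>x. \<bar>?r k x\<bar> \<partial>M) / e"
        using maximal_inequality[of "\<lambda>x. \<bar>?r k x\<bar>" e] r e by (simp add: field_simps)
      also have "measure M ?A2 \<le> (\<integral>x. \<bar>cexp (?r k) x\<bar> \<partial>M) / e"
        using e r inv.real_cond_exp_int(1)[OF r]
        by (intro integral_Markov_inequality_measure[where A = "space M"]) auto
      also have "(\<integral>x. \<bar>cexp (?r k) x\<bar> \<partial>M) \<le> (\<integral>x. cexp (\<lambda>x. \<bar>?r k x\<bar>) x \<partial>M)"
        using r inv.real_cond_exp_int(1)[OF r] inv.real_cond_exp_int(1)[OF integrable_abs[OF r]]
        by (intro integral_mono_AE inv.abs_real_cond_exp_le) auto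
      also have "\<dots> = (\<integral>x. \<bar>?r k x\<bar> \<partial>M)" using r by (intro inv.real_cond_exp_int(2)) auto
      finally show ?thesis using e by (simp add: divide_right_mono)
    qed
    have "(\<lambda>k. \<integral>x. \<bar>?r k x\<bar> \<partial>M) \<longlonglongrightarrow> (\<integral>x. 0 \<partial>M)"
      using f abs_diff_clamp_le
      by (intro integral_dominated_convergence[where w = "\<lambda>x. \<bar>f x\<bar>"] AE_I2 tendsto_rabs_zero diff_clamp_tendsto) auto
    then have "(\<lambda>k. 2 / e * (\<integral>x. \<bar>?r k x\<bar> \<partial>M)) \<longlonglongrightarrow> 2 / e * 0" by (intro tendsto_intros) simp
    then have "measure M Bad \<le> 2 / e * 0" by (rule LIMSEQ_le_const) (use le in blast)
    then have "Bad \<in> null_sets M"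
      using measure_nonneg[of M Bad] by (simp add: null_sets_def emeasure_eq_measure)
    then have "AE x in M. x \<notin> Bad" by (rule AE_not_in)
    then show ?thesis using AE_space
    proof eventually_elim
      case (elim x)
      then have "\<exists>N. \<forall>n\<ge>N. \<not> 3 * e \<le> \<bar>avg f n x - cexp f x\<bar>" unfolding Bad_def by blast
      then show ?case unfolding eventually_sequentially by (simp only: not_le)
    qed
  qed
  then have "AE x in M. \<forall>m. \<forall>\<^sub>F n in sequentially. \<bar>avg f n x - cexp f x\<bar> < 3 * inverse (real (Suc m))"
    unfolding AE_all_countable by simp
  then show ?thesis
  proof eventually_elim
    case (elim x)
    show ?case
    proof (rule tendstoI)
      fix e :: real assume "0 < e"
      then obtain m where "inverse (real (Suc m)) < e / 3" using reals_Archimedean[of "e / 3"] by auto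
      then have "3 * inverse (real (Suc m)) < e" by simp
      then show "\<forall>\<^sub>F n in sequentially. dist (avg f n x) (cexp f x) < e"
        using elim[rule_format, of m] by (auto simp: dist_real_def elim!: eventually_mono)
    qed
  qed
qed

end

section \<open>Convergence of the averages in the mean of order p\<close>

text \<open>The convexity of \<open>x powr p\<close> on the positive reals, extended to arguments \<open>0\<close> by \<open>s powr p \<le> s\<close> for
\<open>s\<close> between \<open>0\<close> and \<open>1\<close>, and to both signs by the triangle inequality.\<close>

lemma convex_on_abs_powr:
  assumes p: "1 \<le> p"
  shows "convex_on UNIV (\<lambda>x :: real. \<bar>x\<bar> powr p)"
proof (rule convex_onI)
  fix t x y :: real assume t: "0 < t" "t < 1"
  have small: "(s * a) powr p \<le> s * a powr p" if "0 < s" "s < 1" "0 \<le> a" for s a :: real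
  proof -
    have "s powr p \<le> s powr 1" using that p by (intro powr_mono') auto
    then have "s powr p * a powr p \<le> s * a powr p" using that by (intro mult_right_mono) auto
    then show ?thesis using that by (simp add: powr_mult)
  qed
  have conv: "((1 - t) * a + t * b) powr p \<le> (1 - t) * a powr p + t * b powr p" if "0 \<le> a" "0 \<le> b" for a b
  proof (cases "a = 0 \<or> b = 0")
    case True
    then show ?thesis using small[of t b] small[of "1 - t" a] t that p by auto
  next
    case False
    then show ?thesis using convex_onD[OF powr_convex[OF p], of t a b] t that by auto
  qed
  have "\<bar>(1 - t) *\<^sub>R x + t *\<^sub>R y\<bar> \<le> (1 - t) * \<bar>x\<bar> + t * \<bar>y\<bar>"
    using t abs_triangle_ineq[of "(1 - t) * x" "t * y"] by (simp add: abs_mult)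
  then have "\<bar>(1 - t) *\<^sub>R x + t *\<^sub>R y\<bar> powr p \<le> ((1 - t) * \<bar>x\<bar> + t * \<bar>y\<bar>) powr p"
    using p by (intro powr_mono2) auto
  also have "\<dots> \<le> (1 - t) * \<bar>x\<bar> powr p + t * \<bar>y\<bar> powr p" by (rule conv) auto
  finally show "\<bar>(1 - t) *\<^sub>R x + t *\<^sub>R y\<bar> powr p \<le> (1 - t) * \<bar>x\<bar> powr p + t * \<bar>y\<bar> powr p" .
qed auto

lemma (in finite_measure_subalgebra) real_cond_exp_Lp:
  assumes p: "1 \<le> p" and f: "integrable M f" "integrable M (\<lambda>x. \<bar>f x\<bar> powr p)"
  shows "integrable M (\<lambda>x. \<bar>real_cond_exp M F f x\<bar> powr p)"
    "(\<integral>x. \<bar>real_cond_exp M F f x\<bar> powr p \<partial>M) \<le> (\<integral>x. \<bar>f x\<bar> powr p \<partial>M)"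
proof -
  have m: "(\<lambda>x :: real. \<bar>x\<bar> powr p) \<in> borel_measurable borel" by measurable
  show i: "integrable M (\<lambda>x. \<bar>real_cond_exp M F f x\<bar> powr p)"
    using integrable_convex_cond_exp[OF f(1) _ _ f(2) convex_on_abs_powr[OF p] m] by simp
  have "AE x in M. \<bar>real_cond_exp M F f x\<bar> powr p \<le> real_cond_exp M F (\<lambda>x. \<bar>f x\<bar> powr p) x"
    using real_cond_exp_jensens_inequality(2)[OF f(1) _ _ f(2) convex_on_abs_powr[OF p] m] by simp
  then have "(\<integral>x. \<bar>real_cond_exp M F f x\<bar> powr p \<partial>M) \<le> (\<integral>x. real_cond_exp M F (\<lambda>x. \<bar>f x\<bar> powr p) x \<partial>M)"
    by (intro integral_mono_AE i real_cond_exp_int f(2))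
  also have "\<dots> = (\<integral>x. \<bar>f x\<bar> powr p \<partial>M)" by (rule real_cond_exp_int(2)[OF f(2)])
  finally show "(\<integral>x. \<bar>real_cond_exp M F f x\<bar> powr p \<partial>M) \<le> (\<integral>x. \<bar>f x\<bar> powr p \<partial>M)" .
qed

context measure_preserving
begin

lemma in_Lp_integrable:
  assumes p: "1 \<le> p" and f: "in_Lp M p f"
  shows "integrable M f"
proof (rule Bochner_Integration.integrable_bound)
  show "integrable M (\<lambda>x. 1 + \<bar>f x\<bar> powr p)" "f \<in> borel_measurable M"
    using f by (auto simp: in_Lp_def)
  have "\<bar>t\<bar> \<le> 1 + \<bar>t\<bar> powr p" for t :: real
  proof (cases "\<bar>t\<bar> \<le> 1")
    case False
    then have "\<bar>t\<bar> powr 1 \<le> \<bar>t\<bar> powr p" using p by (intro powr_mono) auto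
    then show ?thesis using False by simp
  qed (simp add: add_increasing2)
  then show "AE x in M. norm (f x) \<le> norm (1 + \<bar>f x\<bar> powr p)"
    by (intro AE_I2) (simp add: abs_of_nonneg add_nonneg_nonneg)
qed

text \<open>\<open>P f \<circ> T\<close> is the conditional expectation of \<open>f\<close> given the \<open>\<sigma>\<close>-algebra of preimages under \<open>T\<close>, and it has
the same distribution as \<open>P f\<close>; Jensen's inequality for conditional expectations does the rest.\<close>

lemma transfer_Lp:
  assumes p: "1 \<le> p" and f: "in_Lp M p f"
  shows "in_Lp M p (P f)" "(\<integral>x. \<bar>P f x\<bar> powr p \<partial>M) \<le> (\<integral>x. \<bar>f x\<bar> powr p \<partial>M)"
proof -
  have fi: "integrable M f" using in_Lp_integrable[OF p f] .
  have fp: "integrable M (\<lambda>x. \<bar>f x\<bar> powr p)" using f by (simp add: in_Lp_def)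
  let ?V = "vimage_algebra (space M) T M"
  have sub: "subalgebra M ?V"
    unfolding subalgebra_def by (auto simp: sets_vimage_algebra2[OF measurable_space[OF T_measurable, THEN funcsetI]])
  interpret V: finite_measure_subalgebra M ?V by standard (rule sub)
  have TV: "T \<in> measurable ?V M" by (rule measurable_vimage_algebra1) (use measurable_space[OF T_measurable] in auto)
  have eq: "AE x in M. real_cond_exp M ?V f x = P f (T x)"
  proof (rule V.real_cond_exp_charact)
    fix A assume "A \<in> sets ?V"
    then obtain B where B: "B \<in> sets M" "A = T -` B \<inter> space M"
      by (auto simp: sets_vimage_algebra2[OF measurable_space[OF T_measurable, THEN funcsetI]])
    have i: "indicator A x = (indicator B (T x) :: real)" if "x \<in> space M" for x
      using that B by (auto simp: indicator_def)
    have "(\<integral>x. indicator A x * f x \<partial>M) = (\<integral>x. f x * indicator B (T x) \<partial>M)"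
      by (intro Bochner_Integration.integral_cong) (auto simp: i)
    also have "\<dots> = (\<integral>x. P f x * indicator B x \<partial>M)" using transfer_set[OF fi B(1)] by simp
    also have "\<dots> = (\<integral>x. P f (T x) * indicator B (T x) \<partial>M)"
      using B(1) by (intro integral_T[of "\<lambda>x. P f x * indicator B x", symmetric]) simp
    also have "\<dots> = (\<integral>x. indicator A x * P f (T x) \<partial>M)"
      by (intro Bochner_Integration.integral_cong) (auto simp: i)
    finally show "(\<integral>x\<in>A. f x \<partial>M) = (\<integral>x\<in>A. P f (T x) \<partial>M)" by (simp add: set_lebesgue_integral_def)
  next
    show "(\<lambda>x. P f (T x)) \<in> borel_measurable ?V" by (rule measurable_compose[OF TV borel_measurable_transfer])
  qed (use fi integrable_T[OF integrable_transfer[OF fi]] in auto)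
  have iT: "integrable M (\<lambda>x. \<bar>P f (T x)\<bar> powr p)"
    using V.real_cond_exp_Lp(1)[OF p fi fp] eq
    by (subst integrable_cong_AE[where g = "\<lambda>x. \<bar>real_cond_exp M ?V f x\<bar> powr p"]) auto
  have "integrable (distr M M T) (\<lambda>x. \<bar>P f x\<bar> powr p)"
    using iT by (subst integrable_distr_eq) auto
  then show "in_Lp M p (P f)" by (simp add: distr_T in_Lp_def)
  have "(\<integral>x. \<bar>P f x\<bar> powr p \<partial>M) = (\<integral>x. \<bar>P f (T x)\<bar> powr p \<partial>M)"
    by (rule integral_T[symmetric]) measurable
  also have "\<dots> = (\<integral>x. \<bar>real_cond_exp M ?V f x\<bar> powr p \<partial>M)" using eq by (intro integral_cong_AE) auto
  also have "\<dots> \<le> (\<integral>x. \<bar>f x\<bar> powr p \<partial>M)" by (rule V.real_cond_exp_Lp(2)[OF p fi fp])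
  finally show "(\<integral>x. \<bar>P f x\<bar> powr p \<partial>M) \<le> (\<integral>x. \<bar>f x\<bar> powr p \<partial>M)" .
qed

lemma iterate_Lp:
  assumes p: "1 \<le> p" and f: "in_Lp M p f"
  shows "in_Lp M p ((P ^^ i) f) \<and> (\<integral>x. \<bar>(P ^^ i) f x\<bar> powr p \<partial>M) \<le> (\<integral>x. \<bar>f x\<bar> powr p \<partial>M)"
proof (induction i)
  case (Suc i)
  then show ?case using transfer_Lp[OF p, of "(P ^^ i) f"] by auto
qed (use f in simp)

lemma avg_Lp:
  assumes p: "1 \<le> p" and f: "in_Lp M p f"
  shows "in_Lp M p (avg f n)" "(\<integral>x. \<bar>avg f n x\<bar> powr p \<partial>M) \<le> (\<integral>x. \<bar>f x\<bar> powr p \<partial>M)"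
proof -
  have [measurable]: "f \<in> borel_measurable M" using f by (simp add: in_Lp_def)
  let ?w = "inverse (real (Suc n))"
  have le: "\<bar>avg f n x\<bar> powr p \<le> (\<Sum>i<Suc n. ?w * \<bar>(P ^^ i) f x\<bar> powr p)" for x
  proof -
    have "avg f n x = (\<Sum>i<Suc n. ?w *\<^sub>R (P ^^ i) f x)"
      unfolding avg_def psum_def real_scaleR_def sum_distrib_left[symmetric]
      by (simp only: divide_inverse mult.commute)
    moreover have "{..<Suc n} \<noteq> {}" by blast
    ultimately show ?thesis
      using convex_on_sum[OF _ _ convex_on_abs_powr[OF p], of "{..<Suc n}" "\<lambda>_. ?w" "\<lambda>i. (P ^^ i) f x"]
      by (simp del: of_nat_Suc sum.lessThan_Suc)
  qed
  have int: "integrable M (\<lambda>x. \<Sum>i<Suc n. ?w * \<bar>(P ^^ i) f x\<bar> powr p)"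
    using iterate_Lp[OF p f] by (intro Bochner_Integration.integrable_sum integrable_mult_right) (simp add: in_Lp_def)
  have "integrable M (\<lambda>x. \<bar>avg f n x\<bar> powr p)"
    by (rule Bochner_Integration.integrable_bound[OF int])
      (use le in \<open>auto intro!: AE_I2 order_trans[OF _ abs_ge_self]\<close>)
  then show "in_Lp M p (avg f n)" by (simp add: in_Lp_def)
  have "(\<integral>x. \<bar>avg f n x\<bar> powr p \<partial>M) \<le> (\<integral>x. (\<Sum>i<Suc n. ?w * \<bar>(P ^^ i) f x\<bar> powr p) \<partial>M)"
    by (intro integral_mono int le) fact
  also have "\<dots> = (\<Sum>i<Suc n. ?w * (\<integral>x. \<bar>(P ^^ i) f x\<bar> powr p \<partial>M))"
    using iterate_Lp[OF p f] by (subst Bochner_Integration.integral_sum) (auto simp: in_Lp_def)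
  also have "\<dots> \<le> (\<Sum>i<Suc n. ?w * (\<integral>x. \<bar>f x\<bar> powr p \<partial>M))"
    using iterate_Lp[OF p f] by (intro sum_mono mult_left_mono) auto
  also have "\<dots> = (\<integral>x. \<bar>f x\<bar> powr p \<partial>M)" by (simp del: sum.lessThan_Suc of_nat_Suc)
  finally show "(\<integral>x. \<bar>avg f n x\<bar> powr p \<partial>M) \<le> (\<integral>x. \<bar>f x\<bar> powr p \<partial>M)" .
qed

lemma cexp_Lp:
  assumes p: "1 \<le> p" and f: "in_Lp M p f"
  shows "in_Lp M p (cexp f)" "(\<integral>x. \<bar>cexp f x\<bar> powr p \<partial>M) \<le> (\<integral>x. \<bar>f x\<bar> powr p \<partial>M)"
  using inv.real_cond_exp_Lp[OF p in_Lp_integrable[OF p f]] f by (auto simp: in_Lp_def)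

lemma abs_add3_powr_le:
  fixes x y z p :: real
  assumes "1 \<le> p"
  shows "\<bar>x + y + z\<bar> powr p \<le> 3 powr p * (\<bar>x\<bar> powr p + \<bar>y\<bar> powr p + \<bar>z\<bar> powr p)"
proof -
  define m where "m = max \<bar>x\<bar> (max \<bar>y\<bar> \<bar>z\<bar>)"
  have "\<bar>x + y + z\<bar> \<le> 3 * m" by (auto simp: m_def)
  then have "\<bar>x + y + z\<bar> powr p \<le> (3 * m) powr p" using assms by (intro powr_mono2) auto
  also have "\<dots> = 3 powr p * m powr p" by (rule powr_mult)
  also have "m powr p \<le> \<bar>x\<bar> powr p + \<bar>y\<bar> powr p + \<bar>z\<bar> powr p"
    by (auto simp: m_def max_def)
  finally show ?thesis by simp
qed

lemma avg_bounded:
  assumes [measurable]: "f \<in> borel_measurable M" and f: "\<And>x. \<bar>f x\<bar> \<le> C"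
  shows "AE x in M. (\<forall>n. \<bar>avg f n x\<bar> \<le> C) \<and> \<bar>cexp f x\<bar> \<le> C"
proof -
  have fi: "integrable M f" using f by (intro integrable_const_bound[where B = C] AE_I2) auto
  have "AE x in M. \<forall>n. psum (\<lambda>x. \<bar>f x\<bar>) n x \<le> psum (\<lambda>_. C) n x"
    using fi f by (intro psum_mono) auto
  moreover note psum_abs_le[OF fi] psum_const[of C]
  moreover have "AE x in M. cexp (\<lambda>x. \<bar>f x\<bar>) x \<le> cexp (\<lambda>_. C) x"
    using fi f by (intro inv.real_cond_exp_mono) auto
  moreover have "AE x in M. cexp (\<lambda>_. C) x = C" by (rule inv.real_cond_exp_F_meas) auto
  moreover note inv.abs_real_cond_exp_le[OF fi]
  ultimately show ?thesis
  proof eventually_elim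
    case (elim x)
    have "\<bar>psum f (Suc n) x\<bar> \<le> real (Suc n) * C" for n
      using elim(1,2,3) by (metis order_trans)
    then have "\<bar>avg f n x\<bar> \<le> C" for n
      by (simp add: avg_def abs_divide divide_le_eq mult.commute del: of_nat_Suc)
    then show ?case using elim by simp
  qed
qed

text \<open>The truncated function has averages bounded by the truncation level, so dominated convergence
applies to it; the remainder is small in the mean of order \<open>p\<close> for all \<open>n\<close> at once, because averaging
and conditional expectation are contractions.\<close>

theorem avg_tendsto_Lp:
  assumes p: "1 \<le> p" and f: "in_Lp M p f"
  shows "(\<lambda>n. \<integral>x. \<bar>avg f n x - cexp f x\<bar> powr p \<partial>M) \<longlonglongrightarrow> 0"
proof (rule LIMSEQ_I)
  fix e :: real assume e: "0 < e"
  have [measurable]: "f \<in> borel_measurable M" using f by (simp add: in_Lp_def)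
  have fi: "integrable M f" using in_Lp_integrable[OF p f] .
  have fp: "integrable M (\<lambda>x. \<bar>f x\<bar> powr p)" using f by (simp add: in_Lp_def)
  let ?c = "\<lambda>k x. clamp k (f x)" and ?r = "\<lambda>k x. f x - clamp k (f x)"
  define R where "R k = (\<integral>x. \<bar>?r k x\<bar> powr p \<partial>M)" for k
  have rle: "\<bar>?r k x\<bar> powr p \<le> \<bar>f x\<bar> powr p" for k x
    using p abs_diff_clamp_le by (intro powr_mono2) auto
  have rLp: "in_Lp M p (?r k)" for k
    unfolding in_Lp_def
  proof
    show "integrable M (\<lambda>x. \<bar>?r k x\<bar> powr p)"
      by (rule Bochner_Integration.integrable_bound[OF fp]) (use rle in auto)
  qed measurable
  have pz: "(\<lambda>k. \<bar>s k\<bar> powr p) \<longlonglongrightarrow> 0" if "s \<longlonglongrightarrow> 0" for s :: "nat \<Rightarrow> real"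
    using tendsto_powr'[OF tendsto_rabs_zero[OF that] tendsto_const, of p] p by simp
  have "R \<longlonglongrightarrow> (\<integral>x. 0 \<partial>M)"
    unfolding R_def using fp rle
    by (intro integral_dominated_convergence[where w = "\<lambda>x. \<bar>f x\<bar> powr p"] AE_I2 pz diff_clamp_tendsto) auto
  then have "(\<lambda>k. 3 powr p * (2 * R k)) \<longlonglongrightarrow> 3 powr p * (2 * 0)" by (intro tendsto_intros) simp
  then have "(\<lambda>k. 3 powr p * (2 * R k)) \<longlonglongrightarrow> 0" by simp
  then have "\<forall>\<^sub>F k in sequentially. 3 powr p * (2 * R k) < e / 2"
    using e by (rule order_tendstoD(2)[OF _ half_gt_zero])
  then obtain k where k: "3 powr p * (2 * R k) < e / 2"
    using eventually_happens'[OF sequentially_bot] by blast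
  define B where "B n = (\<integral>x. \<bar>avg (?c k) n x - cexp (?c k) x\<bar> powr p \<partial>M)" for n
  have bd: "AE x in M. (\<forall>n. \<bar>avg (?c k) n x\<bar> \<le> real k) \<and> \<bar>cexp (?c k) x\<bar> \<le> real k"
    by (rule avg_bounded) (auto simp: abs_clamp_le)
  have bd2: "AE x in M. \<forall>n. \<bar>avg (?c k) n x - cexp (?c k) x\<bar> powr p \<le> (2 * real k) powr p"
    using bd
  proof eventually_elim
    case (elim x)
    have "\<bar>avg (?c k) n x - cexp (?c k) x\<bar> \<le> 2 * real k" for n
    proof -
      have "\<bar>avg (?c k) n x\<bar> \<le> real k" "\<bar>cexp (?c k) x\<bar> \<le> real k" using elim by blast+
      then show ?thesis by linarith
    qed
    then show ?case using p by (intro allI powr_mono2) auto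
  qed
  have "AE x in M. (\<lambda>n. avg (?c k) n x) \<longlonglongrightarrow> cexp (?c k) x"
    by (rule avg_tendsto_bounded[where C = "real k"]) (auto simp: abs_clamp_le)
  then have "AE x in M. (\<lambda>n. \<bar>avg (?c k) n x - cexp (?c k) x\<bar> powr p) \<longlonglongrightarrow> 0"
    by eventually_elim (intro pz LIM_zero)
  then have "B \<longlonglongrightarrow> (\<integral>x. 0 \<partial>M)"
    unfolding B_def using bd2
    by (intro integral_dominated_convergence[where w = "\<lambda>_. (2 * real k) powr p"]) auto
  then have "(\<lambda>n. 3 powr p * B n) \<longlonglongrightarrow> 3 powr p * 0" by (intro tendsto_intros) simp
  then have "(\<lambda>n. 3 powr p * B n) \<longlonglongrightarrow> 0" by simp
  then have "\<forall>\<^sub>F n in sequentially. 3 powr p * B n < e / 2"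
    using e by (rule order_tendstoD(2)[OF _ half_gt_zero])
  then obtain N where N: "\<And>n. n \<ge> N \<Longrightarrow> 3 powr p * B n < e / 2" unfolding eventually_sequentially by blast
  have "norm ((\<integral>x. \<bar>avg f n x - cexp f x\<bar> powr p \<partial>M) - 0) < e" if n: "n \<ge> N" for n
  proof -
    let ?X = "\<lambda>x. avg (?c k) n x - cexp (?c k) x"
    have Xi: "integrable M (\<lambda>x. \<bar>?X x\<bar> powr p)"
      using bd2 by (intro integrable_const_bound[where B = "(2 * real k) powr p"]) auto
    have Yi: "integrable M (\<lambda>x. \<bar>avg (?r k) n x\<bar> powr p)" and Zi: "integrable M (\<lambda>x. \<bar>cexp (?r k) x\<bar> powr p)"
      using avg_Lp(1)[OF p rLp] cexp_Lp(1)[OF p rLp] by (simp_all add: in_Lp_def)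
    have Wi: "integrable M (\<lambda>x. 3 powr p * (\<bar>?X x\<bar> powr p + \<bar>avg (?r k) n x\<bar> powr p + \<bar>cexp (?r k) x\<bar> powr p))"
      using Xi Yi Zi by simp
    have le: "AE x in M. \<bar>avg f n x - cexp f x\<bar> powr p \<le>
        3 powr p * (\<bar>?X x\<bar> powr p + \<bar>avg (?r k) n x\<bar> powr p + \<bar>cexp (?r k) x\<bar> powr p)"
      using split_clamp[OF fi, of k]
    proof eventually_elim
      case (elim x)
      then have "avg f n x - cexp f x = ?X x + avg (?r k) n x + - cexp (?r k) x" by simp
      then show ?case using abs_add3_powr_le[OF p, of "?X x" "avg (?r k) n x" "- cexp (?r k) x"] by simp
    qed
    have "(\<integral>x. \<bar>avg f n x - cexp f x\<bar> powr p \<partial>M) \<le>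
        (\<integral>x. 3 powr p * (\<bar>?X x\<bar> powr p + \<bar>avg (?r k) n x\<bar> powr p + \<bar>cexp (?r k) x\<bar> powr p) \<partial>M)"
      using le by (intro integral_mono_AE' Wi) auto
    also have "\<dots> = 3 powr p * (B n + (\<integral>x. \<bar>avg (?r k) n x\<bar> powr p \<partial>M) + (\<integral>x. \<bar>cexp (?r k) x\<bar> powr p \<partial>M))"
      using Xi Yi Zi by (simp add: B_def)
    also have "\<dots> \<le> 3 powr p * (B n + R k + R k)"
      unfolding R_def using avg_Lp(2)[OF p rLp] cexp_Lp(2)[OF p rLp] by (intro mult_left_mono add_mono) auto
    also have "\<dots> = 3 powr p * B n + 3 powr p * (2 * R k)" by (simp add: algebra_simps)
    also have "\<dots> < e" using N[OF n] k by simp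
    finally show ?thesis by simp
  qed
  then show "\<exists>N. \<forall>n\<ge>N. norm ((\<integral>x. \<bar>avg f n x - cexp f x\<bar> powr p \<partial>M) - 0) < e" by blast
qed

end

section \<open>Fibre sums weighted by a Radon--Nikodym cocycle\<close>

locale null_preserving_cocycle = prob_space M for M :: "'a measure" +
  fixes E :: "('a \<times> 'a) set" and \<rho> :: "'a \<Rightarrow> 'a \<Rightarrow> real"
  assumes standard: "standard_borel M"
    and null_pres: "null_preserving M E"
    and cocycle: "radon_nikodym_cocycle M E \<rho>"
begin

lemma cocycle_integral:
  assumes "integrable M h" "partial_borel_injection M E A \<gamma>"
  shows "integrable M (\<lambda>x. indicator A x * (h (\<gamma> x) * \<rho> x (\<gamma> x)))"
    "(\<integral>y. indicator (\<gamma> ` A) y * h y \<partial>M) = (\<integral>x. indicator A x * (h (\<gamma> x) * \<rho> x (\<gamma> x)) \<partial>M)"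
  using cocycle assms unfolding radon_nikodym_cocycle_def
  by (auto simp: set_integrable_def set_lebesgue_integral_def)

lemma cocycle_pos: "(x, y) \<in> E \<Longrightarrow> 0 < \<rho> x y"
  using cocycle by (auto simp: radon_nikodym_cocycle_def)

text \<open>The cocycle identity for the constant function \<open>1\<close> takes the place of the Lusin--Souslin theorem. If
the image were not measurable, its indicator would have Bochner integral \<open>0\<close>, so \<open>\<rho> x (\<gamma> x)\<close>, which is
positive, would have integral \<open>0\<close> over \<open>A\<close>. Then \<open>A\<close> is null, and so is its image, which is therefore
measurable after all.\<close>

lemma image_in_sets:
  assumes g: "partial_borel_injection M E A \<gamma>"
  shows "\<gamma> ` A \<in> sets M"
proof (rule ccontr)
  assume no: "\<gamma> ` A \<notin> sets M"
  have A: "A \<in> sets M" and gE: "\<And>x. x \<in> A \<Longrightarrow> (x, \<gamma> x) \<in> E" and gm: "\<gamma> \<in> measurable (restrict_space M A) M"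
    using g by (auto simp: partial_borel_injection_def)
  have AM: "A \<subseteq> space M" using sets.sets_into_space[OF A] .
  have sub: "\<gamma> ` A \<subseteq> space M"
    using measurable_space[OF gm] AM by (auto simp: space_restrict_space)
  have ni: "\<not> integrable M (indicator (\<gamma> ` A) :: 'a \<Rightarrow> real)"
  proof
    assume "integrable M (indicator (\<gamma> ` A) :: 'a \<Rightarrow> real)"
    then have "(indicator (\<gamma> ` A) :: 'a \<Rightarrow> real) \<in> borel_measurable M" by simp
    then have "\<gamma> ` A \<inter> space M \<in> sets M" by (simp add: borel_measurable_indicator_iff)
    then show False using no sub by (simp add: Int_absorb2)
  qed
  have "(\<integral>x. indicator A x * \<rho> x (\<gamma> x) \<partial>M) = (\<integral>y. indicator (\<gamma> ` A) y \<partial>M)"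
    by (rule cocycle_integral(2)[OF integrable_const g, of 1, unfolded mult_1_right mult_1_left, symmetric])
  also have "\<dots> = 0" by (rule not_integrable_integral_eq[OF ni])
  finally have "(\<integral>x. indicator A x * \<rho> x (\<gamma> x) \<partial>M) = 0" .
  moreover have "integrable M (\<lambda>x. indicator A x * \<rho> x (\<gamma> x))"
    using cocycle_integral(1)[OF _ g, of "\<lambda>_. 1"] by simp
  moreover have "AE x in M. 0 \<le> indicator A x * \<rho> x (\<gamma> x)"
    using cocycle_pos[OF gE] by (intro AE_I2) (auto simp: indicator_def intro: less_imp_le)
  ultimately have "AE x in M. indicator A x * \<rho> x (\<gamma> x) = 0"
    by (simp add: integral_nonneg_eq_0_iff_AE)
  then have "AE x in M. x \<notin> A"
  proof eventually_elim
    case (elim x)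
    then show ?case using cocycle_pos[OF gE, of x] by (auto simp: indicator_def)
  qed
  then have "A \<in> null_sets M" using A AM by (simp add: AE_iff_null_sets Int_absorb2)
  then have "\<gamma> ` A \<in> null_sets M" using null_pres g by (simp add: null_preserving_def)
  then show False using no by auto
qed

end

text \<open>A nonsingular map \<open>S\<close> that moves points within their \<open>E\<close>-classes; the iterates of \<open>T\<close> are instances.\<close>

locale map_in_relation = null_preserving_cocycle M E \<rho> for M :: "'a measure" and E \<rho> +
  fixes S :: "'a \<Rightarrow> 'a"
  assumes S_meas [measurable]: "S \<in> measurable M M"
    and S_E: "\<And>y. y \<in> space M \<Longrightarrow> (y, S y) \<in> E" "\<And>y. y \<in> space M \<Longrightarrow> (S y, y) \<in> E"
    and S_AE: "\<And>Q. (AE x in M. Q x) \<Longrightarrow> (AE x in M. Q (S x))"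
begin

lemma partial_inj:
  assumes A: "A \<in> sets M" and "inj_on S A"
  shows "partial_borel_injection M E A S"
  using assms S_E(1) sets.sets_into_space[OF A]
  by (auto simp: partial_borel_injection_def intro: measurable_restrict_space1)

lemma partial_inverse:
  assumes A: "A \<in> sets M" and inj: "inj_on S A"
  shows "S ` A \<in> sets M" "partial_borel_injection M E (S ` A) (inv_into A S)"
proof -
  show SA: "S ` A \<in> sets M" by (rule image_in_sets[OF partial_inj[OF assms]])
  have AM: "A \<subseteq> space M" using sets.sets_into_space[OF A] .
  have "inv_into A S \<in> measurable (restrict_space M (S ` A)) M"
  proof (rule measurableI)
    fix x assume "x \<in> space (restrict_space M (S ` A))"
    then have "inv_into A S x \<in> A" by (auto simp: space_restrict_space inv_into_into)
    then show "inv_into A S x \<in> space M" using AM by auto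
  next
    fix C assume C: "C \<in> sets M"
    have "inv_into A S -` C \<inter> space (restrict_space M (S ` A)) = S ` (A \<inter> C)"
      using AM measurable_space[OF S_meas] inj by (auto simp: space_restrict_space)
    moreover have "S ` (A \<inter> C) \<in> sets M"
      using A C inj by (intro image_in_sets partial_inj) (auto intro: inj_on_subset)
    ultimately show "inv_into A S -` C \<inter> space (restrict_space M (S ` A)) \<in> sets (restrict_space M (S ` A))"
      using SA by (auto simp: sets_restrict_space_iff)
  qed
  moreover have "(S y, inv_into A S (S y)) \<in> E" if "y \<in> A" for y
    using that inj AM S_E(2)[of y] by auto
  ultimately show "partial_borel_injection M E (S ` A) (inv_into A S)"
    using SA by (auto simp: partial_borel_injection_def inj_on_inv_into)
qed

text \<open>The family \<open>\<U>\<close> of countable unions of pieces is closed under countable unions, so some \<open>U\<close> in it has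
the largest measure. A section of \<open>S\<close> over a nonnull set with values outside \<open>U\<close> would have a nonnull
image on which \<open>S\<close> is injective, and adding it to \<open>U\<close> would increase the measure.\<close>

lemma ex_injective_pieces:
  "\<exists>A :: nat \<Rightarrow> 'a set. disjoint_family A \<and> (\<forall>n. A n \<in> sets M \<and> inj_on S (A n)) \<and>
    (\<exists>Z\<in>null_sets M. S ` (space M - (\<Union>n. A n)) \<subseteq> Z)"
proof -
  define \<U> where "\<U> = {U. \<exists>A :: nat \<Rightarrow> 'a set. (\<forall>n. A n \<in> sets M \<and> inj_on S (A n)) \<and> U = (\<Union>n. A n)}"
  have U1: "A \<in> \<U>" if "A \<in> sets M" "inj_on S A" for A
    unfolding \<U>_def using that by (intro CollectI exI[of _ "\<lambda>_. A"]) auto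
  have UM: "U \<in> sets M" if "U \<in> \<U>" for U using that by (auto simp: \<U>_def)
  have Un: "(\<Union>k. U k) \<in> \<U>" if "\<And>k :: nat. U k \<in> \<U>" for U
  proof -
    have "\<forall>k. \<exists>A :: nat \<Rightarrow> 'a set. (\<forall>n. A n \<in> sets M \<and> inj_on S (A n)) \<and> U k = (\<Union>n. A n)"
      using that by (auto simp: \<U>_def)
    then obtain A :: "nat \<Rightarrow> nat \<Rightarrow> 'a set" where
      A: "\<And>k n. A k n \<in> sets M" "\<And>k n. inj_on S (A k n)" "\<And>k. U k = (\<Union>n. A k n)" by metis
    define B where "B j = (case prod_decode j of (k, n) \<Rightarrow> A k n)" for j
    have "(\<Union>k. U k) = (\<Union>j. B j)"
    proof (intro equalityI subsetI)
      fix x assume "x \<in> (\<Union>k. U k)"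
      then obtain k n where "x \<in> A k n" using A(3) by auto
      then have "x \<in> B (prod_encode (k, n))" by (simp add: B_def)
      then show "x \<in> (\<Union>j. B j)" by blast
    next
      fix x assume "x \<in> (\<Union>j. B j)"
      then show "x \<in> (\<Union>k. U k)" using A(3) by (fastforce simp: B_def split: prod.splits)
    qed
    moreover have "B j \<in> sets M \<and> inj_on S (B j)" for j using A by (auto simp: B_def split: prod.split)
    ultimately show ?thesis unfolding \<U>_def by blast
  qed
  have Un2: "U \<union> V \<in> \<U>" if "U \<in> \<U>" "V \<in> \<U>" for U V
  proof -
    have "(\<Union>k :: nat. if k = 0 then U else V) \<in> \<U>" by (rule Un) (use that in auto)
    moreover have "(\<Union>k :: nat. if k = 0 then U else V) = U \<union> V" by (auto split: if_splits)
    ultimately show ?thesis by simp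
  qed
  have ne: "\<U> \<noteq> {}" using U1[of "{}"] by auto
  have bdd: "bdd_above (measure M ` \<U>)" by (intro bdd_aboveI[of _ 1]) auto
  define c where "c = (SUP U\<in>\<U>. measure M U)"
  have "\<exists>U\<in>\<U>. c - inverse (real (Suc k)) < measure M U" for k
    using less_cSUP_iff[OF ne bdd, of "c - inverse (real (Suc k))"] by (simp add: c_def)
  then obtain V where V: "\<And>k. V k \<in> \<U>" "\<And>k. c - inverse (real (Suc k)) < measure M (V k)" by metis
  define U where "U = (\<Union>k. V k)"
  have U: "U \<in> \<U>" unfolding U_def using V(1) by (rule Un)
  have "c \<le> measure M U"
  proof (rule LIMSEQ_le_const2)
    have "(\<lambda>k. c - inverse (real (Suc k))) \<longlonglongrightarrow> c - 0" by (intro tendsto_intros LIMSEQ_inverse_real_of_nat)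
    then show "(\<lambda>k. c - inverse (real (Suc k))) \<longlonglongrightarrow> c" by simp
    have "measure M (V k) \<le> measure M U" for k
      using UM[OF U] by (intro finite_measure_mono) (auto simp: U_def)
    then show "\<exists>N. \<forall>k\<ge>N. c - inverse (real (Suc k)) \<le> measure M U" using V(2) by (meson less_imp_le order_trans)
  qed
  have "\<exists>Z\<in>null_sets M. S ` (space M - U) \<subseteq> Z"
  proof (rule ccontr)
    assume "\<not> ?thesis"
    then have no: "\<And>Z. Z \<in> null_sets M \<Longrightarrow> \<not> S ` (space M - U) \<subseteq> Z" by blast
    have R: "space M - U \<in> sets M" using UM[OF U] by auto
    obtain B s where B: "B \<in> sets M" "B \<notin> null_sets M" "s \<in> measurable (restrict_space M B) M"
      "\<And>x. x \<in> B \<Longrightarrow> s x \<in> space M - U" "\<And>x. x \<in> B \<Longrightarrow> S (s x) = x"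
      using ex_measurable_section[OF standard finite_measure_axioms S_meas R no] by blast
    have "(x, s x) \<in> E" if "x \<in> B" for x using S_E(2)[of "s x"] B(4,5)[OF that] by auto
    moreover have "inj_on s B" using B(5) by (metis inj_onI)
    ultimately have ps: "partial_borel_injection M E B s" using B by (simp add: partial_borel_injection_def)
    have sB: "s ` B \<in> sets M" by (rule image_in_sets[OF ps])
    have "s ` B \<notin> null_sets M" using null_pres ps B(2) by (simp add: null_preserving_def)
    then have pos: "0 < measure M (s ` B)"
      using sB by (simp add: null_sets_def emeasure_eq_measure zero_less_measure_iff)
    have "inj_on S (s ` B)" using B(5) by (intro inj_onI) auto
    then have "U \<union> s ` B \<in> \<U>" using U U1 sB by (intro Un2)
    then have "measure M (U \<union> s ` B) \<le> c" unfolding c_def by (rule cSUP_upper[OF _ bdd])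
    moreover have "measure M (U \<union> s ` B) = measure M U + measure M (s ` B)"
      using UM[OF U] sB B(4) by (intro finite_measure_Union) auto
    ultimately show False using pos \<open>c \<le> measure M U\<close> by simp
  qed
  moreover obtain A :: "nat \<Rightarrow> 'a set" where A: "\<And>n. A n \<in> sets M" "\<And>n. inj_on S (A n)" "U = (\<Union>n. A n)"
    using U unfolding \<U>_def mem_Collect_eq by metis
  moreover have "disjointed A n \<in> sets M \<and> inj_on S (disjointed A n)" for n
    using A disjointed_subset[of A n] by (auto intro: inj_on_subset sets.range_disjointed_sets[THEN subsetD])
  ultimately show ?thesis
    using disjoint_family_disjointed[of A] UN_disjointed_eq[of A] by (intro exI[of _ "disjointed A"]) simp
qed

text \<open>With \<open>s n\<close> the inverse of \<open>S\<close> on the piece \<open>A n\<close>, the sum over a fibre is the sum of the functions \<open>w n\<close>,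
where \<open>w n\<close> is the term \<open>f y * \<rho> x y\<close> at \<open>y = s n x\<close> if \<open>x\<close> has a preimage in \<open>A n\<close>, and \<open>0\<close> otherwise. The
change of variables \<open>push\<close> shows that \<open>w n\<close> is integrable and that its integral over \<open>C\<close> is the integral of
\<open>f\<close> over the part of \<open>A n\<close> that \<open>S\<close> maps into \<open>C\<close>; the norms of the \<open>w n\<close> add up to at most that of \<open>f\<close>.\<close>

theorem fibre_sum:
  assumes f: "integrable M f"
  shows "\<exists>u. integrable M u \<and>
    (\<forall>C\<in>sets M. (\<integral>x. u x * indicator C x \<partial>M) = (\<integral>x. f x * indicator C (S x) \<partial>M)) \<and>
    (AE x in M. ((\<lambda>y. f y * \<rho> x y) has_sum u x) {y\<in>space M. S y = x})"
proof -
  have [measurable]: "f \<in> borel_measurable M" using f by simp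
  obtain A :: "nat \<Rightarrow> 'a set" and Z where disj: "disjoint_family A"
    and A [measurable]: "\<And>n. A n \<in> sets M" and inj: "\<And>n. inj_on S (A n)"
    and Z: "Z \<in> null_sets M" "S ` (space M - (\<Union>n. A n)) \<subseteq> Z"
    using ex_injective_pieces by blast
  have AEZ: "AE x in M. x \<notin> Z" using Z(1) by (rule AE_not_in)
  have AEA: "AE x in M. x \<in> (\<Union>n. A n)"
    using S_AE[OF AEZ] AE_space by eventually_elim (use Z(2) in auto)
  define B where "B n = S ` A n" for n
  define s where "s n = inv_into (A n) S" for n
  have B [measurable]: "B n \<in> sets M" and ps: "partial_borel_injection M E (B n) (s n)" for n
    using partial_inverse[OF A inj] by (auto simp: B_def s_def)
  have sA: "s n x \<in> A n" and Ss: "S (s n x) = x" if "x \<in> B n" for n x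
    using that by (auto simp: B_def s_def inv_into_into f_inv_into_f)
  have sS: "s n (S y) = y" if "y \<in> A n" for n y using inj that by (simp add: s_def)
  have AM: "A n \<subseteq> space M" for n using sets.sets_into_space[OF A] .
  have push: "integrable M (\<lambda>x. indicator (B n) x * (h (s n x) * \<rho> x (s n x)) * indicator C x) \<and>
     (\<integral>x. indicator (B n) x * (h (s n x) * \<rho> x (s n x)) * indicator C x \<partial>M) =
     (\<integral>x. h x * indicator (A n) x * indicator C (S x) \<partial>M)" if h: "integrable M h" and C: "C \<in> sets M" for h C n
  proof -
    have p: "partial_borel_injection M E (B n \<inter> C) (s n)"
      using ps[of n] C unfolding partial_borel_injection_def
      by (auto intro: inj_on_subset measurable_restrict_mono)
    have img: "s n ` (B n \<inter> C) = {y\<in>A n. S y \<in> C}"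
    proof (intro equalityI subsetI)
      fix y assume "y \<in> s n ` (B n \<inter> C)"
      then show "y \<in> {y\<in>A n. S y \<in> C}" using sA Ss by auto
    next
      fix y assume y: "y \<in> {y\<in>A n. S y \<in> C}"
      then have "S y \<in> B n \<inter> C" "s n (S y) = y" using sS by (auto simp: B_def)
      then show "y \<in> s n ` (B n \<inter> C)" by force
    qed
    have eq: "indicator (B n \<inter> C) x * (h (s n x) * \<rho> x (s n x)) =
        indicator (B n) x * (h (s n x) * \<rho> x (s n x)) * indicator C x" for x
      by (auto simp: indicator_def)
    have eq2: "indicator {y\<in>A n. S y \<in> C} x * h x = h x * indicator (A n) x * indicator C (S x)" for x
      by (auto simp: indicator_def)
    then show ?thesis using cocycle_integral[OF h p] unfolding eq img eq2 by simp
  qed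
  define w where "w n x = indicator (B n) x * (f (s n x) * \<rho> x (s n x))" for n x
  have w: "integrable M (w n)" for n
  proof -
    have "integrable M (\<lambda>x. w n x * indicator (space M) x)"
      using push[OF f sets.top, of n] by (simp add: w_def)
    moreover have "integrable M (\<lambda>x. w n x * indicator (space M) x) \<longleftrightarrow> integrable M (w n)"
      by (intro Bochner_Integration.integrable_cong) auto
    ultimately show ?thesis by simp
  qed
  then have [measurable]: "w n \<in> borel_measurable M" for n by simp
  have normw: "norm (w n x) = indicator (B n) x * (\<bar>f (s n x)\<bar> * \<rho> x (s n x))" for n x
  proof (cases "x \<in> B n")
    case True
    then have "0 < \<rho> x (s n x)" using ps[of n] by (intro cocycle_pos) (auto simp: partial_borel_injection_def)
    then show ?thesis by (simp add: w_def abs_mult)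
  qed (simp add: w_def)
  have intw: "(\<integral>x. norm (w n x) \<partial>M) = (\<integral>x. \<bar>f x\<bar> * indicator (A n) x \<partial>M)" for n
  proof -
    have "(\<integral>x. norm (w n x) \<partial>M) = (\<integral>x. indicator (B n) x * (\<bar>f (s n x)\<bar> * \<rho> x (s n x)) * indicator (space M) x \<partial>M)"
      unfolding normw by (intro Bochner_Integration.integral_cong) auto
    also have "\<dots> = (\<integral>x. \<bar>f x\<bar> * indicator (A n) x * indicator (space M) (S x) \<partial>M)"
      using push[OF integrable_abs[OF f] sets.top] by simp
    also have "\<dots> = (\<integral>x. \<bar>f x\<bar> * indicator (A n) x \<partial>M)"
      using measurable_space[OF S_meas] by (intro Bochner_Integration.integral_cong) (auto simp: indicator_def)
    finally show ?thesis .
  qed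
  have fA: "integrable M (\<lambda>x. h x * indicator (A n) x)" if "integrable M h" for h :: "'a \<Rightarrow> real" and n
    using integrable_mult_indicator[OF A that, of n] by (simp add: mult.commute)
  have partial: "(\<Sum>n<N. indicator (A n) x :: real) = indicator (\<Union>n<N. A n) x" for N x
    using disj by (intro indicator_UN_disjoint[symmetric]) (auto simp: disjoint_family_on_def)
  have sumw: "summable (\<lambda>n. \<integral>x. norm (w n x) \<partial>M)"
  proof (rule summableI_nonneg_bounded)
    fix N
    have "(\<Sum>n<N. \<integral>x. norm (w n x) \<partial>M) = (\<integral>x. (\<Sum>n<N. \<bar>f x\<bar> * indicator (A n) x) \<partial>M)"
      unfolding intw using f by (intro Bochner_Integration.integral_sum[symmetric] fA) auto
    also have "\<dots> \<le> (\<integral>x. \<bar>f x\<bar> \<partial>M)"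
    proof (intro integral_mono Bochner_Integration.integrable_sum fA)
      show "(\<Sum>n<N. \<bar>f x\<bar> * indicator (A n) x) \<le> \<bar>f x\<bar>" for x
        unfolding sum_distrib_left[symmetric] partial by (cases "x \<in> (\<Union>n<N. A n)") simp_all
    qed (use f in auto)
    finally show "(\<Sum>n<N. \<integral>x. norm (w n x) \<partial>M) \<le> (\<integral>x. \<bar>f x\<bar> \<partial>M)" .
  qed simp
  have AEw: "AE x in M. summable (\<lambda>n. norm (w n x))"
  proof -
    have "(\<integral>\<^sup>+x. (\<Sum>n. ennreal (norm (w n x))) \<partial>M) = (\<Sum>n. \<integral>\<^sup>+x. ennreal (norm (w n x)) \<partial>M)"
      by (rule nn_integral_suminf) measurable
    also have "\<dots> = (\<Sum>n. ennreal (\<integral>x. norm (w n x) \<partial>M))"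
      using w by (intro suminf_cong nn_integral_eq_integral) auto
    also have "\<dots> = ennreal (\<Sum>n. \<integral>x. norm (w n x) \<partial>M)"
      by (rule suminf_ennreal2[OF _ sumw]) simp
    finally have "(\<integral>\<^sup>+x. (\<Sum>n. ennreal (norm (w n x))) \<partial>M) \<noteq> \<infinity>" by simp
    then have "AE x in M. (\<Sum>n. ennreal (norm (w n x))) \<noteq> \<infinity>"
      by (intro nn_integral_PInf_AE) measurable
    then show ?thesis by eventually_elim (auto intro!: summable_suminf_not_top)
  qed
  define u where "u x = (\<Sum>n. w n x)" for x
  have ui: "integrable M u" unfolding u_def by (rule integrable_suminf[OF w AEw sumw])
  have uC: "(\<integral>x. u x * indicator C x \<partial>M) = (\<integral>x. f x * indicator C (S x) \<partial>M)" if C [measurable]: "C \<in> sets M" for C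
  proof -
    have "(\<lambda>n. \<integral>x. w n x * indicator C x \<partial>M) sums (\<integral>x. (\<Sum>n. w n x * indicator C x) \<partial>M)"
    proof (rule sums_integral)
      show "integrable M (\<lambda>x. w n x * indicator C x)" for n
        using push[OF f C, of n] by (simp add: w_def)
      show "AE x in M. summable (\<lambda>n. norm (w n x * indicator C x))"
        using AEw by eventually_elim (auto simp: indicator_def)
      show "summable (\<lambda>n. \<integral>x. norm (w n x * indicator C x) \<partial>M)"
      proof (rule summable_comparison_test'[OF sumw])
        fix n
        have "(\<integral>x. norm (w n x * indicator C x) \<partial>M) \<le> (\<integral>x. norm (w n x) \<partial>M)"
        proof (intro integral_mono integrable_norm w)
          show "integrable M (\<lambda>x. w n x * indicator C x)" using push[OF f C, of n] by (simp add: w_def)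
          show "norm (w n x * indicator C x) \<le> norm (w n x)" for x by (cases "x \<in> C") simp_all
        qed
        then show "norm (\<integral>x. norm (w n x * indicator C x) \<partial>M) \<le> (\<integral>x. norm (w n x) \<partial>M)" by simp
      qed
    qed
    moreover have "(\<integral>x. (\<Sum>n. w n x * indicator C x) \<partial>M) = (\<integral>x. u x * indicator C x \<partial>M)"
      by (intro Bochner_Integration.integral_cong) (auto simp: u_def indicator_def)
    moreover have "(\<integral>x. w n x * indicator C x \<partial>M) = (\<integral>x. f x * indicator (A n) x * indicator C (S x) \<partial>M)" for n
      using push[OF f C, of n] by (simp add: w_def)
    ultimately have 1: "(\<lambda>n. \<integral>x. f x * indicator (A n) x * indicator C (S x) \<partial>M) sums (\<integral>x. u x * indicator C x \<partial>M)"
      by simp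
    have fi: "integrable M (\<lambda>x. f x * indicator (A n) x * indicator C (S x))" for n
      by (rule Bochner_Integration.integrable_bound[OF f]) (auto simp: indicator_def)
    have "(\<lambda>N. \<integral>x. (\<Sum>n<N. f x * indicator (A n) x * indicator C (S x)) \<partial>M) \<longlonglongrightarrow> (\<integral>x. f x * indicator C (S x) \<partial>M)"
    proof (rule integral_dominated_convergence[where w = "\<lambda>x. \<bar>f x\<bar>"])
      have eq: "(\<Sum>n<N. f x * indicator (A n) x * indicator C (S x)) = f x * indicator (\<Union>n<N. A n) x * indicator C (S x)" for N x
        by (simp only: partial[symmetric] sum_distrib_left sum_distrib_right)
      show "AE x in M. norm (\<Sum>n<N. f x * indicator (A n) x * indicator C (S x)) \<le> \<bar>f x\<bar>" for N
        unfolding eq by (auto simp: indicator_def)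
      show "AE x in M. (\<lambda>N. \<Sum>n<N. f x * indicator (A n) x * indicator C (S x)) \<longlonglongrightarrow> f x * indicator C (S x)"
        using AEA
      proof eventually_elim
        case (elim x)
        then obtain k where k: "x \<in> A k" by blast
        have "f x * indicator (\<Union>n<N. A n) x * indicator C (S x) = f x * indicator C (S x)" if "N \<ge> Suc k" for N
          using k that by (auto simp: indicator_def)
        then show ?case unfolding eq by (intro tendsto_eventually) (auto simp: eventually_sequentially)
      qed
    qed (use f in auto)
    then have "(\<lambda>n. \<integral>x. f x * indicator (A n) x * indicator C (S x) \<partial>M) sums (\<integral>x. f x * indicator C (S x) \<partial>M)"
      unfolding sums_def by (subst (asm) Bochner_Integration.integral_sum) (rule fi)
    then show ?thesis by (rule sums_unique2[OF 1])
  qed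
  have fib: "((\<lambda>y. f y * \<rho> x y) has_sum u x) {y\<in>space M. S y = x}"
    if sx: "summable (\<lambda>n. norm (w n x))" and xZ: "x \<notin> Z" for x
  proof -
    let ?J = "{n. x \<in> B n}"
    have "((\<lambda>n. w n x) has_sum u x) UNIV"
      unfolding u_def by (rule norm_summable_imp_has_sum[OF sx summable_sums[OF summable_norm_cancel[OF sx]]])
    moreover have "((\<lambda>n. w n x) has_sum u x) UNIV \<longleftrightarrow>
        ((\<lambda>n. f (s n x) * \<rho> x (s n x)) has_sum u x) ?J"
      by (rule has_sum_cong_neutral) (auto simp: w_def)
    ultimately have "((\<lambda>n. f (s n x) * \<rho> x (s n x)) has_sum u x) ?J" by simp
    moreover have "bij_betw (\<lambda>n. s n x) ?J {y\<in>space M. S y = x}"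
    proof (rule bij_betw_imageI)
      show "inj_on (\<lambda>n. s n x) ?J"
      proof (rule inj_onI)
        fix n m assume "n \<in> ?J" "m \<in> ?J" "s n x = s m x"
        then have "s n x \<in> A n \<inter> A m" using sA[of x n] sA[of x m] by simp
        then show "n = m" using disj unfolding disjoint_family_on_def by blast
      qed
      show "(\<lambda>n. s n x) ` ?J = {y\<in>space M. S y = x}"
      proof (intro equalityI subsetI)
        fix y assume "y \<in> (\<lambda>n. s n x) ` ?J"
        then show "y \<in> {y\<in>space M. S y = x}" using Ss subsetD[OF AM sA] by auto
      next
        fix y assume y: "y \<in> {y\<in>space M. S y = x}"
        then have "y \<in> (\<Union>n. A n)" using xZ Z(2) by auto
        then obtain n where n: "y \<in> A n" by blast
        then have "x \<in> B n" "s n x = y" using y sS by (auto simp: B_def)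
        then show "y \<in> (\<lambda>n. s n x) ` ?J" by blast
      qed
    qed
    ultimately show ?thesis
      using has_sum_reindex_bij_betw[of "\<lambda>n. s n x" ?J "{y\<in>space M. S y = x}" "\<lambda>y. f y * \<rho> x y" "u x"] by simp
  qed
  have "AE x in M. summable (\<lambda>n. norm (w n x)) \<and> x \<notin> Z" using AEw AEZ by eventually_elim simp
  then have "AE x in M. ((\<lambda>y. f y * \<rho> x y) has_sum u x) {y\<in>space M. S y = x}"
    by (rule eventually_mono) (use fib in simp)
  then show ?thesis using ui uC by (intro exI[of _ u]) simp
qed

end

section \<open>Backward averages\<close>

lemma (in measure_preserving) iterate_set:
  assumes f: "integrable M f" and "C \<in> sets M"
  shows "(\<integral>x. (P ^^ i) f x * indicator C x \<partial>M) = (\<integral>x. f x * indicator C ((T ^^ i) x) \<partial>M)"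
  using assms(2)
proof (induction i arbitrary: C)
  case (Suc i)
  let ?D = "T -` C \<inter> space M"
  have D: "?D \<in> sets M" using Suc.prems by measurable
  have Ti: "(T ^^ i) x \<in> space M" if "x \<in> space M" for x
    using that measurable_space[OF T_measurable] by (induction i) auto
  have "(\<integral>x. (P ^^ Suc i) f x * indicator C x \<partial>M) = (\<integral>x. (P ^^ i) f x * indicator C (T x) \<partial>M)"
    using transfer_set[OF integrable_iterate[OF f] Suc.prems] by simp
  also have "\<dots> = (\<integral>x. (P ^^ i) f x * indicator ?D x \<partial>M)"
    by (intro Bochner_Integration.integral_cong) (auto simp: indicator_def)
  also have "\<dots> = (\<integral>x. f x * indicator ?D ((T ^^ i) x) \<partial>M)" by (rule Suc.IH[OF D])
  also have "\<dots> = (\<integral>x. f x * indicator C ((T ^^ Suc i) x) \<partial>M)"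
    using Ti by (intro Bochner_Integration.integral_cong) (auto simp: indicator_def)
  finally show ?case .
qed simp

theorem corollary1p4:
  fixes M :: "'a measure" and T :: "'a \<Rightarrow> 'a" and \<rho> :: "'a \<Rightarrow> 'a \<Rightarrow> real"
    and p :: real and f :: "'a \<Rightarrow> real"
  assumes "standard_prob_space M"
    and "measure_preserving_map M T"
    and "aperiodic M T"
    and "countable_to_one M T"
    and "T ` space M = space M"
    and "null_preserving M (orbit_rel M T)"
    and "radon_nikodym_cocycle M (orbit_rel M T) \<rho>"
    and "1 \<le> p"
    and "in_Lp M p f"
  shows "(AE x in M. \<forall>i. (\<lambda>y. f y * \<rho> x y) summable_on fibre M T i x) \<and>
         (AE x in M. (\<lambda>n. backward_average M T \<rho> f n x)
            \<longlonglongrightarrow> real_cond_exp M (invariant_algebra M T) f x) \<and>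
         tendsto_Lp M p (backward_average M T \<rho> f) (real_cond_exp M (invariant_algebra M T) f)"
proof -
  interpret prob_space M using assms(1) by (simp add: standard_prob_space_def)
  interpret measure_preserving M T
    using assms(2) by unfold_locales (auto simp: measure_preserving_map_def)
  have f: "integrable M f" using in_Lp_integrable[OF assms(8,9)] .
  have "AE x in M. ((\<lambda>y. f y * \<rho> x y) has_sum (P ^^ i) f x) (fibre M T i x)" for i
  proof -
    have Ti [measurable]: "(T ^^ i) \<in> measurable M M" by (induction i) (auto simp: id_def)
    interpret map_in_relation M "orbit_rel M T" \<rho> "T ^^ i"
    proof unfold_locales
      show "standard_borel M" using assms(1) by (simp add: standard_prob_space_def)
      fix y assume y: "y \<in> space M"
      then have "(T ^^ i) y \<in> space M" by (rule measurable_space[OF Ti])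
      moreover have "(T ^^ i) y = (T ^^ 0) ((T ^^ i) y)" by simp
      ultimately show "(y, (T ^^ i) y) \<in> orbit_rel M T" "((T ^^ i) y, y) \<in> orbit_rel M T"
        using y unfolding orbit_rel_def by (simp, metis)+
    qed (use assms(6,7) AE_T_funpow in auto)
    obtain u where u: "integrable M u"
      "\<And>C. C \<in> sets M \<Longrightarrow> (\<integral>x. u x * indicator C x \<partial>M) = (\<integral>x. f x * indicator C ((T ^^ i) x) \<partial>M)"
      "AE x in M. ((\<lambda>y. f y * \<rho> x y) has_sum u x) {y\<in>space M. (T ^^ i) y = x}"
      using fibre_sum[OF f] by blast
    have "AE x in M. u x = (P ^^ i) f x"
      using u(2) iterate_set[OF f] by (intro AE_eqI_integral u(1) integrable_iterate f) simp
    with u(3) show ?thesis by eventually_elim (simp add: fibre_def)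
  qed
  then have sums: "AE x in M. \<forall>i. ((\<lambda>y. f y * \<rho> x y) has_sum (P ^^ i) f x) (fibre M T i x)"
    by (simp add: AE_all_countable)
  have avg: "AE x in M. \<forall>n. backward_average M T \<rho> f n x = avg f n x"
    using sums
  proof eventually_elim
    case (elim x)
    have "{0..n} = {..<Suc n}" for n :: nat by auto
    then show ?case
      using infsumI[OF elim[rule_format]]
      by (simp add: backward_average_def avg_def psum_def del: sum.lessThan_Suc)
  qed
  have "AE x in M. \<forall>i. (\<lambda>y. f y * \<rho> x y) summable_on fibre M T i x"
    using sums by eventually_elim (auto simp: summable_on_def)
  moreover have "AE x in M. (\<lambda>n. backward_average M T \<rho> f n x) \<longlonglongrightarrow> cexp f x"
    using avg avg_tendsto[OF f] by eventually_elim simp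
  moreover have "tendsto_Lp M p (backward_average M T \<rho> f) (cexp f)"
    unfolding tendsto_Lp_def
  proof (intro conjI exI[of _ "avg f"] allI)
    show "in_Lp M p (cexp f)" by (rule cexp_Lp(1)[OF assms(8,9)])
    show "in_Lp M p (avg f n)" for n by (rule avg_Lp(1)[OF assms(8,9)])
    show "AE x in M. backward_average M T \<rho> f n x = avg f n x" for n using avg by eventually_elim simp
    show "(\<lambda>n. (LINT x|M. \<bar>avg f n x - cexp f x\<bar> powr p) powr (1 / p)) \<longlonglongrightarrow> 0"
      using tendsto_powr'[OF avg_tendsto_Lp[OF assms(8,9)] tendsto_const, of "1 / p"] assms(8) by simp
  qed
  ultimately show ?thesis by blast
qed

end
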